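(* Let $k$ be a field, let $G$ be an affine group scheme over $k$, and let $\omega$ be the forgetful functor from the category of finite-dimensional representations of $G$ over $k$ to finite-dimensional $k$-vector spaces. Then there is a canonical isomorphism of group-valued functors $G\xrightarrow{\sim}\operatorname{Aut}^{\otimes}(\omega)$. Consequently, $\operatorname{Aut}^{\otimes}(\omega)$ is an affine group scheme.
   Context: An affine group scheme $G$ over $k$ is viewed as a representable functor from commutative $k$-algebras to groups; a representation of $G$ on a $k$-vector space $V$ is a natural family of group homomorphisms from $G(R)$ to the group of $R$-linear automorphisms of $V\otimes_k R$. For a commutative $k$-algebra $R$, $\omega\otimes R$ denotes the functor $V\mapsto\omega(V)\otimes_k R$ to $R$-modules. $\operatorname{Aut}^{\otimes}(\omega)$ is the functor sending $R$ to the group (under composition) of $R$-linear natural isomorphisms $\omega\otimes R\to\omega\otimes R$ that are monoidal, i.e. compatible with tensor products of representations and with the unit (the trivial representation $k$). *)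

theory Defs
  imports
    "HOL-Library.Infinite_Typeclass"
    "HOL-Algebra.Free_Abelian_Groups"
    "HOL-Algebra.Generated_Groups"
    "Jordan_Normal_Form.Missing_VectorSpace"
begin

text \<open>
  Size convention: the type \<open>'u\<close> is the universe. The field \<open>k\<close>, commutative
  \<open>k\<close>-algebras (predicate \<open>algebra k R\<close>, which includes commutativity) and the vector spaces
  in the category of representations have carriers in \<open>'u\<close>. For infinite \<open>'u\<close> this universe
  contains, up to isomorphism, all tensor products formed from its members.

  Modules are \<open>module\<close> records; in records that are only modules the ring components
  \<open>mult\<close> and \<open>one\<close> carry no meaning. A map between structures is a function on the carrier, and
  is normalised by \<open>extensional\<close> wherever equality of maps matters.
\<close>

section \<open>Tensor products\<close>

text \<open>\<open>M \<otimes> N\<close> over \<open>K\<close> is the free abelian group on pairs modulo the bilinearity and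
  balancing relations.\<close>

definition tensor_relators ::
  "('a, 'x) ring_scheme \<Rightarrow> ('a, 'm, 'y) module_scheme \<Rightarrow> ('a, 'n, 'z) module_scheme
     \<Rightarrow> (('m \<times> 'n) \<Rightarrow>\<^sub>0 int) set"
  where "tensor_relators K M N =
     {frag_of (m \<oplus>\<^bsub>M\<^esub> m', n) - frag_of (m, n) - frag_of (m', n) | m m' n.
        m \<in> carrier M \<and> m' \<in> carrier M \<and> n \<in> carrier N}
   \<union> {frag_of (m, n \<oplus>\<^bsub>N\<^esub> n') - frag_of (m, n) - frag_of (m, n') | m n n'.
        m \<in> carrier M \<and> n \<in> carrier N \<and> n' \<in> carrier N}
   \<union> {frag_of (a \<odot>\<^bsub>M\<^esub> m, n) - frag_of (m, a \<odot>\<^bsub>N\<^esub> n) | a m n.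
        a \<in> carrier K \<and> m \<in> carrier M \<and> n \<in> carrier N}"

definition tensor_kernel ::
  "('a, 'x) ring_scheme \<Rightarrow> ('a, 'm, 'y) module_scheme \<Rightarrow> ('a, 'n, 'z) module_scheme
     \<Rightarrow> (('m \<times> 'n) \<Rightarrow>\<^sub>0 int) set"
  where "tensor_kernel K M N =
     generate (free_Abelian_group (carrier M \<times> carrier N)) (tensor_relators K M N)"

definition tensor_group ::
  "('a, 'x) ring_scheme \<Rightarrow> ('a, 'm, 'y) module_scheme \<Rightarrow> ('a, 'n, 'z) module_scheme
     \<Rightarrow> (('m \<times> 'n) \<Rightarrow>\<^sub>0 int) set monoid"
  where "tensor_group K M N =
     free_Abelian_group (carrier M \<times> carrier N) Mod tensor_kernel K M N"

definition pure_tensor ::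
  "('a, 'x) ring_scheme \<Rightarrow> ('a, 'm, 'y) module_scheme \<Rightarrow> ('a, 'n, 'z) module_scheme
     \<Rightarrow> 'm \<Rightarrow> 'n \<Rightarrow> (('m \<times> 'n) \<Rightarrow>\<^sub>0 int) set"
  where "pure_tensor K M N m n =
     tensor_kernel K M N #>\<^bsub>free_Abelian_group (carrier M \<times> carrier N)\<^esub> frag_of (m, n)"

text \<open>The additive map on \<open>M \<otimes> N\<close> induced by a balanced biadditive map \<open>b\<close> into the abelian
  group \<open>P\<close> (written multiplicatively, as \<open>tensor_group\<close> is).\<close>

definition tensor_lift ::
  "('a, 'x) ring_scheme \<Rightarrow> ('a, 'm, 'y) module_scheme \<Rightarrow> ('a, 'n, 'z) module_scheme
     \<Rightarrow> ('p, 'w) monoid_scheme \<Rightarrow> ('m \<Rightarrow> 'n \<Rightarrow> 'p) \<Rightarrow> (('m \<times> 'n) \<Rightarrow>\<^sub>0 int) set \<Rightarrow> 'p"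
  where "tensor_lift K M N P b =
     (THE h. h \<in> hom (tensor_group K M N) P \<inter> extensional (carrier (tensor_group K M N)) \<and>
        (\<forall>m\<in>carrier M. \<forall>n\<in>carrier N. h (pure_tensor K M N m n) = b m n))"

definition tensor_map ::
  "('a, 'x) ring_scheme \<Rightarrow> ('a, 'm, 'y) module_scheme \<Rightarrow> ('a, 'n, 'z) module_scheme
     \<Rightarrow> ('a, 'p, 'v) module_scheme \<Rightarrow> ('a, 'q, 'w) module_scheme
     \<Rightarrow> ('m \<Rightarrow> 'p) \<Rightarrow> ('n \<Rightarrow> 'q) \<Rightarrow> (('m \<times> 'n) \<Rightarrow>\<^sub>0 int) set \<Rightarrow> (('p \<times> 'q) \<Rightarrow>\<^sub>0 int) set"
  where "tensor_map K M N P Q \<phi> \<psi> =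
     tensor_lift K M N (tensor_group K P Q) (\<lambda>m n. pure_tensor K P Q (\<phi> m) (\<psi> n))"

definition tensor_module ::
  "('a, 'x) ring_scheme \<Rightarrow> ('a, 'm, 'y) module_scheme \<Rightarrow> ('a, 'n, 'z) module_scheme
     \<Rightarrow> ('a, (('m \<times> 'n) \<Rightarrow>\<^sub>0 int) set) module"
  where "tensor_module K M N =
     \<lparr>carrier = carrier (tensor_group K M N),
      mult = (\<lambda>x y. one (tensor_group K M N)), one = one (tensor_group K M N),
      zero = one (tensor_group K M N), add = mult (tensor_group K M N),
      smult = (\<lambda>a. tensor_map K M N M N (\<lambda>m. a \<odot>\<^bsub>M\<^esub> m) (\<lambda>n. n))\<rparr>"

text \<open>\<open>V \<otimes> R\<close> over \<open>k\<close>, as a module over the \<open>k\<close>-algebra \<open>R\<close>.\<close>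

definition ext_scalars ::
  "('u, 'x) ring_scheme \<Rightarrow> ('u, 'v, 'y) module_scheme \<Rightarrow> ('u, 'u, 'z) module_scheme
     \<Rightarrow> ('u, (('v \<times> 'u) \<Rightarrow>\<^sub>0 int) set) module"
  where "ext_scalars k V R =
     (tensor_module k V R)\<lparr>smult := (\<lambda>r. tensor_map k V R V R (\<lambda>v. v) (\<lambda>s. r \<otimes>\<^bsub>R\<^esub> s))\<rparr>"

text \<open>The canonical isomorphism from \<open>(V \<otimes> R) \<otimes>\<^sub>R (W \<otimes> R)\<close> to \<open>(V \<otimes> W) \<otimes> R\<close>, which
  sends \<open>(v \<otimes> r) \<otimes> (w \<otimes> s)\<close> to \<open>(v \<otimes> w) \<otimes> r s\<close>.\<close>

definition ext_tensor_iso ::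
  "('u, 'x) ring_scheme \<Rightarrow> ('u, 'v, 'y) module_scheme \<Rightarrow> ('u, 'w, 'y2) module_scheme
     \<Rightarrow> ('u, 'u, 'z) module_scheme
     \<Rightarrow> (((('v \<times> 'u) \<Rightarrow>\<^sub>0 int) set \<times> (('w \<times> 'u) \<Rightarrow>\<^sub>0 int) set) \<Rightarrow>\<^sub>0 int) set
     \<Rightarrow> (((('v \<times> 'w) \<Rightarrow>\<^sub>0 int) set \<times> 'u) \<Rightarrow>\<^sub>0 int) set"
  where "ext_tensor_iso k V W R =
     (let VR = ext_scalars k V R; WR = ext_scalars k W R; VW = tensor_module k V W in
      THE h. h \<in> hom (tensor_group R VR WR) (tensor_group k VW R)
                   \<inter> extensional (carrier (tensor_group R VR WR)) \<and>
        (\<forall>v\<in>carrier V. \<forall>r\<in>carrier R. \<forall>w\<in>carrier W. \<forall>s\<in>carrier R.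
           h (pure_tensor R VR WR (pure_tensor k V R v r) (pure_tensor k W R w s))
             = pure_tensor k VW R (pure_tensor k V W v w) (r \<otimes>\<^bsub>R\<^esub> s)))"


section \<open>Group-valued functors on commutative algebras\<close>

definition alg_hom ::
  "('u, 'x) ring_scheme \<Rightarrow> ('u, 'u) module \<Rightarrow> ('u, 'u) module \<Rightarrow> ('u \<Rightarrow> 'u) set"
  where "alg_hom k R S = ring_hom R S \<inter> module_hom k R S \<inter> extensional (carrier R)"

record ('u, 'g) gfunctor =
  fob :: "('u, 'u) module \<Rightarrow> 'g monoid"
  fmor :: "('u, 'u) module \<Rightarrow> ('u, 'u) module \<Rightarrow> ('u \<Rightarrow> 'u) \<Rightarrow> 'g \<Rightarrow> 'g"

definition group_functor :: "'u ring \<Rightarrow> ('u, 'g) gfunctor \<Rightarrow> bool"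
  where "group_functor k F \<longleftrightarrow>
     (\<forall>R. algebra k R \<longrightarrow> group (fob F R)) \<and>
     (\<forall>R S. algebra k R \<longrightarrow> algebra k S \<longrightarrow>
        (\<forall>f\<in>alg_hom k R S. fmor F R S f \<in> hom (fob F R) (fob F S))) \<and>
     (\<forall>R. algebra k R \<longrightarrow>
        (\<forall>x\<in>carrier (fob F R). fmor F R R (\<lambda>r\<in>carrier R. r) x = x)) \<and>
     (\<forall>R S T. algebra k R \<longrightarrow> algebra k S \<longrightarrow> algebra k T \<longrightarrow>
        (\<forall>f\<in>alg_hom k R S. \<forall>g\<in>alg_hom k S T. \<forall>x\<in>carrier (fob F R).
           fmor F R T (compose (carrier R) g f) x = fmor F S T g (fmor F R S f x)))"

definition representable :: "'u ring \<Rightarrow> ('u, 'g) gfunctor \<Rightarrow> bool"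
  where "representable k F \<longleftrightarrow>
     (\<exists>A \<eta>. algebra k A \<and>
        (\<forall>R. algebra k R \<longrightarrow> bij_betw (\<eta> R) (alg_hom k A R) (carrier (fob F R))) \<and>
        (\<forall>R S. algebra k R \<longrightarrow> algebra k S \<longrightarrow>
           (\<forall>f\<in>alg_hom k R S. \<forall>u\<in>alg_hom k A R.
              \<eta> S (compose (carrier A) f u) = fmor F R S f (\<eta> R u))))"

definition affine_group_scheme :: "'u ring \<Rightarrow> ('u, 'g) gfunctor \<Rightarrow> bool"
  where "affine_group_scheme k F \<longleftrightarrow> group_functor k F \<and> representable k F"

definition gfunctor_hom ::
  "'u ring \<Rightarrow> ('u, 'g) gfunctor \<Rightarrow> ('u, 'h) gfunctor \<Rightarrow> (('u, 'u) module \<Rightarrow> 'g \<Rightarrow> 'h) \<Rightarrow> bool"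
  where "gfunctor_hom k F H \<eta> \<longleftrightarrow>
     (\<forall>R. algebra k R \<longrightarrow> \<eta> R \<in> hom (fob F R) (fob H R)) \<and>
     (\<forall>R S. algebra k R \<longrightarrow> algebra k S \<longrightarrow>
        (\<forall>f\<in>alg_hom k R S. \<forall>x\<in>carrier (fob F R).
           \<eta> S (fmor F R S f x) = fmor H R S f (\<eta> R x)))"

definition gfunctor_iso ::
  "'u ring \<Rightarrow> ('u, 'g) gfunctor \<Rightarrow> ('u, 'h) gfunctor \<Rightarrow> (('u, 'u) module \<Rightarrow> 'g \<Rightarrow> 'h) \<Rightarrow> bool"
  where "gfunctor_iso k F H \<eta> \<longleftrightarrow>
     gfunctor_hom k F H \<eta> \<and> (\<forall>R. algebra k R \<longrightarrow> \<eta> R \<in> iso (fob F R) (fob H R))"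


section \<open>Representations\<close>

definition linear_aut_group ::
  "('u, 'x) ring_scheme \<Rightarrow> ('u, 'm, 'y) module_scheme \<Rightarrow> ('m \<Rightarrow> 'm) monoid"
  where "linear_aut_group R M =
     \<lparr>carrier = {\<alpha> \<in> module_hom R M M \<inter> extensional (carrier M).
                   bij_betw \<alpha> (carrier M) (carrier M)},
      mult = compose (carrier M), one = (\<lambda>x\<in>carrier M. x)\<rparr>"

text \<open>Base change of an \<open>R\<close>-linear endomorphism \<open>\<alpha>\<close> of \<open>V \<otimes> R\<close> along \<open>f : R \<rightarrow> S\<close>, with
  \<open>(V \<otimes> R) \<otimes>\<^sub>R S\<close> identified with \<open>V \<otimes> S\<close>: since the image of \<open>V \<otimes> f\<close> generates
  \<open>V \<otimes> S\<close> over \<open>S\<close>, it is the unique \<open>S\<close>-linear map commuting with \<open>\<alpha>\<close> along \<open>V \<otimes> f\<close>.\<close>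

definition base_change ::
  "'u ring \<Rightarrow> ('u, 'v) module \<Rightarrow> ('u, 'u) module \<Rightarrow> ('u, 'u) module \<Rightarrow> ('u \<Rightarrow> 'u)
     \<Rightarrow> ((('v \<times> 'u) \<Rightarrow>\<^sub>0 int) set \<Rightarrow> (('v \<times> 'u) \<Rightarrow>\<^sub>0 int) set)
     \<Rightarrow> ((('v \<times> 'u) \<Rightarrow>\<^sub>0 int) set \<Rightarrow> (('v \<times> 'u) \<Rightarrow>\<^sub>0 int) set)"
  where "base_change k V R S f \<alpha> =
     (let Vf = tensor_map k V R V S (\<lambda>v. v) f in
      THE \<beta>. \<beta> \<in> module_hom S (ext_scalars k V S) (ext_scalars k V S)
                   \<inter> extensional (carrier (ext_scalars k V S)) \<and>
        (\<forall>x\<in>carrier (ext_scalars k V R). \<beta> (Vf x) = Vf (\<alpha> x)))"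

definition GL_functor ::
  "'u ring \<Rightarrow> ('u, 'v) module
     \<Rightarrow> ('u, (('v \<times> 'u) \<Rightarrow>\<^sub>0 int) set \<Rightarrow> (('v \<times> 'u) \<Rightarrow>\<^sub>0 int) set) gfunctor"
  where "GL_functor k V =
     \<lparr>fob = (\<lambda>R. linear_aut_group R (ext_scalars k V R)), fmor = base_change k V\<rparr>"

record ('u, 'v, 'g) rep =
  space :: "('u, 'v) module"
  act :: "('u, 'u) module \<Rightarrow> 'g \<Rightarrow> (('v \<times> 'u) \<Rightarrow>\<^sub>0 int) set \<Rightarrow> (('v \<times> 'u) \<Rightarrow>\<^sub>0 int) set"

definition representation :: "'u ring \<Rightarrow> ('u, 'g) gfunctor \<Rightarrow> ('u, 'v, 'g) rep \<Rightarrow> bool"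
  where "representation k G X \<longleftrightarrow>
     vectorspace k (space X) \<and> gfunctor_hom k G (GL_functor k (space X)) (act X)"

definition Rep :: "'u ring \<Rightarrow> ('u, 'g) gfunctor \<Rightarrow> ('u, 'u, 'g) rep set"
  where "Rep k G = {X. representation k G X \<and> vectorspace.fin_dim k (space X)}"

text \<open>\<open>\<omega> \<otimes> R\<close>, where \<open>\<omega>\<close> is the forgetful functor, on objects and on morphisms.\<close>

definition fibre ::
  "'u ring \<Rightarrow> ('u, 'u) module \<Rightarrow> ('u, 'v, 'g) rep \<Rightarrow> ('u, (('v \<times> 'u) \<Rightarrow>\<^sub>0 int) set) module"
  where "fibre k R X = ext_scalars k (space X) R"

definition fibre_map ::
  "'u ring \<Rightarrow> ('u, 'u) module \<Rightarrow> ('u, 'v, 'g) rep \<Rightarrow> ('u, 'w, 'g) rep \<Rightarrow> ('v \<Rightarrow> 'w)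
     \<Rightarrow> (('v \<times> 'u) \<Rightarrow>\<^sub>0 int) set \<Rightarrow> (('w \<times> 'u) \<Rightarrow>\<^sub>0 int) set"
  where "fibre_map k R X Y \<phi> = tensor_map k (space X) R (space Y) R \<phi> (\<lambda>r. r)"

definition rep_hom ::
  "'u ring \<Rightarrow> ('u, 'g) gfunctor \<Rightarrow> ('u, 'v, 'g) rep \<Rightarrow> ('u, 'w, 'g) rep \<Rightarrow> ('v \<Rightarrow> 'w) set"
  where "rep_hom k G X Y =
     {\<phi> \<in> module_hom k (space X) (space Y).
        \<forall>R. algebra k R \<longrightarrow> (\<forall>g\<in>carrier (fob G R). \<forall>x\<in>carrier (fibre k R X).
           fibre_map k R X Y \<phi> (act X R g x) = act Y R g (fibre_map k R X Y \<phi> x))}"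

definition rep_iso ::
  "'u ring \<Rightarrow> ('u, 'g) gfunctor \<Rightarrow> ('u, 'v, 'g) rep \<Rightarrow> ('u, 'w, 'g) rep \<Rightarrow> ('v \<Rightarrow> 'w) set"
  where "rep_iso k G X Y =
     {\<phi> \<in> rep_hom k G X Y. bij_betw \<phi> (carrier (space X)) (carrier (space Y))}"

definition tensor_rep ::
  "'u ring \<Rightarrow> ('u, 'v, 'g) rep \<Rightarrow> ('u, 'w, 'g) rep \<Rightarrow> ('u, (('v \<times> 'w) \<Rightarrow>\<^sub>0 int) set, 'g) rep"
  where "tensor_rep k X Y =
     \<lparr>space = tensor_module k (space X) (space Y),
      act = (\<lambda>R g.
        let XR = fibre k R X; YR = fibre k R Y;
            J = ext_tensor_iso k (space X) (space Y) R
        in (\<lambda>z\<in>carrier (ext_scalars k (tensor_module k (space X) (space Y)) R).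
             J (tensor_map R XR YR XR YR (act X R g) (act Y R g)
                  (inv_into (carrier (tensor_module R XR YR)) J z))))\<rparr>"

definition base_space :: "'u ring \<Rightarrow> ('u, 'u) module"
  where "base_space k =
     \<lparr>carrier = carrier k, mult = mult k, one = one k, zero = zero k, add = add k,
      smult = mult k\<rparr>"

definition unit_rep :: "'u ring \<Rightarrow> ('u, 'u, 'g) rep"
  where "unit_rep k =
     \<lparr>space = base_space k,
      act = (\<lambda>R g. \<lambda>x\<in>carrier (ext_scalars k (base_space k) R). x)\<rparr>"


section \<open>Monoidal automorphisms of the fibre functor\<close>

definition natural_aut ::
  "'u ring \<Rightarrow> ('u, 'g) gfunctor \<Rightarrow> ('u, 'u) module
     \<Rightarrow> (('u, 'u, 'g) rep \<Rightarrow> (('u \<times> 'u) \<Rightarrow>\<^sub>0 int) set \<Rightarrow> (('u \<times> 'u) \<Rightarrow>\<^sub>0 int) set) \<Rightarrow> bool"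
  where "natural_aut k G R \<theta> \<longleftrightarrow>
     (\<forall>X\<in>Rep k G. \<theta> X \<in> carrier (linear_aut_group R (fibre k R X))) \<and>
     (\<forall>X\<in>Rep k G. \<forall>Y\<in>Rep k G. \<forall>\<phi>\<in>rep_hom k G X Y. \<forall>x\<in>carrier (fibre k R X).
        \<theta> Y (fibre_map k R X Y \<phi> x) = fibre_map k R X Y \<phi> (\<theta> X x))"

text \<open>The carrier of \<open>tensor_rep k X Y\<close> is not in the universe, so the tensor product of \<open>X\<close> and
  \<open>Y\<close> within \<open>Rep k G\<close> is any \<open>T\<close> with an isomorphism \<open>\<phi>\<close> from \<open>tensor_rep k X Y\<close>; by
  naturality the condition does not depend on the choice of \<open>T\<close> and \<open>\<phi>\<close>. The unit
  constraint of \<open>\<omega> \<otimes> R\<close> is the map from \<open>R\<close> to \<open>k \<otimes> R\<close> sending \<open>r\<close> to \<open>1 \<otimes> r\<close>.\<close>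

definition monoidal ::
  "'u ring \<Rightarrow> ('u, 'g) gfunctor \<Rightarrow> ('u, 'u) module
     \<Rightarrow> (('u, 'u, 'g) rep \<Rightarrow> (('u \<times> 'u) \<Rightarrow>\<^sub>0 int) set \<Rightarrow> (('u \<times> 'u) \<Rightarrow>\<^sub>0 int) set) \<Rightarrow> bool"
  where "monoidal k G R \<theta> \<longleftrightarrow>
     (\<forall>X\<in>Rep k G. \<forall>Y\<in>Rep k G. \<forall>T\<in>Rep k G. \<forall>\<phi>\<in>rep_iso k G (tensor_rep k X Y) T.
        let XR = fibre k R X; YR = fibre k R Y;
            J = (\<lambda>z. fibre_map k R (tensor_rep k X Y) T \<phi>
                       (ext_tensor_iso k (space X) (space Y) R z))
        in \<forall>z\<in>carrier (tensor_module R XR YR).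
             \<theta> T (J z) = J (tensor_map R XR YR XR YR (\<theta> X) (\<theta> Y) z)) \<and>
     (\<forall>r\<in>carrier R.
        \<theta> (unit_rep k) (pure_tensor k (base_space k) R (one k) r)
          = pure_tensor k (base_space k) R (one k) r)"

definition Aut_tensor ::
  "'u ring \<Rightarrow> ('u, 'g) gfunctor
     \<Rightarrow> ('u, ('u, 'u, 'g) rep \<Rightarrow> (('u \<times> 'u) \<Rightarrow>\<^sub>0 int) set \<Rightarrow> (('u \<times> 'u) \<Rightarrow>\<^sub>0 int) set) gfunctor"
  where "Aut_tensor k G =
     \<lparr>fob = (\<lambda>R.
        \<lparr>carrier = {\<theta> \<in> extensional (Rep k G). natural_aut k G R \<theta> \<and> monoidal k G R \<theta>},
         mult = (\<lambda>\<theta> \<mu>. \<lambda>X\<in>Rep k G. compose (carrier (fibre k R X)) (\<theta> X) (\<mu> X)),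
         one = (\<lambda>X\<in>Rep k G. \<lambda>x\<in>carrier (fibre k R X). x)\<rparr>),
      fmor = (\<lambda>R S f \<theta>. \<lambda>X\<in>Rep k G. base_change k (space X) R S f (\<theta> X))\<rparr>"

text \<open>The canonical map sends \<open>g\<close> in \<open>G(R)\<close> to the family of its actions on all
  representations.\<close>

definition canonical_map ::
  "'u ring \<Rightarrow> ('u, 'g) gfunctor \<Rightarrow> ('u, 'u) module \<Rightarrow> 'g
     \<Rightarrow> ('u, 'u, 'g) rep \<Rightarrow> (('u \<times> 'u) \<Rightarrow>\<^sub>0 int) set \<Rightarrow> (('u \<times> 'u) \<Rightarrow>\<^sub>0 int) set"
  where "canonical_map k G R g = (\<lambda>X\<in>Rep k G. act X R g)"

end

theory Submission
  imports Defs
begin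

text \<open>
  Tannaka reconstruction. Let \<open>A\<close> represent \<open>G\<close>, so that elements of \<open>A\<close> are functions on \<open>G\<close>
  and \<open>G(R)\<close> is the set of algebra homomorphisms from \<open>A\<close> to \<open>R\<close>. Every function lies in a
  finite-dimensional space of functions that is stable under right translation, hence in a
  representation \<open>reg V\<close> with \<open>V \<subseteq> A\<close>. A monoidal automorphism \<open>\<theta>\<close> over \<open>R\<close> therefore
  gives a map from \<open>A\<close> to \<open>R\<close>, sending \<open>v \<in> V\<close> to the value of \<open>\<theta>\<^bsub>reg V\<^esub> (v \<otimes> 1)\<close> at the
  unit of \<open>G\<close>. Naturality for inclusions makes it well defined and linear, compatibility with
  tensor products and the unit makes it an algebra homomorphism, that is, a point \<open>g\<close> of
  \<open>G(R)\<close>. Matrix coefficients map any representation \<open>X\<close> equivariantly to regular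
  representations and separate the elements of \<open>X \<otimes> R\<close>, so \<open>\<theta>\<close> agrees with the action of \<open>g\<close>
  on every \<open>X\<close>.
\<close>

section \<open>Additive maps and tensor products\<close>

text \<open>Coalgebra axioms for \<open>A\<close> are never stated. The group law on points
  (\<open>pm\<close>, \<open>pe\<close>) stands in for comultiplication and counit, and a tensor in
  V \<otimes> R is handled through its values \<open>hat V R S h f z\<close> at all points. These
  determine the tensor: over the coproduct of \<open>A\<close> and \<open>R\<close>, with its
  coprojections as points, the value is the tensor itself (\<open>hat_eqI\<close>). Identities
  between actions on regular representations thus become associativity and unit laws for points. Two
  obstacles shape the rest. \<open>G\<close> and \<open>Rep\<close> live in the universe, whereas
  tensor products are carried by sets of cosets; as the universe is infinite, the coproduct algebra
  and the tensor product of two representations can be copied back into it. And local finiteness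
  must be extracted from points: in a shortest expression of the comultiplication of
  \<open>a\<close> as a sum of pure tensors, each right factor is a contraction of the whole by a
  functional, and associativity makes the right factors span a stable subspace. The functionals come
  from Zorn's lemma, and this is where division in \<open>k\<close> is used.\<close>

definition amap :: "('a, 'x) ring_scheme \<Rightarrow> ('b, 'y) ring_scheme \<Rightarrow> ('a \<Rightarrow> 'b) \<Rightarrow> bool"
  where "amap M N h \<longleftrightarrow> h \<in> carrier M \<rightarrow> carrier N \<and>
     (\<forall>x\<in>carrier M. \<forall>y\<in>carrier M. h (x \<oplus>\<^bsub>M\<^esub> y) = h x \<oplus>\<^bsub>N\<^esub> h y)"

lemma amapI:
  assumes "\<And>x. x \<in> carrier M \<Longrightarrow> h x \<in> carrier N"
    and "\<And>x y. x \<in> carrier M \<Longrightarrow> y \<in> carrier M \<Longrightarrow> h (x \<oplus>\<^bsub>M\<^esub> y) = h x \<oplus>\<^bsub>N\<^esub> h y"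
  shows "amap M N h"
  using assms by (auto simp: amap_def)

lemma amap_closed: "amap M N h \<Longrightarrow> x \<in> carrier M \<Longrightarrow> h x \<in> carrier N"
  by (auto simp: amap_def)

lemma amap_add:
  "amap M N h \<Longrightarrow> x \<in> carrier M \<Longrightarrow> y \<in> carrier M \<Longrightarrow> h (x \<oplus>\<^bsub>M\<^esub> y) = h x \<oplus>\<^bsub>N\<^esub> h y"
  by (auto simp: amap_def)

lemma amap_iff_hom: "amap M N h \<longleftrightarrow> h \<in> hom (add_monoid M) (add_monoid N)"
  by (auto simp: amap_def hom_def)

lemma amap_zero:
  assumes "abelian_group M" "abelian_group N" "amap M N h"
  shows "h \<zero>\<^bsub>M\<^esub> = \<zero>\<^bsub>N\<^esub>"
  using hom_one[of h "add_monoid M" "add_monoid N"] assms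
  by (simp add: amap_iff_hom abelian_group.a_group)

lemma amap_minus:
  assumes "abelian_group M" "abelian_group N" "amap M N h" "x \<in> carrier M"
  shows "h (\<ominus>\<^bsub>M\<^esub> x) = \<ominus>\<^bsub>N\<^esub> h x"
proof -
  interpret group_hom "add_monoid M" "add_monoid N" h
    using assms by (simp add: amap_iff_hom abelian_group.a_group group_hom_def group_hom_axioms_def)
  show ?thesis using hom_inv[of x] assms by (simp add: a_inv_def)
qed

lemma amap_comp: "amap M N f \<Longrightarrow> amap N P g \<Longrightarrow> amap M P (\<lambda>x. g (f x))"
  by (auto simp: amap_def Pi_iff)

lemma amap_id: "amap M M (\<lambda>x. x)"
  by (simp add: amap_def)

lemma module_hom_iff:
  "h \<in> module_hom K M N \<longleftrightarrow> amap M N h \<and>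
     (\<forall>a\<in>carrier K. \<forall>x\<in>carrier M. h (a \<odot>\<^bsub>M\<^esub> x) = a \<odot>\<^bsub>N\<^esub> h x)"
  by (auto simp: module_hom_def amap_def)

lemma module_homI:
  assumes "amap M N h"
    and "\<And>a x. a \<in> carrier K \<Longrightarrow> x \<in> carrier M \<Longrightarrow> h (a \<odot>\<^bsub>M\<^esub> x) = a \<odot>\<^bsub>N\<^esub> h x"
  shows "h \<in> module_hom K M N"
  using assms by (auto simp: module_hom_iff)

lemma module_hom_amap: "h \<in> module_hom K M N \<Longrightarrow> amap M N h"
  by (simp add: module_hom_iff)

lemma module_hom_in: "h \<in> module_hom K M N \<Longrightarrow> x \<in> carrier M \<Longrightarrow> h x \<in> carrier N"
  by (auto simp: module_hom_def)

section \<open>Balanced maps and the universal property of the tensor product\<close>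

definition balanced ::
  "('a, 'x) ring_scheme \<Rightarrow> ('a, 'm, 'y) module_scheme \<Rightarrow> ('a, 'n, 'z) module_scheme
     \<Rightarrow> ('p, 'w) ring_scheme \<Rightarrow> ('m \<Rightarrow> 'n \<Rightarrow> 'p) \<Rightarrow> bool"
  where "balanced K M N P b \<longleftrightarrow>
     (\<forall>n\<in>carrier N. amap M P (\<lambda>m. b m n)) \<and> (\<forall>m\<in>carrier M. amap N P (b m)) \<and>
     (\<forall>a\<in>carrier K. \<forall>m\<in>carrier M. \<forall>n\<in>carrier N. b (a \<odot>\<^bsub>M\<^esub> m) n = b m (a \<odot>\<^bsub>N\<^esub> n))"

lemma balancedI:
  assumes "\<And>m n. m \<in> carrier M \<Longrightarrow> n \<in> carrier N \<Longrightarrow> b m n \<in> carrier P"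
    and "\<And>m m' n. m \<in> carrier M \<Longrightarrow> m' \<in> carrier M \<Longrightarrow> n \<in> carrier N
      \<Longrightarrow> b (m \<oplus>\<^bsub>M\<^esub> m') n = b m n \<oplus>\<^bsub>P\<^esub> b m' n"
    and "\<And>m n n'. m \<in> carrier M \<Longrightarrow> n \<in> carrier N \<Longrightarrow> n' \<in> carrier N
      \<Longrightarrow> b m (n \<oplus>\<^bsub>N\<^esub> n') = b m n \<oplus>\<^bsub>P\<^esub> b m n'"
    and "\<And>a m n. a \<in> carrier K \<Longrightarrow> m \<in> carrier M \<Longrightarrow> n \<in> carrier N
      \<Longrightarrow> b (a \<odot>\<^bsub>M\<^esub> m) n = b m (a \<odot>\<^bsub>N\<^esub> n)"
  shows "balanced K M N P b"
  using assms by (auto simp: balanced_def amap_def)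

lemma balanced_amap1: "balanced K M N P b \<Longrightarrow> n \<in> carrier N \<Longrightarrow> amap M P (\<lambda>m. b m n)"
  and balanced_amap2: "balanced K M N P b \<Longrightarrow> m \<in> carrier M \<Longrightarrow> amap N P (b m)"
  and balanced_smult: "balanced K M N P b \<Longrightarrow> a \<in> carrier K \<Longrightarrow> m \<in> carrier M \<Longrightarrow> n \<in> carrier N
    \<Longrightarrow> b (a \<odot>\<^bsub>M\<^esub> m) n = b m (a \<odot>\<^bsub>N\<^esub> n)"
  by (auto simp: balanced_def)

text \<open>\<open>tensor_lift\<close> with the target written additively, so that it may be a ring
  or a module. No action of \<open>K\<close> on \<open>P\<close> is involved; a tensor product over
  one ring can therefore be mapped into a tensor product over another, as \<open>J_pair\<close>
  requires.\<close>

definition tlift ::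
  "('a, 'x) ring_scheme \<Rightarrow> ('a, 'm, 'y) module_scheme \<Rightarrow> ('a, 'n, 'z) module_scheme
     \<Rightarrow> ('p, 'w) ring_scheme \<Rightarrow> ('m \<Rightarrow> 'n \<Rightarrow> 'p) \<Rightarrow> (('m \<times> 'n) \<Rightarrow>\<^sub>0 int) set \<Rightarrow> 'p"
  where "tlift K M N P b = tensor_lift K M N (add_monoid P) b"

lemma hom_tensor_group:
  "hom (tensor_group K M N) (add_monoid P) = {h. amap (tensor_module K M N) P h}"
  by (auto simp: tensor_module_def hom_def amap_def)

lemma carrier_tensor_module [simp]: "carrier (tensor_module K M N) = carrier (tensor_group K M N)"
  by (simp add: tensor_module_def)

lemma ext_scalars_simps [simp]:
  "carrier (ext_scalars k V R) = carrier (tensor_group k V R)"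
  "add (ext_scalars k V R) = add (tensor_module k V R)"
  "zero (ext_scalars k V R) = zero (tensor_module k V R)"
  by (simp_all add: ext_scalars_def)

locale tensor_pair =
  fixes K :: "('a, 'x) ring_scheme" and M :: "('a, 'm, 'y) module_scheme"
    and N :: "('a, 'n, 'z) module_scheme"
  assumes M: "module K M" and N: "module K N"
begin

sublocale M: module K M by (rule M)
sublocale N: module K N by (rule N)

abbreviation "FA \<equiv> free_Abelian_group (carrier M \<times> carrier N)"
abbreviation "Z \<equiv> tensor_module K M N"
abbreviation pt where "pt \<equiv> pure_tensor K M N"

lemma FA_diff: "x \<in> carrier FA \<Longrightarrow> y \<in> carrier FA \<Longrightarrow> x - y \<in> carrier FA"
  using keys_diff[of x y] by auto

lemma relators_subset: "tensor_relators K M N \<subseteq> carrier FA"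
  unfolding tensor_relators_def
  by (auto simp del: carrier_free_Abelian_group_iff intro!: FA_diff)

lemma FA_group: "group FA" and FA_comm: "comm_group FA"
  by (simp_all add: abelian_free_Abelian_group)

lemma kernel_subgroup: "subgroup (tensor_kernel K M N) FA"
  unfolding tensor_kernel_def
  by (rule group.generate_is_subgroup[OF FA_group relators_subset])

lemma kernel_normal: "tensor_kernel K M N \<lhd> FA"
  by (simp add: FA_comm comm_group.normal_iff_subgroup kernel_subgroup)

lemma tensor_comm_group: "comm_group (tensor_group K M N)"
  unfolding tensor_group_def by (rule comm_group.abelian_FactGroup[OF FA_comm kernel_subgroup])

lemma tensor_abelian_group: "abelian_group Z"
proof -
  interpret T: comm_group "tensor_group K M N" by (rule tensor_comm_group)
  show ?thesis
  proof (rule abelian_groupI, goal_cases)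
    case (4 x y)
    then show ?case using T.m_comm[of x y] by (simp add: tensor_module_def)
  next
    case (6 x)
    then show ?case using T.l_inv[of x] T.inv_closed[of x] by (auto simp: tensor_module_def)
  qed (simp_all add: tensor_module_def T.m_assoc)
qed

sublocale Z: abelian_group Z by (rule tensor_abelian_group)

lemma coset_in: "x \<in> carrier FA \<Longrightarrow> tensor_kernel K M N #>\<^bsub>FA\<^esub> x \<in> carrier (tensor_group K M N)"
  unfolding tensor_group_def FactGroup_def by (auto simp: RCOSETS_def)

lemma coset_add:
  "x \<in> carrier FA \<Longrightarrow> y \<in> carrier FA \<Longrightarrow>
   (tensor_kernel K M N #>\<^bsub>FA\<^esub> x) \<oplus>\<^bsub>Z\<^esub> (tensor_kernel K M N #>\<^bsub>FA\<^esub> y)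
     = tensor_kernel K M N #>\<^bsub>FA\<^esub> (x + y)"
  using normal.rcos_sum[OF kernel_normal, of x y]
  by (simp add: tensor_module_def tensor_group_def FactGroup_def)

lemma coset_eq:
  assumes "x \<in> carrier FA" "y \<in> carrier FA" "x - y \<in> tensor_kernel K M N"
  shows "tensor_kernel K M N #>\<^bsub>FA\<^esub> x = tensor_kernel K M N #>\<^bsub>FA\<^esub> y"
proof -
  have "x \<in> tensor_kernel K M N #>\<^bsub>FA\<^esub> y"
    unfolding r_coset_def using assms(3) by (auto intro!: bexI[of _ "x - y"])
  then show ?thesis
    by (metis group.repr_independence FA_group kernel_subgroup assms(2))
qed

lemma relator_in: "x \<in> tensor_relators K M N \<Longrightarrow> x \<in> tensor_kernel K M N"
  unfolding tensor_kernel_def by (rule generate.incl)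

lemma pt_closed [simp, intro]:
  "m \<in> carrier M \<Longrightarrow> n \<in> carrier N \<Longrightarrow> pt m n \<in> carrier (tensor_group K M N)"
  unfolding pure_tensor_def by (rule coset_in) simp

lemma pt_add1:
  assumes "m \<in> carrier M" "m' \<in> carrier M" "n \<in> carrier N"
  shows "pt (m \<oplus>\<^bsub>M\<^esub> m') n = pt m n \<oplus>\<^bsub>Z\<^esub> pt m' n"
  unfolding pure_tensor_def using assms
  by (subst coset_add, simp, simp, intro coset_eq relator_in)
    (auto simp: tensor_relators_def diff_diff_eq intro!: order_trans[OF keys_add] Un_least)

lemma pt_add2:
  assumes "m \<in> carrier M" "n \<in> carrier N" "n' \<in> carrier N"
  shows "pt m (n \<oplus>\<^bsub>N\<^esub> n') = pt m n \<oplus>\<^bsub>Z\<^esub> pt m n'"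
  unfolding pure_tensor_def using assms
  by (subst coset_add, simp, simp, intro coset_eq relator_in)
    (auto simp: tensor_relators_def diff_diff_eq intro!: order_trans[OF keys_add] Un_least)

lemma pt_smult:
  assumes "a \<in> carrier K" "m \<in> carrier M" "n \<in> carrier N"
  shows "pt (a \<odot>\<^bsub>M\<^esub> m) n = pt m (a \<odot>\<^bsub>N\<^esub> n)"
  unfolding pure_tensor_def using assms
  by (intro coset_eq relator_in) (auto simp: tensor_relators_def)

lemma pt_balanced: "balanced K M N Z pt"
  by (rule balancedI) (simp_all add: pt_add1 pt_add2 pt_smult)

lemma pt_zero1: "n \<in> carrier N \<Longrightarrow> pt \<zero>\<^bsub>M\<^esub> n = \<zero>\<^bsub>Z\<^esub>"
  using amap_zero[OF M.abelian_group_axioms tensor_abelian_group balanced_amap1[OF pt_balanced]] .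

lemma pt_zero2: "m \<in> carrier M \<Longrightarrow> pt m \<zero>\<^bsub>N\<^esub> = \<zero>\<^bsub>Z\<^esub>"
  using amap_zero[OF N.abelian_group_axioms tensor_abelian_group balanced_amap2[OF pt_balanced]] .

lemma pt_minus1: "m \<in> carrier M \<Longrightarrow> n \<in> carrier N \<Longrightarrow> pt (\<ominus>\<^bsub>M\<^esub> m) n = \<ominus>\<^bsub>Z\<^esub> pt m n"
  using amap_minus[OF M.abelian_group_axioms tensor_abelian_group balanced_amap1[OF pt_balanced]] .

text \<open>Neither zero nor negatives need a case of their own: zero is the pure tensor of two
  zeros, and the negative of a pure tensor is again pure, with the sign moved into the left
  factor.\<close>

lemma tensor_induct [consumes 1, case_names pure add]:
  assumes z: "z \<in> carrier (tensor_group K M N)"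
    and pure: "\<And>m n. m \<in> carrier M \<Longrightarrow> n \<in> carrier N \<Longrightarrow> P (pt m n)"
    and add: "\<And>x y. x \<in> carrier (tensor_group K M N) \<Longrightarrow> y \<in> carrier (tensor_group K M N)
      \<Longrightarrow> P x \<Longrightarrow> P y \<Longrightarrow> P (x \<oplus>\<^bsub>Z\<^esub> y)"
  shows "P z"
proof -
  let ?c = "\<lambda>x. tensor_kernel K M N #>\<^bsub>FA\<^esub> x"
  \<comment> \<open>Both signs are carried along because the induction on the free group forms
    differences.\<close>
  have "P (?c x) \<and> P (?c (- x))" if "Poly_Mapping.keys x \<subseteq> carrier M \<times> carrier N" for x
  proof (rule free_Abelian_group_induct[where P = "\<lambda>x. P (?c x) \<and> P (?c (- x))", OF that],
      goal_cases)
    case 1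
    have "?c 0 = pt \<zero>\<^bsub>M\<^esub> \<zero>\<^bsub>N\<^esub>"
      using pt_zero1[of "\<zero>\<^bsub>N\<^esub>"] group.coset_mult_one[OF FA_group, of "tensor_kernel K M N"]
        subgroup.subset[OF kernel_subgroup]
      by (simp add: tensor_module_def tensor_group_def FactGroup_def)
    then show ?case using pure by simp
  next
    case (2 x y)
    have "x - y = x + - y" "- (x - y) = - x + y" by simp_all
    then show ?case
      using 2 coset_add[of x "- y"] coset_add[of "- x" y] add coset_in[of x] coset_in[of "-x"]
        coset_in[of y] coset_in[of "-y"] by (metis carrier_free_Abelian_group_iff keys_minus)
  next
    case (3 p)
    then obtain m n where p: "p = (m, n)" "m \<in> carrier M" "n \<in> carrier N" by auto
    have 1: "?c (frag_of p) = pt m n" by (simp add: p pure_tensor_def)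
    have "?c (- frag_of p) \<oplus>\<^bsub>Z\<^esub> ?c (frag_of p) = \<zero>\<^bsub>Z\<^esub>"
      using p coset_add[of "- frag_of p" "frag_of p"]
        group.coset_mult_one[OF FA_group, of "tensor_kernel K M N"]
        subgroup.subset[OF kernel_subgroup]
      by (simp add: tensor_module_def tensor_group_def FactGroup_def)
    then have "?c (- frag_of p) = \<ominus>\<^bsub>Z\<^esub> pt m n"
      using p 1 by (intro Z.minus_equality[symmetric]) (auto intro: coset_in)
    then have 2: "?c (- frag_of p) = pt (\<ominus>\<^bsub>M\<^esub> m) n"
      using p by (simp add: pt_minus1)
    show ?case unfolding 1 2 using p pure by simp
  qed
  moreover obtain x where "x \<in> carrier FA" "z = ?c x"
    using z unfolding tensor_group_def FactGroup_def RCOSETS_def by auto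
  ultimately show ?thesis by simp
qed

text \<open>Additivity suffices for pure tensors to determine a map, whatever rings act on the two
  sides. Most identities between tensors below are reduced to pure tensors by this rule.\<close>

lemma amap_tensor_eqI:
  assumes "amap Z P h" "amap Z P h'" "z \<in> carrier (tensor_group K M N)"
    and "\<And>m n. m \<in> carrier M \<Longrightarrow> n \<in> carrier N \<Longrightarrow> h (pt m n) = h' (pt m n)"
  shows "h z = h' z"
  using assms(3)
  by (induction z rule: tensor_induct)
    (use assms in \<open>simp_all add: amap_add[where M = Z]\<close>)

text \<open>Freeness extends \<open>b\<close> to formal sums of pairs. Balancedness puts every
  relator into the kernel of this extension, so it factors through the quotient.\<close>

lemma tlift_exists:
  assumes P: "abelian_group P" and b: "balanced K M N P b"
  obtains h where "amap Z P h" "\<And>m n. m \<in> carrier M \<Longrightarrow> n \<in> carrier N \<Longrightarrow> h (pt m n) = b m n"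
proof -
  interpret P: abelian_group P by fact
  note b1 = balanced_amap1[OF b] and b2 = balanced_amap2[OF b]
  have "(\<lambda>(m, n). b m n) ` (carrier M \<times> carrier N) \<subseteq> carrier (add_monoid P)"
    using amap_closed[OF b1] by auto
  from comm_group.free_Abelian_group_universal[OF P.a_comm_group this]
  obtain f where f: "f \<in> hom FA (add_monoid P)"
    "\<And>x. x \<in> carrier M \<times> carrier N \<Longrightarrow> f (frag_of x) = (case x of (m, n) \<Rightarrow> b m n)" by metis
  interpret f: group_hom FA "add_monoid P" f
    using f FA_group P.a_group by (simp add: group_hom_def group_hom_axioms_def)
  have minus: "f (x - y) = f x \<ominus>\<^bsub>P\<^esub> f y" if "x \<in> carrier FA" "y \<in> carrier FA" for x y
    using that f.hom_mult[of x "- y"] f.hom_inv[of y]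
    by (simp add: a_minus_def a_inv_def)
  have fin: "frag_of (m, n) \<in> carrier FA" if "m \<in> carrier M" "n \<in> carrier N" for m n
    using that by simp
  have cancel: "p \<oplus>\<^bsub>P\<^esub> q \<ominus>\<^bsub>P\<^esub> p \<ominus>\<^bsub>P\<^esub> q = \<zero>\<^bsub>P\<^esub>" if "p \<in> carrier P" "q \<in> carrier P" for p q
  proof -
    have "p \<oplus>\<^bsub>P\<^esub> q \<ominus>\<^bsub>P\<^esub> p \<ominus>\<^bsub>P\<^esub> q = (p \<oplus>\<^bsub>P\<^esub> q) \<oplus>\<^bsub>P\<^esub> \<ominus>\<^bsub>P\<^esub> (p \<oplus>\<^bsub>P\<^esub> q)"
      using that by (simp add: P.minus_eq P.a_assoc P.minus_add)
    then show ?thesis using that by (simp add: P.r_neg)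
  qed
  have key: "tensor_relators K M N \<subseteq> kernel FA (add_monoid P) f"
  proof
    fix x assume x: "x \<in> tensor_relators K M N"
    then have xc: "x \<in> carrier FA" using relators_subset by blast
    have bc: "b m n \<in> carrier P" if "m \<in> carrier M" "n \<in> carrier N" for m n
      using that amap_closed[OF b1] by auto
    have d: "frag_of p - frag_of q \<in> carrier FA"
      if "p \<in> carrier M \<times> carrier N" "q \<in> carrier M \<times> carrier N" for p q
      using that by (intro FA_diff) auto
    have "f x = \<zero>\<^bsub>P\<^esub>"
      using x unfolding tensor_relators_def
      apply (elim UnE)
      subgoal
        by (clarsimp simp: minus d fin f(2) amap_add[OF b1] bc cancel
            simp del: carrier_free_Abelian_group_iff frag_of_in_free_Abelian_group)
      subgoal
        by (clarsimp simp: minus d fin f(2) amap_add[OF b2] bc cancel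
            simp del: carrier_free_Abelian_group_iff frag_of_in_free_Abelian_group)
      subgoal
        by (clarsimp simp: minus d fin f(2) bc P.r_neg P.minus_eq balanced_smult[OF b]
            simp del: carrier_free_Abelian_group_iff frag_of_in_free_Abelian_group)
      done
    then show "x \<in> kernel FA (add_monoid P) f" using xc by (simp add: kernel_def)
  qed
  have "tensor_kernel K M N \<subseteq> kernel FA (add_monoid P) f"
    unfolding tensor_kernel_def
    by (rule group.generate_subgroup_incl[OF FA_group key f.subgroup_kernel])
  obtain g where g: "g \<in> hom (FA Mod tensor_kernel K M N) (add_monoid P)"
    "\<And>x. x \<in> carrier FA \<Longrightarrow> g (tensor_kernel K M N #>\<^bsub>FA\<^esub> x) = f x"
    using f.FactGroup_universal_kernel[OF kernel_normal \<open>tensor_kernel K M N \<subseteq> _\<close>] by metis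
  show thesis
  proof (rule that[of g])
    show "amap Z P g" using g(1) by (simp add: hom_tensor_group flip: tensor_group_def)
    show "g (pt m n) = b m n" if "m \<in> carrier M" "n \<in> carrier N" for m n
      using that by (simp add: pure_tensor_def g(2) f(2))
  qed
qed

text \<open>The definite description in \<open>tensor_lift\<close> is met by exactly one map: pure
  tensors fix the values on the carrier and the extensionality requirement fixes them
  elsewhere.\<close>

lemma tlift_props:
  assumes P: "abelian_group P" and b: "balanced K M N P b"
  shows tlift_amap: "amap Z P (tlift K M N P b)"
    and tlift_pt: "\<And>m n. m \<in> carrier M \<Longrightarrow> n \<in> carrier N \<Longrightarrow> tlift K M N P b (pt m n) = b m n"
    and tlift_ext: "tlift K M N P b \<in> extensional (carrier (tensor_group K M N))"
proof -
  let ?P = "\<lambda>h. h \<in> hom (tensor_group K M N) (add_monoid P)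
      \<inter> extensional (carrier (tensor_group K M N)) \<and>
        (\<forall>m\<in>carrier M. \<forall>n\<in>carrier N. h (pt m n) = b m n)"
  obtain h where h: "amap Z P h"
    "\<And>m n. m \<in> carrier M \<Longrightarrow> n \<in> carrier N \<Longrightarrow> h (pt m n) = b m n"
    using tlift_exists[OF P b] by metis
  have hom_eq: "g \<in> hom (tensor_group K M N) (add_monoid P) \<longleftrightarrow> amap Z P g" for g
    by (simp add: hom_tensor_group)
  have 1: "?P (restrict h (carrier (tensor_group K M N)))"
    using h Z.add.m_closed by (auto simp: hom_eq amap_def)
  have 2: "g = restrict h (carrier (tensor_group K M N))" if g: "?P g" for g
  proof (rule extensionalityI[of _ "carrier (tensor_group K M N)"])
    fix z assume z: "z \<in> carrier (tensor_group K M N)"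
    have "g z = h z"
      using amap_tensor_eqI[of P g h z] g h z by (simp add: hom_eq)
    then show "g z = restrict h (carrier (tensor_group K M N)) z" using z by simp
  qed (use g in auto)
  have "?P (tlift K M N P b)"
    unfolding tlift_def tensor_lift_def by (rule theI2[of ?P, OF 1 2]) auto
  then show "amap Z P (tlift K M N P b)"
    "\<And>m n. m \<in> carrier M \<Longrightarrow> n \<in> carrier N \<Longrightarrow> tlift K M N P b (pt m n) = b m n"
    "tlift K M N P b \<in> extensional (carrier (tensor_group K M N))"
    by (auto simp: hom_eq)
qed

end

lemma module_trans: "module K M \<Longrightarrow> cring K" "module K M \<Longrightarrow> abelian_group M"
  by (simp_all add: module_def)

lemma tensor_map_eq_tlift:
  "tensor_map K M N P Q \<phi> \<psi> =
     tlift K M N (tensor_module K P Q) (\<lambda>m n. pure_tensor K P Q (\<phi> m) (\<psi> n))"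
proof -
  have "hom (tensor_group K M N) (tensor_group K P Q)
      = hom (tensor_group K M N) (add_monoid (tensor_module K P Q))"
    by (simp add: hom_def tensor_module_def)
  then show ?thesis by (simp add: tensor_map_def tlift_def tensor_lift_def)
qed

lemma balanced_pure_tensor_comp:
  assumes MN: "module K M" "module K N" and PQ: "module K P" "module K Q"
    and \<phi>: "\<phi> \<in> module_hom K M P" and \<psi>: "\<psi> \<in> module_hom K N Q"
  shows "balanced K M N (tensor_module K P Q) (\<lambda>m n. pure_tensor K P Q (\<phi> m) (\<psi> n))"
proof -
  interpret T: tensor_pair K P Q using PQ by (rule tensor_pair.intro)
  show ?thesis
    using \<phi> \<psi> by (intro balancedI) (auto simp: module_hom_def T.pt_add1 T.pt_add2 T.pt_smult Pi_iff)
qed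

lemma
  assumes MN: "module K M" "module K N" and PQ: "module K P" "module K Q"
    and \<phi>: "\<phi> \<in> module_hom K M P" and \<psi>: "\<psi> \<in> module_hom K N Q"
  shows tensor_map_amap: "amap (tensor_module K M N) (tensor_module K P Q)
      (tensor_map K M N P Q \<phi> \<psi>)"
    and tensor_map_pt: "\<And>m n. m \<in> carrier M \<Longrightarrow> n \<in> carrier N \<Longrightarrow>
      tensor_map K M N P Q \<phi> \<psi> (pure_tensor K M N m n) = pure_tensor K P Q (\<phi> m) (\<psi> n)"
proof -
  interpret S: tensor_pair K M N using MN by (rule tensor_pair.intro)
  interpret T: tensor_pair K P Q using PQ by (rule tensor_pair.intro)
  note b = balanced_pure_tensor_comp[OF assms]
  show "amap (tensor_module K M N) (tensor_module K P Q) (tensor_map K M N P Q \<phi> \<psi>)"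
    "\<And>m n. m \<in> carrier M \<Longrightarrow> n \<in> carrier N \<Longrightarrow>
      tensor_map K M N P Q \<phi> \<psi> (pure_tensor K M N m n) = pure_tensor K P Q (\<phi> m) (\<psi> n)"
    unfolding tensor_map_eq_tlift
    using S.tlift_amap[OF T.tensor_abelian_group b] S.tlift_pt[OF T.tensor_abelian_group b]
    by simp_all
qed

lemma id_module_hom: "(\<lambda>x. x) \<in> module_hom K M M"
  by (simp add: module_hom_def)

lemma (in module) smult_module_hom: "a \<in> carrier R \<Longrightarrow> (\<lambda>x. a \<odot>\<^bsub>M\<^esub> x) \<in> module_hom R M M"
  by (auto simp: module_hom_def smult_r_distr R.m_comm simp flip: smult_assoc1)

section \<open>The module structure on a tensor product\<close>

context tensor_pair
begin

lemma Z_closed [simp, intro]: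
  "x \<in> carrier (tensor_group K M N) \<Longrightarrow> y \<in> carrier (tensor_group K M N) \<Longrightarrow>
    x \<oplus>\<^bsub>Z\<^esub> y \<in> carrier (tensor_group K M N)"
  "\<zero>\<^bsub>Z\<^esub> \<in> carrier (tensor_group K M N)"
  "x \<in> carrier (tensor_group K M N) \<Longrightarrow> \<ominus>\<^bsub>Z\<^esub> x \<in> carrier (tensor_group K M N)"
  using Z.a_closed[of x y] Z.zero_closed Z.a_inv_closed[of x] by simp_all

lemma smult_amap: "a \<in> carrier K \<Longrightarrow> amap Z Z (\<lambda>z. a \<odot>\<^bsub>Z\<^esub> z)"
  using tensor_map_amap[OF M N M N M.smult_module_hom id_module_hom, of a]
  by (simp add: amap_def tensor_module_def)

lemma smult_pt: "a \<in> carrier K \<Longrightarrow> m \<in> carrier M \<Longrightarrow> n \<in> carrier N \<Longrightarrow>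
    a \<odot>\<^bsub>Z\<^esub> pt m n = pt (a \<odot>\<^bsub>M\<^esub> m) n"
  using tensor_map_pt[OF M N M N M.smult_module_hom id_module_hom, of a]
  by (simp add: tensor_module_def)

lemma tensor_module_module: "module K Z"
proof (rule moduleI)
  show "cring K" by (rule M.R.is_cring)
  show "abelian_group Z" by (rule tensor_abelian_group)
  show cl: "a \<odot>\<^bsub>Z\<^esub> x \<in> carrier Z" if "a \<in> carrier K" "x \<in> carrier Z" for a x
    using amap_closed[OF smult_amap] that by simp
  have cl': "a \<odot>\<^bsub>Z\<^esub> x \<in> carrier (tensor_group K M N)"
    if "a \<in> carrier K" "x \<in> carrier (tensor_group K M N)" for a x using cl that by simp
  show add: "a \<odot>\<^bsub>Z\<^esub> (x \<oplus>\<^bsub>Z\<^esub> y) = a \<odot>\<^bsub>Z\<^esub> x \<oplus>\<^bsub>Z\<^esub> a \<odot>\<^bsub>Z\<^esub> y"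
    if "a \<in> carrier K" "x \<in> carrier Z" "y \<in> carrier Z" for a x y
    using amap_add[OF smult_amap] that by simp
  have add': "a \<odot>\<^bsub>Z\<^esub> (x \<oplus>\<^bsub>Z\<^esub> y) = a \<odot>\<^bsub>Z\<^esub> x \<oplus>\<^bsub>Z\<^esub> a \<odot>\<^bsub>Z\<^esub> y"
    if "a \<in> carrier K" "x \<in> carrier (tensor_group K M N)" "y \<in> carrier (tensor_group K M N)"
      for a x y
    using amap_add[OF smult_amap] that by simp
  show "(a \<oplus>\<^bsub>K\<^esub> b) \<odot>\<^bsub>Z\<^esub> x = a \<odot>\<^bsub>Z\<^esub> x \<oplus>\<^bsub>Z\<^esub> b \<odot>\<^bsub>Z\<^esub> x"
    if ab: "a \<in> carrier K" "b \<in> carrier K" and x: "x \<in> carrier Z" for a b x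
    using x unfolding carrier_tensor_module
  proof (induction x rule: tensor_induct)
    case (pure m n)
    then show ?case using ab by (simp add: smult_pt M.smult_l_distr pt_add1)
  next
    case (add x y)
    then show ?case using ab by (simp add: add' cl' Z.a_ac)
  qed
  show "(a \<otimes>\<^bsub>K\<^esub> b) \<odot>\<^bsub>Z\<^esub> x = a \<odot>\<^bsub>Z\<^esub> (b \<odot>\<^bsub>Z\<^esub> x)"
    if ab: "a \<in> carrier K" "b \<in> carrier K" and x: "x \<in> carrier Z" for a b x
    using x unfolding carrier_tensor_module
  proof (induction x rule: tensor_induct)
    case (pure m n)
    then show ?case using ab by (simp add: smult_pt M.smult_assoc1)
  next
    case (add x y)
    then show ?case using ab by (simp add: add' cl')
  qed
  show "\<one>\<^bsub>K\<^esub> \<odot>\<^bsub>Z\<^esub> x = x" if x: "x \<in> carrier Z" for x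
    using x unfolding carrier_tensor_module
  proof (induction x rule: tensor_induct)
    case (pure m n)
    then show ?case by (simp add: smult_pt)
  next
    case (add x y)
    then show ?case by (simp add: add')
  qed
qed

end

section \<open>Extension of scalars\<close>

locale ext_scal =
  fixes k :: "('u, 'x) ring_scheme" and V :: "('u, 'v, 'y) module_scheme"
    and R :: "('u, 'u) module"
  assumes V: "module k V" and R: "algebra k R"
begin

sublocale R: algebra k R by (rule R)

sublocale tensor_pair k V R
  by (rule tensor_pair.intro[OF V R.module])

abbreviation "E \<equiv> ext_scalars k V R"

lemma mult_module_hom: "r \<in> carrier R \<Longrightarrow> (\<lambda>s. r \<otimes>\<^bsub>R\<^esub> s) \<in> module_hom k R R"
  using R.smult_assoc2 by (auto simp: module_hom_def R.r_distr R.m_comm)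

lemma esmult_amap: "r \<in> carrier R \<Longrightarrow> amap Z Z (\<lambda>z. r \<odot>\<^bsub>E\<^esub> z)"
  using tensor_map_amap[OF V N V N id_module_hom mult_module_hom, of r]
  by (simp add: ext_scalars_def)

lemma esmult_pt: "r \<in> carrier R \<Longrightarrow> v \<in> carrier V \<Longrightarrow> s \<in> carrier R \<Longrightarrow>
    r \<odot>\<^bsub>E\<^esub> pt v s = pt v (r \<otimes>\<^bsub>R\<^esub> s)"
  using tensor_map_pt[OF V N V N id_module_hom mult_module_hom, of r]
  by (simp add: ext_scalars_def)

lemma esmult_one_pt: "r \<in> carrier R \<Longrightarrow> v \<in> carrier V \<Longrightarrow> r \<odot>\<^bsub>E\<^esub> pt v \<one>\<^bsub>R\<^esub> = pt v r"
  by (simp add: esmult_pt)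

lemma ext_abelian_group: "abelian_group E"
proof (rule abelian_groupI, goal_cases)
  case (4 x y)
  then show ?case using Z.a_comm by simp
next
  case (6 x)
  then show ?case using Z.l_neg[of x] by auto
qed (simp_all add: Z.a_assoc)

text \<open>\<open>E\<close> and \<open>Z\<close> differ only in scalar multiplication, so induction
  and uniqueness, proved for \<open>Z\<close>, serve for the \<open>R\<close>-module
  \<open>E\<close> as well.\<close>

lemma amap_E: "amap E P h \<longleftrightarrow> amap Z P h" "amap Q E g \<longleftrightarrow> amap Q Z g"
  by (simp_all add: amap_def)

lemma ext_module: "module R E"
proof (rule moduleI)
  show "cring R" by (rule R.M_cring)
  show "abelian_group E" by (rule ext_abelian_group)
  show cl: "a \<odot>\<^bsub>E\<^esub> x \<in> carrier E" if "a \<in> carrier R" "x \<in> carrier E" for a x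
    using amap_closed[OF esmult_amap] that by simp
  have cl': "a \<odot>\<^bsub>E\<^esub> x \<in> carrier (tensor_group k V R)"
    if "a \<in> carrier R" "x \<in> carrier (tensor_group k V R)" for a x using cl that by simp
  show add: "a \<odot>\<^bsub>E\<^esub> (x \<oplus>\<^bsub>E\<^esub> y) = a \<odot>\<^bsub>E\<^esub> x \<oplus>\<^bsub>E\<^esub> a \<odot>\<^bsub>E\<^esub> y"
    if "a \<in> carrier R" "x \<in> carrier E" "y \<in> carrier E" for a x y
    using amap_add[OF esmult_amap] that by simp
  have add': "a \<odot>\<^bsub>E\<^esub> (x \<oplus>\<^bsub>Z\<^esub> y) = a \<odot>\<^bsub>E\<^esub> x \<oplus>\<^bsub>Z\<^esub> a \<odot>\<^bsub>E\<^esub> y"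
    if "a \<in> carrier R" "x \<in> carrier (tensor_group k V R)" "y \<in> carrier (tensor_group k V R)"
      for a x y
    using amap_add[OF esmult_amap] that by simp
  show "(a \<oplus>\<^bsub>R\<^esub> b) \<odot>\<^bsub>E\<^esub> x = a \<odot>\<^bsub>E\<^esub> x \<oplus>\<^bsub>E\<^esub> b \<odot>\<^bsub>E\<^esub> x"
    if ab: "a \<in> carrier R" "b \<in> carrier R" and x: "x \<in> carrier E" for a b x
    using x unfolding ext_scalars_simps
  proof (induction x rule: tensor_induct)
    case (pure m n)
    then show ?case using ab by (simp add: esmult_pt R.l_distr pt_add2)
  next
    case (add x y)
    then show ?case using ab by (simp add: add' cl' Z.a_ac)
  qed
  show "(a \<otimes>\<^bsub>R\<^esub> b) \<odot>\<^bsub>E\<^esub> x = a \<odot>\<^bsub>E\<^esub> (b \<odot>\<^bsub>E\<^esub> x)"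
    if ab: "a \<in> carrier R" "b \<in> carrier R" and x: "x \<in> carrier E" for a b x
    using x unfolding ext_scalars_simps
  proof (induction x rule: tensor_induct)
    case (pure m n)
    then show ?case using ab by (simp add: esmult_pt R.m_assoc)
  next
    case (add x y)
    then show ?case using ab by (simp add: add' cl')
  qed
  show "\<one>\<^bsub>R\<^esub> \<odot>\<^bsub>E\<^esub> x = x" if x: "x \<in> carrier E" for x
    using x unfolding ext_scalars_simps
  proof (induction x rule: tensor_induct)
    case (pure m n)
    then show ?case by (simp add: esmult_pt)
  next
    case (add x y)
    then show ?case by (simp add: add')
  qed
qed

sublocale E: module R E by (rule ext_module)

text \<open>Over \<open>R\<close> the tensors with right factor 1 already generate, so linear maps
  need comparing only there.\<close>

lemma module_hom_eqI:
  assumes h: "h \<in> module_hom R E P" and h': "h' \<in> module_hom R E P" and z: "z \<in> carrier E"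
    and eq: "\<And>v. v \<in> carrier V \<Longrightarrow> h (pt v \<one>\<^bsub>R\<^esub>) = h' (pt v \<one>\<^bsub>R\<^esub>)"
  shows "h z = h' z"
proof (rule amap_tensor_eqI[of P h h' z])
  show "h (pt v r) = h' (pt v r)" if vr: "v \<in> carrier V" "r \<in> carrier R" for v r
    using vr eq module_hom_smult[OF h, of r "pt v \<one>\<^bsub>R\<^esub>"] module_hom_smult[OF h', of r "pt v \<one>\<^bsub>R\<^esub>"]
    by (simp add: esmult_one_pt)
qed (use h h' z in \<open>simp_all add: module_hom_amap amap_E(1)[symmetric]\<close>)

lemma module_hom_tlift:
  assumes P: "module R P" and b: "balanced k V R P b"
    and lin: "\<And>v r s. v \<in> carrier V \<Longrightarrow> r \<in> carrier R \<Longrightarrow> s \<in> carrier R \<Longrightarrow>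
      b v (r \<otimes>\<^bsub>R\<^esub> s) = r \<odot>\<^bsub>P\<^esub> b v s"
  shows "tlift k V R P b \<in> module_hom R E P"
proof -
  interpret P: module R P by fact
  note t = tlift_amap[OF P.abelian_group_axioms b] and tp = tlift_pt[OF P.abelian_group_axioms b]
  show ?thesis
  proof (rule module_homI)
    show "amap E P (tlift k V R P b)" by (simp add: amap_E t)
    show "tlift k V R P b (r \<odot>\<^bsub>E\<^esub> x) = r \<odot>\<^bsub>P\<^esub> tlift k V R P b x"
      if r: "r \<in> carrier R" and x: "x \<in> carrier E" for r x
    proof (rule amap_tensor_eqI[of P])
      show "amap Z P (\<lambda>x. tlift k V R P b (r \<odot>\<^bsub>E\<^esub> x))"
        by (rule amap_comp[OF esmult_amap[OF r] t])
      show "amap Z P (\<lambda>x. r \<odot>\<^bsub>P\<^esub> tlift k V R P b x)"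
        by (rule amap_comp[OF t module_hom_amap[OF P.smult_module_hom[OF r]]])
      show "tlift k V R P b (r \<odot>\<^bsub>E\<^esub> pt v s) = r \<odot>\<^bsub>P\<^esub> tlift k V R P b (pt v s)"
        if "v \<in> carrier V" "s \<in> carrier R" for v s
        using that r by (simp add: esmult_pt tp lin)
    qed (use x in simp)
  qed
qed

end

section \<open>Homomorphisms of algebras\<close>

lemma alg_homD:
  assumes "f \<in> alg_hom k R S"
  shows "f \<in> ring_hom R S" "f \<in> module_hom k R S" "f \<in> extensional (carrier R)"
    "\<And>x. x \<in> carrier R \<Longrightarrow> f x \<in> carrier S"
    "\<And>x y. x \<in> carrier R \<Longrightarrow> y \<in> carrier R \<Longrightarrow> f (x \<oplus>\<^bsub>R\<^esub> y) = f x \<oplus>\<^bsub>S\<^esub> f y"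
    "\<And>x y. x \<in> carrier R \<Longrightarrow> y \<in> carrier R \<Longrightarrow> f (x \<otimes>\<^bsub>R\<^esub> y) = f x \<otimes>\<^bsub>S\<^esub> f y"
    "f \<one>\<^bsub>R\<^esub> = \<one>\<^bsub>S\<^esub>"
    "\<And>a x. a \<in> carrier k \<Longrightarrow> x \<in> carrier R \<Longrightarrow> f (a \<odot>\<^bsub>R\<^esub> x) = a \<odot>\<^bsub>S\<^esub> f x"
  using assms by (auto simp: alg_hom_def ring_hom_def module_hom_def)

lemma alg_homI:
  assumes "\<And>x. x \<in> carrier R \<Longrightarrow> f x \<in> carrier S"
    "\<And>x y. x \<in> carrier R \<Longrightarrow> y \<in> carrier R \<Longrightarrow> f (x \<oplus>\<^bsub>R\<^esub> y) = f x \<oplus>\<^bsub>S\<^esub> f y"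
    "\<And>x y. x \<in> carrier R \<Longrightarrow> y \<in> carrier R \<Longrightarrow> f (x \<otimes>\<^bsub>R\<^esub> y) = f x \<otimes>\<^bsub>S\<^esub> f y"
    "f \<one>\<^bsub>R\<^esub> = \<one>\<^bsub>S\<^esub>"
    "\<And>a x. a \<in> carrier k \<Longrightarrow> x \<in> carrier R \<Longrightarrow> f (a \<odot>\<^bsub>R\<^esub> x) = a \<odot>\<^bsub>S\<^esub> f x"
    "f \<in> extensional (carrier R)"
  shows "f \<in> alg_hom k R S"
  using assms by (auto simp: alg_hom_def ring_hom_def module_hom_def)

lemma alg_hom_compose:
  assumes "f \<in> alg_hom k R S" "g \<in> alg_hom k S T" "algebra k R"
  shows "compose (carrier R) g f \<in> alg_hom k R T"
proof -
  interpret algebra k R by fact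
  show ?thesis
    using alg_homD[OF assms(1)] alg_homD[OF assms(2)]
    by (intro alg_homI) (simp_all add: compose_def)
qed

lemma alg_hom_id:
  assumes "algebra k R" shows "(\<lambda>r\<in>carrier R. r) \<in> alg_hom k R R"
proof -
  interpret algebra k R by fact
  show ?thesis by (intro alg_homI) simp_all
qed

section \<open>Base change\<close>

locale base_chg =
  fixes k :: "'u ring" and V :: "('u, 'v) module" and R S :: "('u, 'u) module" and f :: "'u \<Rightarrow> 'u"
  assumes V: "module k V" and R: "algebra k R" and S: "algebra k S" and f: "f \<in> alg_hom k R S"
begin

sublocale ER: ext_scal k V R using V R by (rule ext_scal.intro)
sublocale ES: ext_scal k V S using V S by (rule ext_scal.intro)

abbreviation "Vf \<equiv> tensor_map k V R V S (\<lambda>v. v) f"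

lemma Vf_amap: "amap ER.Z ES.Z Vf"
  and Vf_pt: "v \<in> carrier V \<Longrightarrow> r \<in> carrier R \<Longrightarrow> Vf (ER.pt v r) = ES.pt v (f r)"
  using tensor_map_amap[OF V ER.N V ES.N id_module_hom alg_homD(2)[OF f]]
    tensor_map_pt[OF V ER.N V ES.N id_module_hom alg_homD(2)[OF f]]
  by simp_all

lemma Vf_closed: "z \<in> carrier (tensor_group k V R) \<Longrightarrow> Vf z \<in> carrier (tensor_group k V S)"
  using amap_closed[OF Vf_amap] by simp

lemma Vf_smult:
  assumes r: "r \<in> carrier R" and z: "z \<in> carrier (tensor_group k V R)"
  shows "Vf (r \<odot>\<^bsub>ER.E\<^esub> z) = f r \<odot>\<^bsub>ES.E\<^esub> Vf z"
proof (rule ER.amap_tensor_eqI[OF _ _ z])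
  show "amap ER.Z ES.Z (\<lambda>z. Vf (r \<odot>\<^bsub>ER.E\<^esub> z))"
    by (rule amap_comp[OF ER.esmult_amap[OF r] Vf_amap])
  show "amap ER.Z ES.Z (\<lambda>z. f r \<odot>\<^bsub>ES.E\<^esub> Vf z)"
    by (rule amap_comp[OF Vf_amap ES.esmult_amap]) (simp add: alg_homD[OF f] r)
  show "Vf (r \<odot>\<^bsub>ER.E\<^esub> ER.pt v s) = f r \<odot>\<^bsub>ES.E\<^esub> Vf (ER.pt v s)"
    if "v \<in> carrier V" "s \<in> carrier R" for v s
    using that r by (simp add: ER.esmult_pt Vf_pt ES.esmult_pt alg_homD[OF f])
qed

text \<open>Every tensor with right factor 1 over \<open>S\<close> is the image under
  \<open>Vf\<close> of the corresponding tensor over \<open>R\<close>. An \<open>S\<close>-linear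
  map that commutes with \<alpha> along \<open>Vf\<close> is therefore fixed on generators, and a
  candidate \<beta> has to be tested only on them. The candidate is a parameter: it is the action of
  a point in \<open>representationI\<close> and an explicit lift in
  \<open>base_change_Vf\<close>.\<close>

lemma
  assumes \<beta>: "\<beta> \<in> module_hom S ES.E ES.E" "\<beta> \<in> extensional (carrier ES.E)"
    and eq: "\<And>v. v \<in> carrier V \<Longrightarrow> \<beta> (ES.pt v \<one>\<^bsub>S\<^esub>) = Vf (\<alpha> (ER.pt v \<one>\<^bsub>R\<^esub>))"
    and \<alpha>: "\<alpha> \<in> module_hom R ER.E ER.E"
  shows base_change_eq: "base_change k V R S f \<alpha> = \<beta>"
    and base_change_comm: "x \<in> carrier ER.E \<Longrightarrow> \<beta> (Vf x) = Vf (\<alpha> x)"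
proof -
  have comm: "\<beta> (Vf x) = Vf (\<alpha> x)" if x: "x \<in> carrier ER.E" for x
  proof (rule ER.amap_tensor_eqI[where P = ES.Z and z = x])
    have a: "amap ER.Z ER.Z \<alpha>" using module_hom_amap[OF \<alpha>] by (simp add: ER.amap_E)
    have b: "amap ES.Z ES.Z \<beta>" using module_hom_amap[OF \<beta>(1)] by (simp add: ES.amap_E)
    show "amap ER.Z ES.Z (\<lambda>x. \<beta> (Vf x))" by (rule amap_comp[OF Vf_amap b])
    show "amap ER.Z ES.Z (\<lambda>x. Vf (\<alpha> x))" by (rule amap_comp[OF a Vf_amap])
    show "\<beta> (Vf (ER.pt v r)) = Vf (\<alpha> (ER.pt v r))" if vr: "v \<in> carrier V" "r \<in> carrier R" for v r
    proof -
      have "\<beta> (Vf (ER.pt v r)) = \<beta> (f r \<odot>\<^bsub>ES.E\<^esub> ES.pt v \<one>\<^bsub>S\<^esub>)"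
        using vr by (simp add: Vf_pt ES.esmult_one_pt alg_homD[OF f])
      also have "\<dots> = f r \<odot>\<^bsub>ES.E\<^esub> Vf (\<alpha> (ER.pt v \<one>\<^bsub>R\<^esub>))"
        using vr module_hom_smult[OF \<beta>(1), of "f r" "ES.pt v \<one>\<^bsub>S\<^esub>"]
        by (simp add: eq alg_homD[OF f])
      also have "\<dots> = Vf (r \<odot>\<^bsub>ER.E\<^esub> \<alpha> (ER.pt v \<one>\<^bsub>R\<^esub>))"
        using vr amap_closed[OF a, of "ER.pt v \<one>\<^bsub>R\<^esub>"] by (simp add: Vf_smult)
      also have "\<dots> = Vf (\<alpha> (ER.pt v r))"
        using vr module_hom_smult[OF \<alpha>, of r "ER.pt v \<one>\<^bsub>R\<^esub>"] by (simp add: ER.esmult_one_pt)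
      finally show ?thesis .
    qed
  qed (use x in simp)
  then show "x \<in> carrier ER.E \<Longrightarrow> \<beta> (Vf x) = Vf (\<alpha> x)" .
  show "base_change k V R S f \<alpha> = \<beta>"
    unfolding base_change_def Let_def
  proof (rule the_equality)
    show "\<beta> \<in> module_hom S ES.E ES.E \<inter> extensional (carrier ES.E) \<and>
        (\<forall>x\<in>carrier ER.E. \<beta> (Vf x) = Vf (\<alpha> x))" using \<beta> comm by simp
    show "\<gamma> = \<beta>" if \<gamma>: "\<gamma> \<in> module_hom S ES.E ES.E \<inter> extensional (carrier ES.E) \<and>
        (\<forall>x\<in>carrier ER.E. \<gamma> (Vf x) = Vf (\<alpha> x))" for \<gamma>
    proof (rule extensionalityI)
      show "\<gamma> z = \<beta> z" if z: "z \<in> carrier ES.E" for z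
      proof (rule ES.module_hom_eqI[OF _ \<beta>(1) z])
        show "\<gamma> (ES.pt v \<one>\<^bsub>S\<^esub>) = \<beta> (ES.pt v \<one>\<^bsub>S\<^esub>)" if v: "v \<in> carrier V" for v
        proof -
          have "ES.pt v \<one>\<^bsub>S\<^esub> = Vf (ER.pt v \<one>\<^bsub>R\<^esub>)" using v by (simp add: Vf_pt alg_homD[OF f])
          then show ?thesis using \<gamma> comm v by simp
        qed
      qed (use \<gamma> in simp)
    qed (use \<gamma> \<beta> in auto)
  qed
qed

text \<open>This supplies the existence that the definite description in \<open>base_change\<close>
  presupposes.\<close>

lemma base_change_Vf:
  assumes \<alpha>: "\<alpha> \<in> module_hom R ER.E ER.E" and x: "x \<in> carrier ER.E"
  shows "base_change k V R S f \<alpha> (Vf x) = Vf (\<alpha> x)"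
proof -
  \<comment> \<open>Linearity over \<open>S\<close> leaves no other choice: v \<otimes> s must go to
    s times the image of \<alpha>(v \<otimes> 1).\<close>
  let ?b = "\<lambda>v s. s \<odot>\<^bsub>ES.E\<^esub> Vf (\<alpha> (ER.pt v \<one>\<^bsub>R\<^esub>))"
  let ?\<beta> = "tlift k V S ES.E ?b"
  have a: "amap ER.Z ER.Z \<alpha>" using module_hom_amap[OF \<alpha>] by (simp add: ER.amap_E)
  have g: "amap V ES.Z (\<lambda>v. Vf (\<alpha> (ER.pt v \<one>\<^bsub>R\<^esub>)))"
    by (intro amap_comp[OF amap_comp[OF balanced_amap1[OF ER.pt_balanced] a] Vf_amap]) simp
  \<comment> \<open>A scalar of \<open>k\<close> acts through its image in \<open>R\<close>, which
    \<open>f\<close> sends to its image in \<open>S\<close>. In this way \<open>R\<close>-linearity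
    of \<alpha> yields the balancing condition over \<open>k\<close>.\<close>
  have k: "Vf (\<alpha> (ER.pt (c \<odot>\<^bsub>V\<^esub> v) \<one>\<^bsub>R\<^esub>)) = (c \<odot>\<^bsub>S\<^esub> \<one>\<^bsub>S\<^esub>) \<odot>\<^bsub>ES.E\<^esub> Vf (\<alpha> (ER.pt v \<one>\<^bsub>R\<^esub>))"
    if "c \<in> carrier k" "v \<in> carrier V" for c v
  proof -
    have "ER.pt (c \<odot>\<^bsub>V\<^esub> v) \<one>\<^bsub>R\<^esub> = (c \<odot>\<^bsub>R\<^esub> \<one>\<^bsub>R\<^esub>) \<odot>\<^bsub>ER.E\<^esub> ER.pt v \<one>\<^bsub>R\<^esub>"
      using that by (simp add: ER.pt_smult ER.esmult_one_pt)
    then show ?thesis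
      using that module_hom_smult[OF \<alpha>, of "c \<odot>\<^bsub>R\<^esub> \<one>\<^bsub>R\<^esub>" "ER.pt v \<one>\<^bsub>R\<^esub>"]
        amap_closed[OF a, of "ER.pt v \<one>\<^bsub>R\<^esub>"]
      by (simp add: Vf_smult alg_homD[OF f])
  qed
  have gc: "Vf (\<alpha> (ER.pt v \<one>\<^bsub>R\<^esub>)) \<in> carrier ES.E" if "v \<in> carrier V" for v
    using amap_closed[OF g that] by simp
  have b: "balanced k V S ES.E ?b"
  proof (rule balancedI, goal_cases)
    case (2 m m' n)
    then show ?case using amap_add[OF g, of m m'] gc ES.E.smult_r_distr[of n] by simp
  next
    case (4 c m n)
    have "(c \<odot>\<^bsub>S\<^esub> \<one>\<^bsub>S\<^esub>) \<otimes>\<^bsub>S\<^esub> n = c \<odot>\<^bsub>S\<^esub> n"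
      using 4 by (simp add: ES.R.smult_assoc2)
    then show ?case using 4 k[of c m] gc ES.E.smult_assoc1[of n "c \<odot>\<^bsub>S\<^esub> \<one>\<^bsub>S\<^esub>"]
      by (simp add: ES.R.m_comm)
  next
    case (1 m n)
    then show ?case using gc ES.E.smult_closed by blast
  next
    case (3 m n n')
    then show ?case using gc ES.E.smult_l_distr by blast
  qed
  have \<beta>: "?\<beta> \<in> module_hom S ES.E ES.E"
    by (rule ES.module_hom_tlift[OF ES.ext_module b]) (use gc ES.E.smult_assoc1 in blast)
  have e: "?\<beta> \<in> extensional (carrier ES.E)"
    using ES.tlift_ext[OF ES.ext_abelian_group b] by simp
  have eq: "?\<beta> (ES.pt v \<one>\<^bsub>S\<^esub>) = Vf (\<alpha> (ER.pt v \<one>\<^bsub>R\<^esub>))" if "v \<in> carrier V" for v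
    using ES.tlift_pt[OF ES.ext_abelian_group b that] gc[OF that] by simp
  show ?thesis
    using base_change_eq[OF \<beta> e eq \<alpha>] base_change_comm[OF \<beta> e eq \<alpha> x] by simp
qed

end

lemma (in algebra) smult_assoc2_right:
  assumes "a \<in> carrier R" "x \<in> carrier M" "y \<in> carrier M"
  shows "x \<otimes>\<^bsub>M\<^esub> (a \<odot>\<^bsub>M\<^esub> y) = a \<odot>\<^bsub>M\<^esub> (x \<otimes>\<^bsub>M\<^esub> y)"
  using assms smult_assoc2[of a y x] by (simp add: m_comm)

section \<open>The coproduct of two algebras\<close>

locale alg_pair =
  fixes k :: "('u, 'x) ring_scheme" and R S :: "('u, 'u) module"
  assumes R: "algebra k R" and S: "algebra k S"
begin

sublocale R: ext_scal k R R
  using R algebra.module by (auto intro: ext_scal.intro)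
sublocale S: ext_scal k S S
  using S algebra.module by (auto intro: ext_scal.intro)
sublocale tensor_pair k R S
  by (rule tensor_pair.intro[OF R.V S.V])

abbreviation "tmul \<equiv> \<lambda>r s. tensor_map k R S R S (\<lambda>x. r \<otimes>\<^bsub>R\<^esub> x) (\<lambda>x. s \<otimes>\<^bsub>S\<^esub> x)"

lemma tmul_amap: "r \<in> carrier R \<Longrightarrow> s \<in> carrier S \<Longrightarrow> amap Z Z (tmul r s)"
  and tmul_pt: "r \<in> carrier R \<Longrightarrow> s \<in> carrier S \<Longrightarrow> r' \<in> carrier R \<Longrightarrow> s' \<in> carrier S \<Longrightarrow>
    tmul r s (pt r' s') = pt (r \<otimes>\<^bsub>R\<^esub> r') (s \<otimes>\<^bsub>S\<^esub> s')"
  using tensor_map_amap[OF M N M N R.mult_module_hom S.mult_module_hom]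
    tensor_map_pt[OF M N M N R.mult_module_hom S.mult_module_hom] by simp_all

lemma amap_Z_add: "amap M' Z f \<Longrightarrow> amap M' Z g \<Longrightarrow> amap M' Z (\<lambda>x. f x \<oplus>\<^bsub>Z\<^esub> g x)"
  by (auto simp: amap_def Pi_iff Z.a_ac)

lemma tmul_balanced: 
  assumes w: "w \<in> carrier (tensor_group k R S)"
  shows "balanced k R S Z (\<lambda>r s. tmul r s w)"
proof (rule balancedI)
  show "tmul r s w \<in> carrier Z" if "r \<in> carrier R" "s \<in> carrier S" for r s
    using amap_closed[OF tmul_amap[OF that]] w by simp
  show "tmul (r \<oplus>\<^bsub>R\<^esub> r') s w = tmul r s w \<oplus>\<^bsub>Z\<^esub> tmul r' s w"
    if "r \<in> carrier R" "r' \<in> carrier R" "s \<in> carrier S" for r r' s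
    by (rule amap_tensor_eqI[where P = Z and z = w])
      (use that w in \<open>simp_all add: tmul_amap amap_Z_add tmul_pt R.R.l_distr pt_add1\<close>)
  show "tmul r (s \<oplus>\<^bsub>S\<^esub> s') w = tmul r s w \<oplus>\<^bsub>Z\<^esub> tmul r s' w"
    if "r \<in> carrier R" "s' \<in> carrier S" "s \<in> carrier S" for r s s'
    by (rule amap_tensor_eqI[where P = Z and z = w])
      (use that w in \<open>simp_all add: tmul_amap amap_Z_add tmul_pt S.R.l_distr pt_add2\<close>)
  show "tmul (a \<odot>\<^bsub>R\<^esub> r) s w = tmul r (a \<odot>\<^bsub>S\<^esub> s) w"
    if "a \<in> carrier k" "r \<in> carrier R" "s \<in> carrier S" for a r s
    by (rule amap_tensor_eqI[where P = Z and z = w])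
      (use that w in \<open>simp_all add: tmul_amap tmul_pt R.R.smult_assoc2 S.R.smult_assoc2 pt_smult\<close>)
qed

text \<open>The lifting is done one factor at a time: \<open>tmul r s\<close> is multiplication by a
  fixed pure tensor, already defined on all of R \<otimes> S, and for each \<open>w\<close> its
  value at \<open>w\<close> is balanced in \<open>r\<close> and \<open>s\<close>.\<close>

definition tensor_mult where "tensor_mult z w = tlift k R S Z (\<lambda>r s. tmul r s w) z"

lemma tensor_mult_pt1:
  "r \<in> carrier R \<Longrightarrow> s \<in> carrier S \<Longrightarrow> w \<in> carrier (tensor_group k R S) \<Longrightarrow>
    tensor_mult (pt r s) w = tmul r s w"
  unfolding tensor_mult_def by (rule tlift_pt[OF tensor_abelian_group tmul_balanced])

lemma tensor_mult_pt:
  "r \<in> carrier R \<Longrightarrow> s \<in> carrier S \<Longrightarrow> r' \<in> carrier R \<Longrightarrow> s' \<in> carrier S \<Longrightarrow>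
    tensor_mult (pt r s) (pt r' s') = pt (r \<otimes>\<^bsub>R\<^esub> r') (s \<otimes>\<^bsub>S\<^esub> s')"
  by (simp add: tensor_mult_pt1 tmul_pt)

lemma tensor_mult_amap1: "w \<in> carrier (tensor_group k R S) \<Longrightarrow> amap Z Z (\<lambda>z. tensor_mult z w)"
  unfolding tensor_mult_def by (rule tlift_amap[OF tensor_abelian_group tmul_balanced])

lemma tensor_mult_closed:
  "z \<in> carrier (tensor_group k R S) \<Longrightarrow> w \<in> carrier (tensor_group k R S) \<Longrightarrow>
    tensor_mult z w \<in> carrier (tensor_group k R S)"
  using amap_closed[OF tensor_mult_amap1] by simp

lemma tensor_mult_amap2:
  assumes z: "z \<in> carrier (tensor_group k R S)"
  shows "amap Z Z (\<lambda>w. tensor_mult z w)"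
  using z
proof (induction z rule: tensor_induct)
  case (pure r s)
  then show ?case
    using tmul_amap[of r s] by (simp add: amap_def Pi_iff tensor_mult_pt1)
next
  case (add x y)
  have "amap Z Z (\<lambda>w. tensor_mult x w \<oplus>\<^bsub>Z\<^esub> tensor_mult y w)" using add by (intro amap_Z_add)
  then show ?case using add amap_add[OF tensor_mult_amap1] by (simp add: amap_def Pi_iff)
qed

lemma tensor_mult_comm:
  assumes zw: "z \<in> carrier (tensor_group k R S)" "w \<in> carrier (tensor_group k R S)"
  shows "tensor_mult z w = tensor_mult w z"
proof (rule amap_tensor_eqI[where P = Z and z = z])
  show "tensor_mult (pt r s) w = tensor_mult w (pt r s)" if "r \<in> carrier R" "s \<in> carrier S" for r s
    by (rule amap_tensor_eqI[where P = Z and z = w])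
      (use zw that in \<open>simp_all add: tensor_mult_amap1 tensor_mult_amap2 tensor_mult_pt
        R.R.m_comm S.R.m_comm\<close>)
qed (use zw in \<open>simp_all add: tensor_mult_amap1 tensor_mult_amap2\<close>)

lemma tensor_mult_assoc:
  assumes x: "x \<in> carrier (tensor_group k R S)" and y: "y \<in> carrier (tensor_group k R S)"
    and z: "z \<in> carrier (tensor_group k R S)"
  shows "tensor_mult (tensor_mult x y) z = tensor_mult x (tensor_mult y z)"
proof (rule amap_tensor_eqI[where P = Z and z = x])
  show "amap Z Z (\<lambda>x. tensor_mult (tensor_mult x y) z)"
    using y z by (intro amap_comp[OF tensor_mult_amap1 tensor_mult_amap1])
  show "tensor_mult (tensor_mult (pt r s) y) z = tensor_mult (pt r s) (tensor_mult y z)"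
    if rs: "r \<in> carrier R" "s \<in> carrier S" for r s
  proof (rule amap_tensor_eqI[where P = Z and z = y])
    show "amap Z Z (\<lambda>y. tensor_mult (tensor_mult (pt r s) y) z)"
      using rs z by (intro amap_comp[OF tensor_mult_amap2 tensor_mult_amap1]) simp_all
    show "amap Z Z (\<lambda>y. tensor_mult (pt r s) (tensor_mult y z))"
      using rs z by (intro amap_comp[OF tensor_mult_amap1 tensor_mult_amap2]) simp_all
    show "tensor_mult (tensor_mult (pt r s) (pt r' s')) z
        = tensor_mult (pt r s) (tensor_mult (pt r' s') z)"
      if rs': "r' \<in> carrier R" "s' \<in> carrier S" for r' s'
    proof (rule amap_tensor_eqI[where P = Z and z = z])
      show "amap Z Z (\<lambda>z. tensor_mult (pt r s) (tensor_mult (pt r' s') z))"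
        using rs rs' by (intro amap_comp[OF tensor_mult_amap2 tensor_mult_amap2]) simp_all
    qed (use z rs rs' in \<open>simp_all add: tensor_mult_pt tensor_mult_amap2 R.R.m_assoc S.R.m_assoc\<close>)
  qed (use y in simp)
qed (use x y z in \<open>simp_all add: tensor_mult_amap1 tensor_mult_closed\<close>)

definition tensor_algebra where
  "tensor_algebra = Z\<lparr>mult := tensor_mult, one := pt \<one>\<^bsub>R\<^esub> \<one>\<^bsub>S\<^esub>\<rparr>"

lemma tensor_algebra_simps [simp]:
  "carrier tensor_algebra = carrier (tensor_group k R S)"
  "add tensor_algebra = add Z" "zero tensor_algebra = zero Z"
  "smult tensor_algebra = smult Z"
  "mult tensor_algebra = tensor_mult" "one tensor_algebra = pt \<one>\<^bsub>R\<^esub> \<one>\<^bsub>S\<^esub>"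
  by (simp_all add: tensor_algebra_def)

lemma tensor_algebra: "algebra k tensor_algebra"
proof -
  interpret ZM: module k Z by (rule tensor_module_module)
  have one: "tensor_mult (pt \<one>\<^bsub>R\<^esub> \<one>\<^bsub>S\<^esub>) z = z" if z: "z \<in> carrier (tensor_group k R S)" for z
    by (rule amap_tensor_eqI[where P = Z and z = z])
      (use z in \<open>simp_all add: tensor_mult_amap2 tensor_mult_pt amap_id\<close>)
  have ab: "abelian_group tensor_algebra"
  proof (rule abelian_groupI, goal_cases)
    case (4 x y)
    then show ?case using Z.a_comm by simp
  next
    case (6 x)
    then show ?case using Z.l_neg[of x] by auto
  qed (simp_all add: Z.a_assoc)
  have mc: "comm_monoid tensor_algebra"
    by (rule comm_monoidI; simp add: tensor_mult_closed tensor_mult_assoc one;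
        rule tensor_mult_comm; simp)
  have cr: "cring tensor_algebra"
    by (rule cringI[OF ab mc]) (simp add: amap_add[OF tensor_mult_amap1])
  have sm: "a \<odot>\<^bsub>Z\<^esub> x \<in> carrier (tensor_group k R S)"
    if "a \<in> carrier k" "x \<in> carrier (tensor_group k R S)" for a x
    using ZM.smult_closed[of a x] that by simp
  have as2: "tensor_mult (a \<odot>\<^bsub>Z\<^esub> x) y = a \<odot>\<^bsub>Z\<^esub> tensor_mult x y"
    if a: "a \<in> carrier k" and x: "x \<in> carrier (tensor_group k R S)"
      and y: "y \<in> carrier (tensor_group k R S)" for a x y
  proof (rule amap_tensor_eqI[where P = Z and z = x])
    show "amap Z Z (\<lambda>x. tensor_mult (a \<odot>\<^bsub>Z\<^esub> x) y)"
      by (rule amap_comp[OF smult_amap[OF a] tensor_mult_amap1[OF y]])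
    show "amap Z Z (\<lambda>x. a \<odot>\<^bsub>Z\<^esub> tensor_mult x y)"
      by (rule amap_comp[OF tensor_mult_amap1[OF y] smult_amap[OF a]])
    show "tensor_mult (a \<odot>\<^bsub>Z\<^esub> pt r s) y = a \<odot>\<^bsub>Z\<^esub> tensor_mult (pt r s) y"
      if rs: "r \<in> carrier R" "s \<in> carrier S" for r s
    proof (rule amap_tensor_eqI[where P = Z and z = y])
      show "amap Z Z (\<lambda>y. tensor_mult (a \<odot>\<^bsub>Z\<^esub> pt r s) y)"
        using a rs by (intro tensor_mult_amap2 sm) auto
      show "amap Z Z (\<lambda>y. a \<odot>\<^bsub>Z\<^esub> tensor_mult (pt r s) y)"
        using a rs by (intro amap_comp[OF tensor_mult_amap2 smult_amap]) auto
    qed (use a rs y in \<open>simp_all add: smult_pt tensor_mult_pt R.R.smult_assoc2\<close>)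
  qed (use x in simp)
  show ?thesis
    using ZM.smult_l_distr ZM.smult_r_distr ZM.smult_assoc1 ZM.smult_one
    by (intro algebraI[OF algebra.R_cring[OF R] cr]) (simp_all add: sm as2)
qed

end

section \<open>Transport of structure\<close>

text \<open>Meant for \<beta> injective on the carrier, with \<gamma> as its inverse on the image.
  It serves to bring modules and algebras carried by sets of cosets back into the universe.\<close>

definition transport :: "('b \<Rightarrow> 'c) \<Rightarrow> ('a, 'b) module \<Rightarrow> ('a, 'c) module"
  where "transport \<beta> M =
     (let \<gamma> = inv_into (carrier M) \<beta> in
      \<lparr>carrier = \<beta> ` carrier M, mult = (\<lambda>x y. \<beta> (\<gamma> x \<otimes>\<^bsub>M\<^esub> \<gamma> y)), one = \<beta> \<one>\<^bsub>M\<^esub>,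
       zero = \<beta> \<zero>\<^bsub>M\<^esub>, add = (\<lambda>x y. \<beta> (\<gamma> x \<oplus>\<^bsub>M\<^esub> \<gamma> y)), smult = (\<lambda>a x. \<beta> (a \<odot>\<^bsub>M\<^esub> \<gamma> x))\<rparr>)"

locale transported =
  fixes M :: "('a, 'b) module" and \<beta> :: "'b \<Rightarrow> 'c"
  assumes inj: "inj_on \<beta> (carrier M)"
begin

abbreviation "T \<equiv> transport \<beta> M"

lemma transport_carrier [simp]: "carrier T = \<beta> ` carrier M"
  and transport_one [simp]: "\<one>\<^bsub>T\<^esub> = \<beta> \<one>\<^bsub>M\<^esub>"
  and transport_zero [simp]: "\<zero>\<^bsub>T\<^esub> = \<beta> \<zero>\<^bsub>M\<^esub>"
  and transport_mult: "x \<in> carrier M \<Longrightarrow> y \<in> carrier M \<Longrightarrow> \<beta> x \<otimes>\<^bsub>T\<^esub> \<beta> y = \<beta> (x \<otimes>\<^bsub>M\<^esub> y)"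
  and transport_add: "x \<in> carrier M \<Longrightarrow> y \<in> carrier M \<Longrightarrow> \<beta> x \<oplus>\<^bsub>T\<^esub> \<beta> y = \<beta> (x \<oplus>\<^bsub>M\<^esub> y)"
  and transport_smult: "x \<in> carrier M \<Longrightarrow> a \<odot>\<^bsub>T\<^esub> \<beta> x = \<beta> (a \<odot>\<^bsub>M\<^esub> x)"
  using inj by (simp_all add: transport_def Let_def)

lemmas transport_simps = transport_mult transport_add transport_smult

lemma transport_bij: "bij_betw \<beta> (carrier M) (carrier T)"
  using inj by (simp add: bij_betw_def)

lemma transport_module:
  assumes "module K M" shows "module K T"
proof -
  interpret module K M by fact
  show ?thesis
  proof (rule moduleI)
    show "cring K" by (rule R.is_cring)
    show "abelian_group T"
    proof (rule abelian_groupI, goal_cases)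
      case (4 x y)
      then show ?case by (auto simp: transport_simps intro!: arg_cong[of _ _ \<beta>] M.a_comm)
    next
      case (6 x)
      then show ?case by (auto simp: transport_simps M.l_neg intro!: bexI[of _ "\<ominus>\<^bsub>M\<^esub> _"])
    qed (auto simp: transport_simps M.a_assoc)
  qed (auto simp: transport_simps smult_l_distr smult_r_distr smult_assoc1)
qed

lemma transport_algebra:
  assumes "algebra K M" shows "algebra K T"
proof -
  interpret algebra K M by fact
  have TM: "module K T" by (rule transport_module[OF module])
  have mc: "comm_monoid T"
  proof (rule comm_monoidI, goal_cases)
    case (5 x y)
    then show ?case by (auto simp: transport_simps intro!: arg_cong[of _ _ \<beta>] m_comm)
  qed (auto simp: transport_simps m_assoc)
  have cr: "cring T"
    by (rule cringI[OF module_trans(2)[OF TM] mc]) (auto simp: transport_simps l_distr)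
  interpret T: module K T by (rule TM)
  show ?thesis
    by (intro algebraI[OF R.is_cring cr])
      (use T.smult_closed T.smult_l_distr T.smult_r_distr T.smult_assoc1 T.smult_one in
        \<open>auto simp: transport_simps smult_assoc2\<close>)
qed

end

text \<open>A tensor product is a quotient of the free Abelian group on pairs, and a free Abelian
  group on an infinite set has the cardinality of that set. The carriers themselves may be finite,
  hence the comparison with the group on all pairs of the universe.\<close>

lemma tensor_inj_universe:
  fixes M N :: "('a, 'u::infinite, 'y) module_scheme"
  assumes "module K M" "module K N"
  obtains \<beta> :: "(('u \<times> 'u) \<Rightarrow>\<^sub>0 int) set \<Rightarrow> 'u" where "inj_on \<beta> (carrier (tensor_group K M N))"
proof -
  have inf: "infinite (UNIV :: ('u \<times> 'u) set)"
    using infinite_UNIV by (simp add: finite_prod)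
  have "carrier (tensor_group K M N)
      \<subseteq> (\<lambda>x. tensor_kernel K M N #>\<^bsub>free_Abelian_group (carrier M \<times> carrier N)\<^esub> x) `
          carrier (free_Abelian_group (carrier M \<times> carrier N))"
    unfolding tensor_group_def FactGroup_def RCOSETS_def by auto
  then have "carrier (tensor_group K M N) \<lesssim> carrier (free_Abelian_group (carrier M \<times> carrier N))"
    by (meson image_lepoll lepoll_trans subset_imp_lepoll)
  also have "\<dots> \<lesssim> carrier (free_Abelian_group (UNIV :: ('u \<times> 'u) set))"
    by (rule subset_imp_lepoll) auto
  also have "\<dots> \<approx> (UNIV :: ('u \<times> 'u) set)" by (rule eqpoll_free_Abelian_group_infinite[OF inf])
  also have "(UNIV :: ('u \<times> 'u) set) \<approx> (UNIV :: 'u set)"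
    unfolding eqpoll_iff_card_of_ordIso UNIV_Times_UNIV[symmetric]
    by (rule card_of_Times_same_infinite[OF infinite_UNIV])
  finally show thesis using that by (auto simp: lepoll_def)
qed

section \<open>The coproduct of two algebras inside the universe\<close>

locale coproduct = alg_pair k R S
  for k :: "('u::infinite, 'x) ring_scheme" and R S :: "('u, 'u) module"
begin

definition \<beta> where "\<beta> = (SOME \<beta> :: _ \<Rightarrow> 'u. inj_on \<beta> (carrier (tensor_group k R S)))"

lemma \<beta>_inj: "inj_on \<beta> (carrier (tensor_group k R S))"
proof -
  obtain \<gamma> :: "_ \<Rightarrow> 'u" where "inj_on \<gamma> (carrier (tensor_group k R S))"
    by (rule tensor_inj_universe[OF M N])
  then show ?thesis unfolding \<beta>_def
    by (rule someI[where P = "\<lambda>\<beta>. inj_on \<beta> (carrier (tensor_group k R S))"])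
qed

text \<open>The copy is needed because \<open>G\<close> can be evaluated only at algebras carried by
  \<open>'u\<close>, and the universal pair of points lives over this algebra.\<close>

definition Co :: "('u, 'u) module" where "Co = transport \<beta> tensor_algebra"

sublocale tr: transported tensor_algebra \<beta>
  rewrites "transport \<beta> tensor_algebra \<equiv> Co"
  by (unfold_locales, simp add: \<beta>_inj) (simp add: Co_def)

lemma Co_algebra: "algebra k Co"
  by (rule tr.transport_algebra[OF tensor_algebra])

sublocale Co: algebra k Co by (rule Co_algebra)

lemma \<beta>_amap: "amap Z Co \<beta>"
  by (rule amapI) (simp_all add: tr.transport_add)

definition inl where "inl = (\<lambda>r\<in>carrier R. \<beta> (pt r \<one>\<^bsub>S\<^esub>))"
definition inr where "inr = (\<lambda>s\<in>carrier S. \<beta> (pt \<one>\<^bsub>R\<^esub> s))"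

lemma \<beta>_pt: "r \<in> carrier R \<Longrightarrow> s \<in> carrier S \<Longrightarrow> \<beta> (pt r s) = inl r \<otimes>\<^bsub>Co\<^esub> inr s"
  by (simp add: inl_def inr_def tr.transport_mult tensor_mult_pt)

lemma inl_hom: "inl \<in> alg_hom k R Co"
  by (rule alg_homI)
    (simp_all add: inl_def tr.transport_simps tensor_mult_pt pt_add1 smult_pt)

lemma inr_hom: "inr \<in> alg_hom k S Co"
  by (rule alg_homI)
    (simp_all add: inr_def tr.transport_simps tensor_mult_pt pt_add2 smult_pt pt_smult)

lemma copair_balanced:
  assumes U: "algebra k U" and p: "p \<in> alg_hom k R U" and q: "q \<in> alg_hom k S U"
  shows "balanced k R S U (\<lambda>r s. p r \<otimes>\<^bsub>U\<^esub> q s)"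
proof -
  interpret U: algebra k U by fact
  note ps = alg_homD[OF p] and qs = alg_homD[OF q]
  show ?thesis
    using ps(4) qs(4)
    by (intro balancedI)
      (simp_all add: ps qs U.l_distr U.r_distr U.smult_assoc2 U.smult_assoc2_right)
qed

text \<open>The last clause describes the mediating map on every tensor and not only on the two
  factors. It is what turns the value of a function at a product of points into \<open>hat\<close>
  of a tensor in \<open>comult_exists\<close>.\<close>

lemma copair:
  assumes U: "algebra k U" and p: "p \<in> alg_hom k R U" and q: "q \<in> alg_hom k S U"
  obtains t where "t \<in> alg_hom k Co U" "compose (carrier R) t inl = p"
      "compose (carrier S) t inr = q"
    "\<And>z. z \<in> carrier (tensor_group k R S) \<Longrightarrow> t (\<beta> z) = tlift k R S U (\<lambda>r s. p r \<otimes>\<^bsub>U\<^esub> q s) z"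
proof -
  interpret U: algebra k U by fact
  note ps = alg_homD[OF p] and qs = alg_homD[OF q]
  let ?b = "\<lambda>r s. p r \<otimes>\<^bsub>U\<^esub> q s"
  let ?h = "tlift k R S U ?b"
  note b = copair_balanced[OF assms]
  note h = tlift_amap[OF U.M.abelian_group_axioms b]
    and hp = tlift_pt[OF U.M.abelian_group_axioms b]
  define t where "t = (\<lambda>x\<in>carrier Co. ?h (inv_into (carrier (tensor_group k R S)) \<beta> x))"
  have t: "t (\<beta> z) = ?h z" if "z \<in> carrier (tensor_group k R S)" for z
    using that \<beta>_inj by (simp add: t_def)
  have sm: "?h (a \<odot>\<^bsub>Z\<^esub> z) = a \<odot>\<^bsub>U\<^esub> ?h z"
    if a: "a \<in> carrier k" and z: "z \<in> carrier (tensor_group k R S)" for a z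
  proof (rule amap_tensor_eqI[where P = U and z = z])
    show "amap Z U (\<lambda>z. ?h (a \<odot>\<^bsub>Z\<^esub> z))" by (rule amap_comp[OF smult_amap[OF a] h])
    show "amap Z U (\<lambda>z. a \<odot>\<^bsub>U\<^esub> ?h z)"
      by (rule amap_comp[OF h module_hom_amap[OF U.smult_module_hom[OF a]]])
  qed (use a z ps(4) qs(4) in \<open>simp_all add: smult_pt hp ps(8) U.smult_assoc2\<close>)
  have mu: "?h (tensor_mult x y) = ?h x \<otimes>\<^bsub>U\<^esub> ?h y"
    if x: "x \<in> carrier (tensor_group k R S)" and y: "y \<in> carrier (tensor_group k R S)" for x y
  proof (rule amap_tensor_eqI[where P = U and z = x])
    have mr: "amap U U (\<lambda>u. u \<otimes>\<^bsub>U\<^esub> v)" and ml: "amap U U (\<lambda>u. v \<otimes>\<^bsub>U\<^esub> u)" if "v \<in> carrier U" for v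
      using that by (simp_all add: amap_def U.l_distr U.r_distr)
    show "amap Z U (\<lambda>x. ?h (tensor_mult x y))" by (rule amap_comp[OF tensor_mult_amap1[OF y] h])
    show "amap Z U (\<lambda>x. ?h x \<otimes>\<^bsub>U\<^esub> ?h y)"
      using y by (intro amap_comp[OF h mr]) (simp add: amap_closed[OF h])
    show "?h (tensor_mult (pt r s) y) = ?h (pt r s) \<otimes>\<^bsub>U\<^esub> ?h y"
      if rs: "r \<in> carrier R" "s \<in> carrier S" for r s
    proof (rule amap_tensor_eqI[where P = U and z = y])
      show "amap Z U (\<lambda>y. ?h (tensor_mult (pt r s) y))"
        using rs by (intro amap_comp[OF tensor_mult_amap2 h]) simp
      show "amap Z U (\<lambda>y. ?h (pt r s) \<otimes>\<^bsub>U\<^esub> ?h y)"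
        using rs by (intro amap_comp[OF h ml]) (simp add: amap_closed[OF h])
    qed (use rs y ps(4) qs(4) in \<open>simp_all add: tensor_mult_pt hp ps(6) qs(6) U.m_ac\<close>)
  qed (use x in simp)
  show thesis
  proof (rule that[of t])
    show "t (\<beta> z) = ?h z" if "z \<in> carrier (tensor_group k R S)" for z using t that .
    show "t \<in> alg_hom k Co U"
      using amap_closed[OF h] tensor_mult_closed amap_closed[OF smult_amap]
      by (intro alg_homI)
        (auto simp: tr.transport_simps t amap_add[OF h] mu sm hp ps qs, simp add: t_def)
    show "compose (carrier R) t inl = p"
      by (rule extensionalityI[of _ "carrier R"])
        (use ps(3) ps(4) in \<open>auto simp: compose_def inl_def t hp qs(7)\<close>)
    show "compose (carrier S) t inr = q"
      by (rule extensionalityI[of _ "carrier S"])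
        (use qs(3) qs(4) in \<open>auto simp: compose_def inr_def t hp ps(7)\<close>)
  qed
qed

end

section \<open>Linear functionals\<close>

lemma base_space_simps [simp]:
  "carrier (base_space k) = carrier k" "zero (base_space k) = zero k" "add (base_space k) = add k"
  "smult (base_space k) = mult k" "mult (base_space k) = mult k" "one (base_space k) = one k"
  by (simp_all add: base_space_def)

abbreviation "functionals k A \<equiv> module_hom k A (base_space k)"

lemma submodule_Union_chain:
  assumes A: "module k A" and C: "C \<noteq> {}" "subset.chain {W. submodule k W A} C"
  shows "submodule k (\<Union>C) A"
proof -
  interpret module k A by fact
  have sub: "submodule k W A" if "W \<in> C" for W using C that by (auto simp: subset.chain_def)
  show ?thesis
  proof (rule submodule.intro[OF A])
    show "\<Union>C \<subseteq> carrier A" using submodule.subset[OF sub] by blast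
    show "\<zero>\<^bsub>A\<^esub> \<in> \<Union>C" using C(1) submodule.zero_closed[OF sub] by blast
    show "v \<oplus>\<^bsub>A\<^esub> w \<in> \<Union>C" if vw: "v \<in> \<Union>C" "w \<in> \<Union>C" for v w
    proof -
      obtain X Y where XY: "X \<in> C" "v \<in> X" "Y \<in> C" "w \<in> Y" using vw by blast
      then have "X \<subseteq> Y \<or> Y \<subseteq> X" using C(2) by (auto simp: subset.chain_def)
      then show ?thesis using XY submodule.m_closed[OF sub] by blast
    qed
    show "c \<odot>\<^bsub>A\<^esub> v \<in> \<Union>C" if "c \<in> carrier k" "v \<in> \<Union>C" for c v
      using that submodule.smult_closed[OF sub] by blast
  qed
qed

text \<open>Zorn's lemma gives a subspace \<open>M\<close> maximal among those that contain
  \<open>W\<close> and miss \<open>x\<close>. Maximality makes \<open>M\<close> a complement of the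
  line through \<open>x\<close>, and the functional is the coefficient of \<open>x\<close>. No basis
  of \<open>A\<close>, which may have infinite dimension, has to be chosen.\<close>

lemma functional_exists:
  assumes A: "vectorspace k A" and W: "submodule k W A" and x: "x \<in> carrier A" "x \<notin> W"
  obtains f where "f \<in> functionals k A" "f x = \<one>\<^bsub>k\<^esub>" "\<And>w. w \<in> W \<Longrightarrow> f w = \<zero>\<^bsub>k\<^esub>"
proof -
  interpret vectorspace k A by fact
  let ?S = "{M. submodule k M A \<and> W \<subseteq> M \<and> x \<notin> M}"
  have "\<exists>M\<in>?S. \<forall>X\<in>?S. M \<subseteq> X \<longrightarrow> X = M"
  proof (rule subset_Zorn_nonempty)
    show "?S \<noteq> {}" using W x by auto
    show "\<Union>C \<in> ?S" if C: "C \<noteq> {}" "subset.chain ?S C" for C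
    proof -
      have "subset.chain {W. submodule k W A} C" using C(2) by (auto simp: subset.chain_def)
      then have "submodule k (\<Union>C) A" using submodule_Union_chain[OF module_axioms C(1)] by blast
      then show ?thesis using C by (auto simp: subset.chain_def)
    qed
  qed
  then obtain M where MS: "M \<in> ?S" and mx: "\<forall>X\<in>?S. M \<subseteq> X \<longrightarrow> X = M" by (rule bexE)
  have M: "submodule k M A" "W \<subseteq> M" "x \<notin> M" using MS by simp_all
  have max: "X = M" if "submodule k X A" "M \<subseteq> X" "x \<notin> X" for X
    using mx that order_trans[OF M(2)] by simp
  interpret M: submodule k M A by (rule M(1))
  have Mc: "m \<in> M \<Longrightarrow> m \<in> carrier A" for m using M.subset by blast
  have Mneg: "\<ominus>\<^bsub>A\<^esub> m \<in> M" if "m \<in> M" for m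
    using M.smult_closed[of "\<ominus>\<^bsub>k\<^esub> \<one>\<^bsub>k\<^esub>" m] smult_l_minus[of "\<one>\<^bsub>k\<^esub>" m] that Mc[OF that] by simp
  have ex: "\<exists>c\<in>carrier k. \<exists>m\<in>M. a = c \<odot>\<^bsub>A\<^esub> x \<oplus>\<^bsub>A\<^esub> m" if a: "a \<in> carrier A" for a
  proof (cases "a \<in> M")
    case True
    then show ?thesis using x a by (intro bexI[of _ "\<zero>\<^bsub>k\<^esub>"] bexI[of _ a]) simp_all
  next
    case False
    \<comment> \<open>The sum of \<open>M\<close> and the line through \<open>a\<close> is strictly
      larger than \<open>M\<close>, so it contains \<open>x\<close>. The coefficient
      \<open>d\<close> of \<open>a\<close> in \<open>x\<close> is nonzero because \<open>x\<close>
      is not in \<open>M\<close>; dividing by it solves for \<open>a\<close>.\<close>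
    let ?X = "{d \<odot>\<^bsub>A\<^esub> a \<oplus>\<^bsub>A\<^esub> m | d m. d \<in> carrier k \<and> m \<in> M}"
    have "submodule k ?X A"
    proof (rule submodule.intro[OF module_axioms])
      show "?X \<subseteq> carrier A" using a Mc by auto
      show "\<zero>\<^bsub>A\<^esub> \<in> ?X" using a by (auto intro!: exI[of _ "\<zero>\<^bsub>k\<^esub>"] exI[of _ "\<zero>\<^bsub>A\<^esub>"])
      show "v \<oplus>\<^bsub>A\<^esub> w \<in> ?X" if vw: "v \<in> ?X" "w \<in> ?X" for v w
      proof -
        obtain d m d' m' where *: "v = d \<odot>\<^bsub>A\<^esub> a \<oplus>\<^bsub>A\<^esub> m" "w = d' \<odot>\<^bsub>A\<^esub> a \<oplus>\<^bsub>A\<^esub> m'"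
          "d \<in> carrier k" "d' \<in> carrier k" "m \<in> M" "m' \<in> M" using vw by blast
        then have "v \<oplus>\<^bsub>A\<^esub> w = (d \<oplus>\<^bsub>k\<^esub> d') \<odot>\<^bsub>A\<^esub> a \<oplus>\<^bsub>A\<^esub> (m \<oplus>\<^bsub>A\<^esub> m')"
          using a Mc by (simp add: smult_l_distr M.a_ac)
        then show ?thesis using * by blast
      qed
      show "c \<odot>\<^bsub>A\<^esub> v \<in> ?X" if cv: "c \<in> carrier k" "v \<in> ?X" for c v
      proof -
        obtain d m where *: "v = d \<odot>\<^bsub>A\<^esub> a \<oplus>\<^bsub>A\<^esub> m" "d \<in> carrier k" "m \<in> M" using cv by blast
        then have "c \<odot>\<^bsub>A\<^esub> v = (c \<otimes>\<^bsub>k\<^esub> d) \<odot>\<^bsub>A\<^esub> a \<oplus>\<^bsub>A\<^esub> c \<odot>\<^bsub>A\<^esub> m"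
          using a Mc cv by (simp add: smult_r_distr smult_assoc1)
        then show ?thesis using * cv by blast
      qed
    qed
    moreover have "M \<subseteq> ?X"
    proof
      fix m assume "m \<in> M"
      then show "m \<in> ?X" using a Mc by (auto intro!: exI[of _ "\<zero>\<^bsub>k\<^esub>"] exI[of _ m])
    qed
    moreover have "a \<in> ?X" using a by (auto intro!: exI[of _ "\<one>\<^bsub>k\<^esub>"] exI[of _ "\<zero>\<^bsub>A\<^esub>"])
    ultimately have "x \<in> ?X" using max[of ?X] False by blast
    then obtain d m where dm: "x = d \<odot>\<^bsub>A\<^esub> a \<oplus>\<^bsub>A\<^esub> m" "d \<in> carrier k" "m \<in> M" by blast
    have "d \<noteq> \<zero>\<^bsub>k\<^esub>" using dm M(3) a Mc by auto
    then have inv: "inv\<^bsub>k\<^esub> d \<in> carrier k" "inv\<^bsub>k\<^esub> d \<otimes>\<^bsub>k\<^esub> d = \<one>\<^bsub>k\<^esub>"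
      using dm(2) field_Units by auto
    have "inv\<^bsub>k\<^esub> d \<odot>\<^bsub>A\<^esub> x = a \<oplus>\<^bsub>A\<^esub> inv\<^bsub>k\<^esub> d \<odot>\<^bsub>A\<^esub> m"
      using dm inv a Mc by (simp add: smult_r_distr flip: smult_assoc1)
    then have "a = inv\<^bsub>k\<^esub> d \<odot>\<^bsub>A\<^esub> x \<oplus>\<^bsub>A\<^esub> \<ominus>\<^bsub>A\<^esub> (inv\<^bsub>k\<^esub> d \<odot>\<^bsub>A\<^esub> m)"
      using inv dm a Mc by (simp add: M.a_assoc M.r_neg)
    then show ?thesis using inv dm Mneg by blast
  qed
  \<comment> \<open>Two different coefficients would put a nonzero multiple of \<open>x\<close>,
    hence \<open>x\<close> itself, into \<open>M\<close>.\<close>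
  have uniq: "c = c'" if c: "c \<in> carrier k" "c' \<in> carrier k" "m \<in> M" "m' \<in> M"
    and eq: "c \<odot>\<^bsub>A\<^esub> x \<oplus>\<^bsub>A\<^esub> m = c' \<odot>\<^bsub>A\<^esub> x \<oplus>\<^bsub>A\<^esub> m'" for c c' m m'
  proof (rule ccontr)
    assume "c \<noteq> c'"
    let ?d = "c \<ominus>\<^bsub>k\<^esub> c'"
    have d: "?d \<in> carrier k" "?d \<noteq> \<zero>\<^bsub>k\<^esub>"
      using c \<open>c \<noteq> c'\<close> by (simp_all)
    then have inv: "inv\<^bsub>k\<^esub> ?d \<in> carrier k" "inv\<^bsub>k\<^esub> ?d \<otimes>\<^bsub>k\<^esub> ?d = \<one>\<^bsub>k\<^esub>"
      using field_Units by auto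
    have "c \<odot>\<^bsub>A\<^esub> x = (c' \<odot>\<^bsub>A\<^esub> x \<oplus>\<^bsub>A\<^esub> m') \<oplus>\<^bsub>A\<^esub> \<ominus>\<^bsub>A\<^esub> m"
      using c x Mc by (simp add: M.a_assoc M.r_neg flip: eq)
    then have "?d \<odot>\<^bsub>A\<^esub> x = m' \<oplus>\<^bsub>A\<^esub> \<ominus>\<^bsub>A\<^esub> m"
      using c x Mc by (simp add: R.minus_eq smult_l_distr smult_l_minus M.a_ac M.r_neg1 M.r_neg2
          M.r_neg)
    then have "?d \<odot>\<^bsub>A\<^esub> x \<in> M" using c Mneg by simp
    then have "inv\<^bsub>k\<^esub> ?d \<odot>\<^bsub>A\<^esub> (?d \<odot>\<^bsub>A\<^esub> x) \<in> M" using inv by simp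
    then show False using inv d x M(3) by (simp flip: smult_assoc1)
  qed
  define f where "f a = (THE c. c \<in> carrier k \<and> (\<exists>m\<in>M. a = c \<odot>\<^bsub>A\<^esub> x \<oplus>\<^bsub>A\<^esub> m))" for a
  have f: "f (c \<odot>\<^bsub>A\<^esub> x \<oplus>\<^bsub>A\<^esub> m) = c" if "c \<in> carrier k" "m \<in> M" for c m
    unfolding f_def using that uniq by (intro the_equality) blast+
  have "f \<in> functionals k A"
  proof (rule module_homI, rule amapI)
    show "f a \<in> carrier (base_space k)" if "a \<in> carrier A" for a
      using ex[OF that] f by auto
    show "f (a \<oplus>\<^bsub>A\<^esub> b) = f a \<oplus>\<^bsub>base_space k\<^esub> f b" if ab: "a \<in> carrier A" "b \<in> carrier A" for a b
    proof -
      obtain c m d n where *: "a = c \<odot>\<^bsub>A\<^esub> x \<oplus>\<^bsub>A\<^esub> m" "b = d \<odot>\<^bsub>A\<^esub> x \<oplus>\<^bsub>A\<^esub> n"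
        "c \<in> carrier k" "d \<in> carrier k" "m \<in> M" "n \<in> M" using ex ab by meson
      then have "a \<oplus>\<^bsub>A\<^esub> b = (c \<oplus>\<^bsub>k\<^esub> d) \<odot>\<^bsub>A\<^esub> x \<oplus>\<^bsub>A\<^esub> (m \<oplus>\<^bsub>A\<^esub> n)"
        using x Mc by (simp add: smult_l_distr M.a_ac)
      then show ?thesis using * f[of "c \<oplus>\<^bsub>k\<^esub> d" "m \<oplus>\<^bsub>A\<^esub> n"] by (simp add: f)
    qed
    show "f (c \<odot>\<^bsub>A\<^esub> a) = c \<odot>\<^bsub>base_space k\<^esub> f a" if ca: "c \<in> carrier k" "a \<in> carrier A" for c a
    proof -
      obtain d m where *: "a = d \<odot>\<^bsub>A\<^esub> x \<oplus>\<^bsub>A\<^esub> m" "d \<in> carrier k" "m \<in> M" using ex ca by meson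
      then have "c \<odot>\<^bsub>A\<^esub> a = (c \<otimes>\<^bsub>k\<^esub> d) \<odot>\<^bsub>A\<^esub> x \<oplus>\<^bsub>A\<^esub> c \<odot>\<^bsub>A\<^esub> m"
        using x Mc ca by (simp add: smult_r_distr smult_assoc1)
      then show ?thesis using * ca f[of "c \<otimes>\<^bsub>k\<^esub> d" "c \<odot>\<^bsub>A\<^esub> m"] by (simp add: f)
    qed
  qed
  moreover have "f x = \<one>\<^bsub>k\<^esub>" using f[of "\<one>\<^bsub>k\<^esub>" "\<zero>\<^bsub>A\<^esub>"] x by simp
  moreover have "f w = \<zero>\<^bsub>k\<^esub>" if "w \<in> W" for w
    using f[of "\<zero>\<^bsub>k\<^esub>" w] x that M(2) Mc by auto
  ultimately show thesis using that by blast
qed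

text \<open>Generation is tested against submodules instead of linear combinations. A property that
  cuts out a submodule then passes from a finite set \<open>B\<close> to the whole space in one
  step, usually through \<open>preimage_submodule\<close>.\<close>

lemma fin_dim_iff:
  assumes "vectorspace k V"
  shows "vectorspace.fin_dim k V \<longleftrightarrow>
    (\<exists>B. finite B \<and> B \<subseteq> carrier V \<and> (\<forall>U. submodule k U V \<longrightarrow> B \<subseteq> U \<longrightarrow> carrier V \<subseteq> U))"
proof -
  interpret vectorspace k V by fact
  have "span B = carrier V \<longleftrightarrow> (\<forall>U. submodule k U V \<longrightarrow> B \<subseteq> U \<longrightarrow> carrier V \<subseteq> U)"
    if "B \<subseteq> carrier V" for B
    using span_is_subset[of B] span_is_submodule[OF that] in_own_span[OF that]
        span_is_subset2[OF that]
    by (metis subset_antisym)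
  then show ?thesis unfolding fin_dim_def by (metis (no_types, lifting))
qed

section \<open>Slices of tensors\<close>

text \<open>The left factor is a subspace \<open>V\<close> of \<open>A\<close>, but slices are taken
  by functionals on all of \<open>A\<close>. Slices in V \<otimes> N and in A \<otimes> N by the
  same functional can then be compared, which gives injectivity of the map between the two in
  \<open>hat_eqI\<close>.\<close>

locale vec_tensor =
  fixes k :: "'u ring" and A :: "('u, 'v, 'y) module_scheme" and V :: "'v set"
    and N :: "('u, 'n, 'z) module_scheme"
  assumes A: "vectorspace k A" and V: "submodule k V A" and N': "module k N"
begin

sublocale A: vectorspace k A by (rule A)
sublocale V: submodule k V A by (rule V)

sublocale tensor_pair k "A\<lparr>carrier := V\<rparr>" N
  by (rule tensor_pair.intro[OF A.submodule_is_module[OF V] N'])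

abbreviation "subsp \<equiv> A\<lparr>carrier := V\<rparr>"

lemma V_in: "v \<in> V \<Longrightarrow> v \<in> carrier A" using V.subset by blast

definition slice where "slice f = tlift k subsp N N (\<lambda>v n. f v \<odot>\<^bsub>N\<^esub> n)"

lemma functionalD:
  assumes "f \<in> functionals k A"
  shows "v \<in> carrier A \<Longrightarrow> f v \<in> carrier k"
    "v \<in> carrier A \<Longrightarrow> w \<in> carrier A \<Longrightarrow> f (v \<oplus>\<^bsub>A\<^esub> w) = f v \<oplus>\<^bsub>k\<^esub> f w"
    "c \<in> carrier k \<Longrightarrow> v \<in> carrier A \<Longrightarrow> f (c \<odot>\<^bsub>A\<^esub> v) = c \<otimes>\<^bsub>k\<^esub> f v"
  using assms by (auto simp: module_hom_def)

lemma slice_balanced: "f \<in> functionals k A \<Longrightarrow> balanced k subsp N N (\<lambda>v n. f v \<odot>\<^bsub>N\<^esub> n)"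
  by (rule balancedI)
    (simp_all add: functionalD V_in N.smult_l_distr N.smult_r_distr A.R.m_comm flip: N.smult_assoc1)

lemma slice_amap: "f \<in> functionals k A \<Longrightarrow> amap Z N (slice f)"
  and slice_pt: "f \<in> functionals k A \<Longrightarrow> v \<in> V \<Longrightarrow> n \<in> carrier N \<Longrightarrow> slice f (pt v n) = f v \<odot>\<^bsub>N\<^esub> n"
  unfolding slice_def
  using tlift_amap[OF N.abelian_group_axioms slice_balanced]
      tlift_pt[OF N.abelian_group_axioms slice_balanced]
  by simp_all

text \<open>Expressions are lists, so that they have a length to be minimised and a fixed sequence
  of left factors.\<close>

fun tsum where
  "tsum [] = \<zero>\<^bsub>Z\<^esub>"
| "tsum ((v, n) # zs) = pt v n \<oplus>\<^bsub>Z\<^esub> tsum zs"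

lemma tsum_closed: "set zs \<subseteq> V \<times> carrier N \<Longrightarrow> tsum zs \<in> carrier (tensor_group k subsp N)"
  by (induction zs rule: tsum.induct) auto

lemma tsum_append:
  "set zs \<subseteq> V \<times> carrier N \<Longrightarrow> set ws \<subseteq> V \<times> carrier N \<Longrightarrow> tsum (zs @ ws) = tsum zs \<oplus>\<^bsub>Z\<^esub> tsum ws"
  by (induction zs rule: tsum.induct) (auto simp: tsum_closed Z.a_assoc)

lemma tsum_exists:
  assumes "z \<in> carrier (tensor_group k subsp N)"
  shows "\<exists>zs. set zs \<subseteq> V \<times> carrier N \<and> z = tsum zs"
  using assms
proof (induction z rule: tensor_induct)
  case (pure m n)
  then show ?case by (intro exI[of _ "[(m, n)]"]) simp
next
  case (add x y)
  then obtain zs ws where "set zs \<subseteq> V \<times> carrier N" "x = tsum zs" "set ws \<subseteq> V \<times> carrier N"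
      "y = tsum ws"
    by blast
  then show ?case by (intro exI[of _ "zs @ ws"]) (auto simp: tsum_append)
qed

text \<open>Expressions over the same left factors add without growing longer; this is what
  contradicts minimality in \<open>minimal_expression\<close>.\<close>

lemma tsum_add:
  assumes "map fst zs = map fst ws" "set zs \<subseteq> V \<times> carrier N" "set ws \<subseteq> V \<times> carrier N"
  shows "\<exists>us. map fst us = map fst zs \<and> set us \<subseteq> V \<times> carrier N \<and> tsum us = tsum zs \<oplus>\<^bsub>Z\<^esub> tsum ws"
  using assms
proof (induction zs arbitrary: ws)
  case Nil
  then show ?case by (intro exI[of _ "[]"]) simp
next
  case (Cons p zs)
  obtain v n where p: "p = (v, n)" by (cases p)
  obtain n' ws' where ws: "ws = (v, n') # ws'" "map fst zs = map fst ws'"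
    using Cons.prems(1) p by (cases ws) auto
  obtain us where us: "map fst us = map fst zs" "set us \<subseteq> V \<times> carrier N"
      "tsum us = tsum zs \<oplus>\<^bsub>Z\<^esub> tsum ws'"
    using Cons.IH[OF ws(2)] Cons.prems ws by auto
  show ?case
    using Cons.prems us p ws
    by (intro exI[of _ "(v, n \<oplus>\<^bsub>N\<^esub> n') # us"]) (auto simp: pt_add2 tsum_closed Z.a_ac)
qed

lemma tsum_const_zero: "set vs \<subseteq> V \<Longrightarrow> tsum (map (\<lambda>v. (v, \<zero>\<^bsub>N\<^esub>)) vs) = \<zero>\<^bsub>Z\<^esub>"
  by (induction vs) (auto simp: pt_zero2)

lemma slice_tsum_zero:
  assumes "f \<in> functionals k A" "set zs \<subseteq> V \<times> carrier N" "\<And>v. v \<in> fst ` set zs \<Longrightarrow> f v = \<zero>\<^bsub>k\<^esub>"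
  shows "slice f (tsum zs) = \<zero>\<^bsub>N\<^esub>"
  using assms(2,3)
proof (induction zs rule: tsum.induct)
  case 1
  then show ?case
    using amap_zero[OF tensor_abelian_group N.abelian_group_axioms slice_amap[OF assms(1)]] by simp
next
  case (2 v n zs)
  then show ?case
    by (simp add: amap_add[OF slice_amap[OF assms(1)]] tsum_closed slice_pt[OF assms(1)])
qed

text \<open>In an expression of minimal length as a sum of pure tensors the left factors are linearly
  independent, so each right factor is picked out by a functional.\<close>

lemma minimal_expression:
  assumes z: "z \<in> carrier (tensor_group k subsp N)"
  obtains zs where "set zs \<subseteq> V \<times> carrier N" "z = tsum zs"
    "\<And>v n. (v, n) \<in> set zs \<Longrightarrow> \<exists>f\<in>functionals k A. slice f z = n"
proof -
  define P where "P zs \<longleftrightarrow> set zs \<subseteq> V \<times> carrier N \<and> z = tsum zs" for zs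
  have "\<exists>zs. P zs" using tsum_exists[OF z] by (simp add: P_def)
  then obtain zs where zs: "P zs" and min: "\<And>ws. P ws \<Longrightarrow> length zs \<le> length ws"
    using ex_has_least_nat[of P _ length] by meson
  have zsV: "set zs \<subseteq> V \<times> carrier N" and zsz: "z = tsum zs" using zs by (auto simp: P_def)
  show thesis
  proof (rule that[OF zsV zsz])
    fix x n assume "(x, n) \<in> set zs"
    then obtain us vs where split: "zs = us @ (x, n) # vs" by (meson split_list)
    let ?ws = "us @ vs"
    have ws: "set ?ws \<subseteq> V \<times> carrier N" and uv: "set us \<subseteq> V \<times> carrier N" "set vs \<subseteq> V \<times> carrier N"
      and xV: "x \<in> V" and n: "n \<in> carrier N" using zsV split by auto
    have zeq: "z = pt x n \<oplus>\<^bsub>Z\<^esub> tsum ?ws"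
      using zsz split uv xV n by (simp add: tsum_append tsum_closed Z.a_ac)
    let ?Q = "\<lambda>w n zs'. map fst zs' = map fst ?ws \<and> set zs' \<subseteq> V \<times> carrier N \<and> pt w n = tsum zs'"
    \<comment> \<open>\<open>?W\<close> consists of the vectors \<open>w\<close> for which every w
      \<otimes> n can be written over the left factors of the remaining terms. It is a subspace
      containing those factors. Were \<open>x\<close> in it, the term of \<open>x\<close> could be
      absorbed into the others, giving a shorter expression of \<open>z\<close>.\<close>
    let ?W = "{w \<in> V. \<forall>n\<in>carrier N. \<exists>zs'. ?Q w n zs'}"
    have W: "submodule k ?W A"
    proof (rule submodule.intro[OF A.module_axioms])
      show "?W \<subseteq> carrier A" using V_in by auto
      show "\<zero>\<^bsub>A\<^esub> \<in> ?W"
      proof -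
        have "?Q \<zero>\<^bsub>A\<^esub> n (map (\<lambda>v. (v, \<zero>\<^bsub>N\<^esub>)) (map fst ?ws))" if "n \<in> carrier N" for n
        proof -
          have "set (map fst ?ws) \<subseteq> V" using ws by auto
          then have "tsum (map (\<lambda>v. (v, \<zero>\<^bsub>N\<^esub>)) (map fst ?ws)) = pt \<zero>\<^bsub>A\<^esub> n"
            using tsum_const_zero[of "map fst ?ws"] pt_zero1[OF that] by simp
          moreover have "set (map (\<lambda>v. (v, \<zero>\<^bsub>N\<^esub>)) (map fst ?ws)) \<subseteq> V \<times> carrier N" using ws by auto
          ultimately show ?thesis by (simp add: comp_def)
        qed
        then show ?thesis by (simp only: mem_Collect_eq V.zero_closed) blast
      qed
      show "v \<oplus>\<^bsub>A\<^esub> w \<in> ?W" if vw: "v \<in> ?W" "w \<in> ?W" for v w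
      proof -
        have "\<exists>zs'. ?Q (v \<oplus>\<^bsub>A\<^esub> w) n zs'" if n: "n \<in> carrier N" for n
        proof -
          obtain a b where "?Q v n a" "?Q w n b" using vw n by blast
          then show ?thesis using tsum_add[of a b] pt_add1[of v w n] vw n by (simp) metis
        qed
        then show ?thesis using vw V.m_closed by blast
      qed
      show "c \<odot>\<^bsub>A\<^esub> v \<in> ?W" if cv: "c \<in> carrier k" "v \<in> ?W" for c v
      proof -
        have "\<exists>zs'. ?Q (c \<odot>\<^bsub>A\<^esub> v) n zs'" if n: "n \<in> carrier N" for n
          using cv n pt_smult[of c v n] N.smult_closed[of c n] by simp
        then show ?thesis using cv V.smult_closed by blast
      qed
    qed
    have wsW: "y \<in> ?W" if y: "y \<in> fst ` set ?ws" for y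
    proof -
      obtain s where "(y, s) \<in> set ?ws" using y by force
      then obtain as bs where ab: "?ws = as @ (y, s) # bs" by (meson split_list)
      let ?l = "\<lambda>as. map (\<lambda>v. (v, \<zero>\<^bsub>N\<^esub>)) (map fst as)"
      have sub: "set as \<subseteq> V \<times> carrier N" "set bs \<subseteq> V \<times> carrier N" "y \<in> V" using ws unfolding ab
        by auto
      have l: "set (?l cs) \<subseteq> V \<times> carrier N" "tsum (?l cs) = \<zero>\<^bsub>Z\<^esub>" "map fst (?l cs) = map fst cs"
        if "set cs \<subseteq> V \<times> carrier N" for cs
      proof -
        have "set (map fst cs) \<subseteq> V" using that by auto
        then show "tsum (?l cs) = \<zero>\<^bsub>Z\<^esub>" by (rule tsum_const_zero)
      qed (use that in \<open>auto simp: comp_def\<close>)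
      \<comment> \<open>Zero right factors at the other positions leave the sequence of left factors
        unchanged.\<close>
      have "?Q y n (?l as @ (y, n) # ?l bs)" if n: "n \<in> carrier N" for n
      proof -
        have "tsum (?l as @ (y, n) # ?l bs) = pt y n"
          using l[OF sub(1)] l[OF sub(2)] n sub(3) tsum_append[of "?l as" "(y, n) # ?l bs"] by simp
        then show ?thesis unfolding ab using l[OF sub(1)] l[OF sub(2)] n sub(3) by auto
      qed
      then show ?thesis using sub(3) by blast
    qed
    have "x \<notin> ?W"
    proof
      assume "x \<in> ?W"
      then obtain zs' where zs': "?Q x n zs'" using n by blast
      then obtain us' where us': "map fst us' = map fst zs'" "set us' \<subseteq> V \<times> carrier N"
        "tsum us' = tsum zs' \<oplus>\<^bsub>Z\<^esub> tsum ?ws"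
        using tsum_add[of zs' ?ws] ws by blast
      have "P us'" using us' zs' zeq by (simp add: P_def)
      then have "length zs \<le> length us'" by (rule min)
      also have "length us' = length ?ws" using us'(1) zs' by (metis length_map)
      finally show False using split by simp
    qed
    \<comment> \<open>A functional that is 1 at \<open>x\<close> and vanishes on \<open>?W\<close>
      annihilates every other term, so it picks out \<open>n\<close>.\<close>
    then obtain f where f: "f \<in> functionals k A" "f x = \<one>\<^bsub>k\<^esub>" "\<And>w. w \<in> ?W \<Longrightarrow> f w = \<zero>\<^bsub>k\<^esub>"
      using functional_exists[OF A W V_in[OF xV]] by blast
    have "slice f (tsum ?ws) = \<zero>\<^bsub>N\<^esub>"
      by (rule slice_tsum_zero[OF f(1) ws]) (rule f(3), rule wsW)
    then have "slice f z = n"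
      using zeq xV n f(2) by (simp add: amap_add[OF slice_amap[OF f(1)]] tsum_closed[OF ws]
          slice_pt[OF f(1)])
    then show "\<exists>f\<in>functionals k A. slice f z = n" using f(1) by blast
  qed
qed

text \<open>In a minimal expression each right factor is itself a slice of \<open>z\<close>. If all
  slices vanish, so does every term.\<close>

lemma slices_zero:
  assumes z: "z \<in> carrier (tensor_group k subsp N)"
    and 0: "\<And>f. f \<in> functionals k A \<Longrightarrow> slice f z = \<zero>\<^bsub>N\<^esub>"
  shows "z = \<zero>\<^bsub>Z\<^esub>"
proof -
  obtain zs where zs: "set zs \<subseteq> V \<times> carrier N" "z = tsum zs"
    "\<And>v n. (v, n) \<in> set zs \<Longrightarrow> \<exists>f\<in>functionals k A. slice f z = n"
    using minimal_expression[OF z] by blast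
  then have "\<And>v n. (v, n) \<in> set zs \<Longrightarrow> n = \<zero>\<^bsub>N\<^esub>" using 0 by metis
  then have "map (\<lambda>v. (v, \<zero>\<^bsub>N\<^esub>)) (map fst zs) = zs" by (auto intro: map_idI)
  moreover have "set (map fst zs) \<subseteq> V" using zs(1) by auto
  ultimately show ?thesis using tsum_const_zero[of "map fst zs"] zs(2) by simp
qed

lemma slices_eqI:
  assumes z: "z \<in> carrier (tensor_group k subsp N)" and w: "w \<in> carrier (tensor_group k subsp N)"
    and eq: "\<And>f. f \<in> functionals k A \<Longrightarrow> slice f z = slice f w"
  shows "z = w"
proof -
  have "z \<oplus>\<^bsub>Z\<^esub> \<ominus>\<^bsub>Z\<^esub> w = \<zero>\<^bsub>Z\<^esub>"
  proof (rule slices_zero)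
    fix f assume f: "f \<in> functionals k A"
    show "slice f (z \<oplus>\<^bsub>Z\<^esub> \<ominus>\<^bsub>Z\<^esub> w) = \<zero>\<^bsub>N\<^esub>"
      using z w eq[OF f] amap_closed[OF slice_amap[OF f], of w]
      by (simp add: amap_add[OF slice_amap[OF f]] N.r_neg
          amap_minus[OF tensor_abelian_group N.abelian_group_axioms slice_amap[OF f]])
  qed (use z w in simp)
  then show ?thesis using z w
    by (metis Z.minus_equality Z.minus_minus carrier_tensor_module Z_closed(3) Z.a_comm)
qed

end

section \<open>Extension of scalars and tensor products\<close>

locale tens_iso =
  fixes k :: "'u ring" and V :: "('u, 'v) module" and W :: "('u, 'w) module"
    and R :: "('u, 'u) module"
  assumes V: "module k V" and W: "module k W" and R: "algebra k R"
begin

sublocale VR: ext_scal k V R using V R by (rule ext_scal.intro)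
sublocale WR: ext_scal k W R using W R by (rule ext_scal.intro)
sublocale VW: tensor_pair k V W using V W by (rule tensor_pair.intro)
sublocale VWR: ext_scal k VW.Z R using VW.tensor_module_module R by (rule ext_scal.intro)
sublocale TR: tensor_pair R VR.E WR.E using VR.ext_module WR.ext_module by (rule tensor_pair.intro)

text \<open>The inner pure tensors reach all of the outer tensor product because an outer pure
  tensor is additive in each argument.\<close>

lemma double_eqI:
  assumes P: "amap TR.Z P h" "amap TR.Z P h'" and z: "z \<in> carrier (tensor_group R VR.E WR.E)"
    and eq: "\<And>v r w s. v \<in> carrier V \<Longrightarrow> r \<in> carrier R \<Longrightarrow> w \<in> carrier W \<Longrightarrow> s \<in> carrier R \<Longrightarrow>
      h (TR.pt (VR.pt v r) (WR.pt w s)) = h' (TR.pt (VR.pt v r) (WR.pt w s))"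
  shows "h z = h' z"
proof (rule TR.amap_tensor_eqI[OF P z])
  fix x y assume x: "x \<in> carrier VR.E" and y: "y \<in> carrier WR.E"
  note b1 = balanced_amap1[OF TR.pt_balanced] and b2 = balanced_amap2[OF TR.pt_balanced]
  show "h (TR.pt x y) = h' (TR.pt x y)"
  proof (rule VR.amap_tensor_eqI[where P = P and z = x])
    show "amap VR.Z P (\<lambda>x. h (TR.pt x y))" "amap VR.Z P (\<lambda>x. h' (TR.pt x y))"
      using amap_comp[OF b1[OF y] P(1)] amap_comp[OF b1[OF y] P(2)] by (simp_all add: VR.amap_E)
    show "h (TR.pt (VR.pt v r) y) = h' (TR.pt (VR.pt v r) y)"
      if vr: "v \<in> carrier V" "r \<in> carrier R" for v r
    proof (rule WR.amap_tensor_eqI[where P = P and z = y])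
      have vE: "VR.pt v r \<in> carrier VR.E" using vr by simp
      show "amap WR.Z P (\<lambda>y. h (TR.pt (VR.pt v r) y))" "amap WR.Z P (\<lambda>y. h' (TR.pt (VR.pt v r) y))"
        using amap_comp[OF b2[OF vE] P(1)] amap_comp[OF b2[OF vE] P(2)] by (simp_all add: WR.amap_E)
    qed (use y vr eq in simp_all)
  qed (use x in simp)
qed

text \<open>The map takes four arguments and is lifted in stages: over (w, s) for fixed v and r in
  \<open>J_row\<close>, over (v, r) in \<open>J_pair\<close>, and finally over \<open>R\<close> in
  \<open>J_eq\<close>.\<close>

definition J_row where "J_row v r = tlift k W R VWR.Z (\<lambda>w s. VWR.pt (VW.pt v w) (r \<otimes>\<^bsub>R\<^esub> s))"

lemma J_row_balanced:
  "v \<in> carrier V \<Longrightarrow> r \<in> carrier R \<Longrightarrow>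
    balanced k W R VWR.Z (\<lambda>w s. VWR.pt (VW.pt v w) (r \<otimes>\<^bsub>R\<^esub> s))"
  by (rule balancedI)
    (simp_all add: VW.pt_add2 VWR.pt_add1 VWR.pt_add2 VR.R.r_distr VR.R.smult_assoc2_right
      VW.smult_pt VW.pt_smult VWR.pt_smult flip: VWR.pt_smult VW.pt_smult VW.smult_pt)

lemma J_row_amap: "v \<in> carrier V \<Longrightarrow> r \<in> carrier R \<Longrightarrow> amap WR.Z VWR.Z (J_row v r)"
  and J_row_pt: "v \<in> carrier V \<Longrightarrow> r \<in> carrier R \<Longrightarrow> w \<in> carrier W \<Longrightarrow> s \<in> carrier R \<Longrightarrow>
    J_row v r (WR.pt w s) = VWR.pt (VW.pt v w) (r \<otimes>\<^bsub>R\<^esub> s)"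
  unfolding J_row_def
  using WR.tlift_amap[OF VWR.tensor_abelian_group J_row_balanced]
    WR.tlift_pt[OF VWR.tensor_abelian_group J_row_balanced] by simp_all

lemma amap_VWR_add: "amap M VWR.Z f \<Longrightarrow> amap M VWR.Z g \<Longrightarrow> amap M VWR.Z (\<lambda>x. f x \<oplus>\<^bsub>VWR.Z\<^esub> g x)"
  by (auto simp: amap_def Pi_iff VWR.Z.a_ac)

lemma J_col_balanced:
  assumes y: "y \<in> carrier (tensor_group k W R)"
  shows "balanced k V R VWR.Z (\<lambda>v r. J_row v r y)"
proof (rule balancedI)
  show "J_row v r y \<in> carrier VWR.Z" if "v \<in> carrier V" "r \<in> carrier R" for v r
    using amap_closed[OF J_row_amap[OF that]] y by simp
  show "J_row (v \<oplus>\<^bsub>V\<^esub> v') r y = J_row v r y \<oplus>\<^bsub>VWR.Z\<^esub> J_row v' r y"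
    if "v \<in> carrier V" "v' \<in> carrier V" "r \<in> carrier R" for v v' r
    by (rule WR.amap_tensor_eqI[where P = VWR.Z and z = y])
      (use that y in \<open>simp_all add: J_row_amap amap_VWR_add J_row_pt VW.pt_add1 VWR.pt_add1\<close>)
  show "J_row v (r \<oplus>\<^bsub>R\<^esub> r') y = J_row v r y \<oplus>\<^bsub>VWR.Z\<^esub> J_row v r' y"
    if "v \<in> carrier V" "r \<in> carrier R" "r' \<in> carrier R" for v r r'
    by (rule WR.amap_tensor_eqI[where P = VWR.Z and z = y])
      (use that y in \<open>simp_all add: J_row_amap amap_VWR_add J_row_pt VR.R.l_distr VWR.pt_add2\<close>)
  show "J_row (a \<odot>\<^bsub>V\<^esub> v) r y = J_row v (a \<odot>\<^bsub>R\<^esub> r) y"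
    if "a \<in> carrier k" "v \<in> carrier V" "r \<in> carrier R" for a v r
    by (rule WR.amap_tensor_eqI[where P = VWR.Z and z = y])
      (use that y in \<open>simp_all add: J_row_amap J_row_pt VR.R.smult_assoc2 flip: VW.smult_pt
          VWR.pt_smult\<close>)
qed

definition J_pair where "J_pair x y = tlift k V R VWR.Z (\<lambda>v r. J_row v r y) x"

lemma J_pair_amap1: "y \<in> carrier (tensor_group k W R) \<Longrightarrow> amap VR.Z VWR.Z (\<lambda>x. J_pair x y)"
  unfolding J_pair_def by (rule VR.tlift_amap[OF VWR.tensor_abelian_group J_col_balanced])

lemma J_pair_pt1: "v \<in> carrier V \<Longrightarrow> r \<in> carrier R \<Longrightarrow> y \<in> carrier (tensor_group k W R) \<Longrightarrow>
    J_pair (VR.pt v r) y = J_row v r y"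
  unfolding J_pair_def by (rule VR.tlift_pt[OF VWR.tensor_abelian_group J_col_balanced])

lemma J_pair_amap2:
  assumes "x \<in> carrier (tensor_group k V R)"
  shows "amap WR.Z VWR.Z (J_pair x)"
  using assms
proof (induction x rule: VR.tensor_induct)
  case (pure v r)
  then show ?case using J_row_amap[of v r] by (simp add: amap_def Pi_iff J_pair_pt1)
next
  case (add x y)
  have "amap WR.Z VWR.Z (\<lambda>w. J_pair x w \<oplus>\<^bsub>VWR.Z\<^esub> J_pair y w)" using add by (intro amap_VWR_add)
  then show ?case using add amap_add[OF J_pair_amap1] by (simp add: amap_def Pi_iff)
qed

text \<open>Compatibility with scalars of \<open>R\<close> on either side is what lets
  \<open>J_pair\<close> descend to the tensor product over \<open>R\<close>.\<close>

lemma J_pair_smult: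
  assumes r: "r \<in> carrier R" and x: "x \<in> carrier (tensor_group k V R)"
    and y: "y \<in> carrier (tensor_group k W R)"
  shows "J_pair (r \<odot>\<^bsub>VR.E\<^esub> x) y = r \<odot>\<^bsub>VWR.E\<^esub> J_pair x y" (is ?l)
    and "J_pair x (r \<odot>\<^bsub>WR.E\<^esub> y) = r \<odot>\<^bsub>VWR.E\<^esub> J_pair x y" (is ?r)
proof -
  show ?l
  proof (rule VR.amap_tensor_eqI[where P = VWR.Z and z = x])
    show "amap VR.Z VWR.Z (\<lambda>x. J_pair (r \<odot>\<^bsub>VR.E\<^esub> x) y)"
      by (rule amap_comp[OF VR.esmult_amap[OF r] J_pair_amap1[OF y]])
    show "amap VR.Z VWR.Z (\<lambda>x. r \<odot>\<^bsub>VWR.E\<^esub> J_pair x y)"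
      by (rule amap_comp[OF J_pair_amap1[OF y] VWR.esmult_amap[OF r]])
    show "J_pair (r \<odot>\<^bsub>VR.E\<^esub> VR.pt v s) y = r \<odot>\<^bsub>VWR.E\<^esub> J_pair (VR.pt v s) y"
      if vs: "v \<in> carrier V" "s \<in> carrier R" for v s
    proof -
      have "J_row v (r \<otimes>\<^bsub>R\<^esub> s) y = r \<odot>\<^bsub>VWR.E\<^esub> J_row v s y"
      proof (rule WR.amap_tensor_eqI[where P = VWR.Z and z = y])
        show "amap WR.Z VWR.Z (\<lambda>y. r \<odot>\<^bsub>VWR.E\<^esub> J_row v s y)"
          by (rule amap_comp[OF J_row_amap[OF vs] VWR.esmult_amap[OF r]])
      qed (use vs r y in \<open>simp_all add: J_row_amap J_row_pt VWR.esmult_pt VR.R.m_assoc\<close>)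
      then show ?thesis using vs r y by (simp add: VR.esmult_pt J_pair_pt1)
    qed
  qed (use x in simp)
  show ?r
  proof (rule VR.amap_tensor_eqI[where P = VWR.Z and z = x])
    have ry: "r \<odot>\<^bsub>WR.E\<^esub> y \<in> carrier (tensor_group k W R)"
      using amap_closed[OF WR.esmult_amap[OF r]] y by simp
    show "amap VR.Z VWR.Z (\<lambda>x. J_pair x (r \<odot>\<^bsub>WR.E\<^esub> y))"
      by (rule J_pair_amap1[OF ry])
    show "amap VR.Z VWR.Z (\<lambda>x. r \<odot>\<^bsub>VWR.E\<^esub> J_pair x y)"
      by (rule amap_comp[OF J_pair_amap1[OF y] VWR.esmult_amap[OF r]])
    show "J_pair (VR.pt v s) (r \<odot>\<^bsub>WR.E\<^esub> y) = r \<odot>\<^bsub>VWR.E\<^esub> J_pair (VR.pt v s) y"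
      if vs: "v \<in> carrier V" "s \<in> carrier R" for v s
    proof -
      have "J_row v s (r \<odot>\<^bsub>WR.E\<^esub> y) = r \<odot>\<^bsub>VWR.E\<^esub> J_row v s y"
      proof (rule WR.amap_tensor_eqI[where P = VWR.Z and z = y])
        show "amap WR.Z VWR.Z (\<lambda>y. r \<odot>\<^bsub>VWR.E\<^esub> J_row v s y)"
          by (rule amap_comp[OF J_row_amap[OF vs] VWR.esmult_amap[OF r]])
        show "amap WR.Z VWR.Z (\<lambda>y. J_row v s (r \<odot>\<^bsub>WR.E\<^esub> y))"
          by (rule amap_comp[OF WR.esmult_amap[OF r] J_row_amap[OF vs]])
      qed (use vs r y in \<open>simp_all add: WR.esmult_pt J_row_pt VWR.esmult_pt VR.R.m_lcomm\<close>)
      then show ?thesis using vs ry y by (simp add: J_pair_pt1)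
    qed
  qed (use x in simp)
qed

lemma J_pair_balanced: "balanced R VR.E WR.E VWR.Z J_pair"
  using amap_add[OF J_pair_amap1] amap_add[OF J_pair_amap2] amap_closed[OF J_pair_amap1]
  by (intro balancedI) (simp_all add: J_pair_smult)

abbreviation "J \<equiv> ext_tensor_iso k V W R"

lemma J_eq: "J = tlift R VR.E WR.E VWR.Z J_pair"
  unfolding ext_tensor_iso_def Let_def
proof (rule the_equality)
  let ?J = "tlift R VR.E WR.E VWR.Z J_pair"
  note J = TR.tlift_props[OF VWR.tensor_abelian_group J_pair_balanced]
  have hom: "hom (tensor_group R VR.E WR.E) (tensor_group k VW.Z R) = {h. amap TR.Z VWR.Z h}"
    by (auto simp: hom_def amap_def tensor_module_def)
  show 1: "?J \<in> hom (tensor_group R VR.E WR.E) (tensor_group k VW.Z R)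
      \<inter> extensional (carrier (tensor_group R VR.E WR.E)) \<and>
      (\<forall>v\<in>carrier V. \<forall>r\<in>carrier R. \<forall>w\<in>carrier W. \<forall>s\<in>carrier R.
        ?J (TR.pt (VR.pt v r) (WR.pt w s)) = VWR.pt (VW.pt v w) (r \<otimes>\<^bsub>R\<^esub> s))"
    using J(1,3) by (simp add: hom J(2) J_pair_pt1 J_row_pt)
  show "h = ?J" if h: "h \<in> hom (tensor_group R VR.E WR.E) (tensor_group k VW.Z R)
      \<inter> extensional (carrier (tensor_group R VR.E WR.E)) \<and>
      (\<forall>v\<in>carrier V. \<forall>r\<in>carrier R. \<forall>w\<in>carrier W. \<forall>s\<in>carrier R.
        h (TR.pt (VR.pt v r) (WR.pt w s)) = VWR.pt (VW.pt v w) (r \<otimes>\<^bsub>R\<^esub> s))" for h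
  proof (rule extensionalityI)
    show "h z = ?J z" if "z \<in> carrier (tensor_group R VR.E WR.E)" for z
      by (rule double_eqI[where P = VWR.Z and z = z]) (use h 1 that in \<open>simp_all add: hom\<close>)
  qed (use h 1 in auto)
qed

lemma J_amap: "amap TR.Z VWR.Z J"
  unfolding J_eq by (rule TR.tlift_amap[OF VWR.tensor_abelian_group J_pair_balanced])

lemma J_closed: "z \<in> carrier (tensor_group R VR.E WR.E) \<Longrightarrow> J z \<in> carrier (tensor_group k VW.Z R)"
  using amap_closed[OF J_amap] by simp

lemma J_pt: "v \<in> carrier V \<Longrightarrow> r \<in> carrier R \<Longrightarrow> w \<in> carrier W \<Longrightarrow> s \<in> carrier R \<Longrightarrow>
    J (TR.pt (VR.pt v r) (WR.pt w s)) = VWR.pt (VW.pt v w) (r \<otimes>\<^bsub>R\<^esub> s)"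
  unfolding J_eq using TR.tlift_pt[OF VWR.tensor_abelian_group J_pair_balanced]
  by (simp add: J_pair_pt1 J_row_pt)

lemma J_smult:
  assumes r: "r \<in> carrier R" and z: "z \<in> carrier (tensor_group R VR.E WR.E)"
  shows "J (r \<odot>\<^bsub>TR.Z\<^esub> z) = r \<odot>\<^bsub>VWR.E\<^esub> J z"
proof (rule double_eqI[where P = VWR.Z and z = z])
  show "amap TR.Z VWR.Z (\<lambda>z. J (r \<odot>\<^bsub>TR.Z\<^esub> z))" by (rule amap_comp[OF TR.smult_amap[OF r] J_amap])
  show "amap TR.Z VWR.Z (\<lambda>z. r \<odot>\<^bsub>VWR.E\<^esub> J z)" by (rule amap_comp[OF J_amap VWR.esmult_amap[OF r]])
qed (use r z in \<open>simp_all add: TR.smult_pt VR.esmult_pt J_pt VWR.esmult_pt VR.R.m_assoc\<close>)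

text \<open>Building block for the inverse of \<open>J\<close>, which sends (v \<otimes> w)
  \<otimes> r to (v \<otimes> 1) \<otimes> (w \<otimes> r). The whole scalar may be placed on the
  right because the outer tensor product is taken over \<open>R\<close>.\<close>

definition K_row where "K_row r = tlift k V W TR.Z (\<lambda>v w. TR.pt (VR.pt v \<one>\<^bsub>R\<^esub>) (WR.pt w r))"

text \<open>A scalar of \<open>k\<close> crosses the outer tensor sign as its image in
  \<open>R\<close>.\<close>

lemma K_swap:
  assumes "a \<in> carrier k" "v \<in> carrier V" "w \<in> carrier W" "r \<in> carrier R"
  shows "TR.pt (VR.pt (a \<odot>\<^bsub>V\<^esub> v) \<one>\<^bsub>R\<^esub>) (WR.pt w r) = TR.pt (VR.pt v \<one>\<^bsub>R\<^esub>) (WR.pt w (a \<odot>\<^bsub>R\<^esub> r))"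
proof -
  have "VR.pt (a \<odot>\<^bsub>V\<^esub> v) \<one>\<^bsub>R\<^esub> = (a \<odot>\<^bsub>R\<^esub> \<one>\<^bsub>R\<^esub>) \<odot>\<^bsub>VR.E\<^esub> VR.pt v \<one>\<^bsub>R\<^esub>"
    using assms by (simp add: VR.esmult_pt VR.pt_smult)
  then show ?thesis
    using assms TR.pt_smult[of "a \<odot>\<^bsub>R\<^esub> \<one>\<^bsub>R\<^esub>" "VR.pt v \<one>\<^bsub>R\<^esub>" "WR.pt w r"]
    by (simp add: WR.esmult_pt VR.R.smult_assoc2)
qed

lemma K_row_balanced:
  "r \<in> carrier R \<Longrightarrow> balanced k V W TR.Z (\<lambda>v w. TR.pt (VR.pt v \<one>\<^bsub>R\<^esub>) (WR.pt w r))"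
  using TR.pt_add1 TR.pt_add2
  by (intro balancedI) (simp_all add: VR.pt_add1 WR.pt_add1 K_swap WR.pt_smult)

lemma K_row_amap: "r \<in> carrier R \<Longrightarrow> amap VW.Z TR.Z (K_row r)"
  and K_row_pt: "r \<in> carrier R \<Longrightarrow> v \<in> carrier V \<Longrightarrow> w \<in> carrier W \<Longrightarrow>
    K_row r (VW.pt v w) = TR.pt (VR.pt v \<one>\<^bsub>R\<^esub>) (WR.pt w r)"
  unfolding K_row_def
  using VW.tlift_amap[OF TR.tensor_abelian_group K_row_balanced]
    VW.tlift_pt[OF TR.tensor_abelian_group K_row_balanced] by simp_all

lemma K_balanced: "balanced k VW.Z R TR.Z (\<lambda>u r. K_row r u)"
proof (rule balancedI)
  show "K_row r u \<in> carrier TR.Z" if "u \<in> carrier VW.Z" "r \<in> carrier R" for u r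
    using amap_closed[OF K_row_amap] that by blast
  show "K_row r (u \<oplus>\<^bsub>VW.Z\<^esub> u') = K_row r u \<oplus>\<^bsub>TR.Z\<^esub> K_row r u'"
    if "u \<in> carrier VW.Z" "u' \<in> carrier VW.Z" "r \<in> carrier R" for u u' r
    using amap_add[OF K_row_amap] that by blast
  show "K_row (r \<oplus>\<^bsub>R\<^esub> r') u = K_row r u \<oplus>\<^bsub>TR.Z\<^esub> K_row r' u"
    if u: "u \<in> carrier VW.Z" and r: "r \<in> carrier R" "r' \<in> carrier R" for u r r'
  proof (rule VW.amap_tensor_eqI[where P = TR.Z and z = u])
    show "amap VW.Z TR.Z (\<lambda>u. K_row r u \<oplus>\<^bsub>TR.Z\<^esub> K_row r' u)"
      using K_row_amap[OF r(1)] K_row_amap[OF r(2)] by (auto simp: amap_def Pi_iff TR.Z.a_ac)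
    show "K_row (r \<oplus>\<^bsub>R\<^esub> r') (VW.pt v w) = K_row r (VW.pt v w) \<oplus>\<^bsub>TR.Z\<^esub> K_row r' (VW.pt v w)"
      if "v \<in> carrier V" "w \<in> carrier W" for v w
      using TR.pt_add2[of "VR.pt v \<one>\<^bsub>R\<^esub>" "WR.pt w r" "WR.pt w r'"] that r
      by (simp add: K_row_pt WR.pt_add2)
  qed (use u r in \<open>simp_all add: K_row_amap\<close>)
  show "K_row r (a \<odot>\<^bsub>VW.Z\<^esub> u) = K_row (a \<odot>\<^bsub>R\<^esub> r) u"
    if a: "a \<in> carrier k" and u: "u \<in> carrier VW.Z" and r: "r \<in> carrier R" for a u r
  proof (rule VW.amap_tensor_eqI[where P = TR.Z and z = u])
    show "amap VW.Z TR.Z (\<lambda>u. K_row r (a \<odot>\<^bsub>VW.Z\<^esub> u))"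
      by (rule amap_comp[OF VW.smult_amap[OF a] K_row_amap[OF r]])
  qed (use u r a in \<open>simp_all add: K_row_amap VW.smult_pt K_row_pt K_swap\<close>)
qed

lemma J_bij: "bij_betw J (carrier (tensor_group R VR.E WR.E)) (carrier (tensor_group k VW.Z R))"
proof -
  let ?K = "tlift k VW.Z R TR.Z (\<lambda>u r. K_row r u)"
  note K = VWR.tlift_amap[OF TR.tensor_abelian_group K_balanced]
  note Kp = VWR.tlift_pt[OF TR.tensor_abelian_group K_balanced]
  show ?thesis
  proof (rule bij_betw_byWitness[where f' = ?K])
    have "?K (J z) = z" if z: "z \<in> carrier (tensor_group R VR.E WR.E)" for z
    proof (rule double_eqI[where P = TR.Z and z = z])
      show "amap TR.Z TR.Z (\<lambda>z. ?K (J z))" by (rule amap_comp[OF J_amap K])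
      show "?K (J (TR.pt (VR.pt v r) (WR.pt w s))) = TR.pt (VR.pt v r) (WR.pt w s)"
        if "v \<in> carrier V" "r \<in> carrier R" "w \<in> carrier W" "s \<in> carrier R" for v r w s
        using that TR.pt_smult[of r "VR.pt v \<one>\<^bsub>R\<^esub>" "WR.pt w s"]
        by (simp add: J_pt Kp K_row_pt VR.esmult_pt WR.esmult_pt)
    qed (use z in \<open>simp_all add: amap_id\<close>)
    then show "\<forall>z\<in>carrier (tensor_group R VR.E WR.E). ?K (J z) = z" by blast
    have "J (?K z) = z" if z: "z \<in> carrier (tensor_group k VW.Z R)" for z
    proof (rule VWR.amap_tensor_eqI[where P = VWR.Z and z = z])
      show "amap VWR.Z VWR.Z (\<lambda>z. J (?K z))" by (rule amap_comp[OF K J_amap])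
      show "J (?K (VWR.pt u r)) = VWR.pt u r" if u: "u \<in> carrier VW.Z" and r: "r \<in> carrier R"
        for u r
      proof -
        have "J (K_row r u) = VWR.pt u r"
        proof (rule VW.amap_tensor_eqI[where P = VWR.Z and z = u])
          show "amap VW.Z VWR.Z (\<lambda>u. J (K_row r u))" by (rule amap_comp[OF K_row_amap[OF r] J_amap])
          show "amap VW.Z VWR.Z (\<lambda>u. VWR.pt u r)" by (rule balanced_amap1[OF VWR.pt_balanced r])
        qed (use u r in \<open>simp_all add: K_row_pt J_pt\<close>)
        then show ?thesis using u r by (simp add: Kp)
      qed
    qed (use z in \<open>simp_all add: amap_id\<close>)
    then show "\<forall>z\<in>carrier (tensor_group k VW.Z R). J (?K z) = z" by blast
    show "J ` carrier (tensor_group R VR.E WR.E) \<subseteq> carrier (tensor_group k VW.Z R)"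
      using J_closed by blast
    show "?K ` carrier (tensor_group k VW.Z R) \<subseteq> carrier (tensor_group R VR.E WR.E)"
      using amap_closed[OF K] by auto
  qed
qed

end

text \<open>Only pure tensors x \<otimes> y occur in the statement; a comparison map between the
  tensor products over the different rings \<open>R\<close> and \<open>S\<close> is thereby
  avoided.\<close>

lemma J_base_change:
  fixes k :: "'u ring" and V :: "('u, 'v) module" and W :: "('u, 'w) module"
    and R S :: "('u, 'u) module"
  assumes V: "module k V" and W: "module k W" and R: "algebra k R" and S: "algebra k S"
    and f: "f \<in> alg_hom k R S"
    and x: "x \<in> carrier (tensor_group k V R)" and y: "y \<in> carrier (tensor_group k W R)"
  shows "tensor_map k (tensor_module k V W) R (tensor_module k V W) S (\<lambda>v. v) f
      (ext_tensor_iso k V W R (pure_tensor R (ext_scalars k V R) (ext_scalars k W R) x y))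
    = ext_tensor_iso k V W S (pure_tensor S (ext_scalars k V S) (ext_scalars k W S)
        (tensor_map k V R V S (\<lambda>v. v) f x) (tensor_map k W R W S (\<lambda>v. v) f y))"
proof -
  interpret R: tens_iso k V W R using V W R by (rule tens_iso.intro)
  interpret S: tens_iso k V W S using V W S by (rule tens_iso.intro)
  interpret BV: base_chg k V R S f using V R S f by (rule base_chg.intro)
  interpret BW: base_chg k W R S f using W R S f by (rule base_chg.intro)
  interpret BVW: base_chg k R.VW.Z R S f using R.VWR.V R S f by (rule base_chg.intro)
  note R2 = amap_comp[OF R.J_amap BVW.Vf_amap]
  have pt2: "amap R.WR.Z R.TR.Z (R.TR.pt x)" if "x \<in> carrier (tensor_group k V R)" for x
    using balanced_amap2[OF R.TR.pt_balanced, of x] that by (simp add: R.WR.amap_E)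
  have pt1: "amap R.VR.Z R.TR.Z (\<lambda>x. R.TR.pt x y)" if "y \<in> carrier (tensor_group k W R)" for y
    using balanced_amap1[OF R.TR.pt_balanced, of y] that by (simp add: R.VR.amap_E)
  have spt2: "amap S.WR.Z S.TR.Z (S.TR.pt x)" if "x \<in> carrier (tensor_group k V S)" for x
    using balanced_amap2[OF S.TR.pt_balanced, of x] that by (simp add: S.WR.amap_E)
  have spt1: "amap S.VR.Z S.TR.Z (\<lambda>x. S.TR.pt x y)" if "y \<in> carrier (tensor_group k W S)" for y
    using balanced_amap1[OF S.TR.pt_balanced, of y] that by (simp add: S.VR.amap_E)
  show ?thesis
  proof (rule R.VR.amap_tensor_eqI[where P = S.VWR.Z and z = x])
    show "amap R.VR.Z S.VWR.Z (\<lambda>x. BVW.Vf (R.J (R.TR.pt x y)))"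
      by (rule amap_comp[OF pt1[OF y] R2])
    show "amap R.VR.Z S.VWR.Z (\<lambda>x. S.J (S.TR.pt (BV.Vf x) (BW.Vf y)))"
      by (rule amap_comp[OF BV.Vf_amap amap_comp[OF spt1[OF BW.Vf_closed[OF y]] S.J_amap]])
    show "BVW.Vf (R.J (R.TR.pt (R.VR.pt v r) y)) = S.J (S.TR.pt (BV.Vf (R.VR.pt v r)) (BW.Vf y))"
      if vr: "v \<in> carrier V" "r \<in> carrier R" for v r
    proof (rule R.WR.amap_tensor_eqI[where P = S.VWR.Z and z = y])
      show "amap R.WR.Z S.VWR.Z (\<lambda>y. BVW.Vf (R.J (R.TR.pt (R.VR.pt v r) y)))"
        using vr by (intro amap_comp[OF pt2 R2]) simp
      show "amap R.WR.Z S.VWR.Z (\<lambda>y. S.J (S.TR.pt (BV.Vf (R.VR.pt v r)) (BW.Vf y)))"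
        using vr by (intro amap_comp[OF BW.Vf_amap amap_comp[OF spt2 S.J_amap]] BV.Vf_closed) simp
    qed (use y vr in \<open>simp_all add: R.J_pt BV.Vf_pt BW.Vf_pt BVW.Vf_pt S.J_pt alg_homD[OF f]\<close>)
  qed (use x in simp)
qed

section \<open>Functoriality of tensor products and of extension of scalars\<close>

lemma tensor_map_module_hom:
  assumes MN: "module K M" "module K N" and PQ: "module K P" "module K Q"
    and \<phi>: "\<phi> \<in> module_hom K M P" and \<psi>: "\<psi> \<in> module_hom K N Q"
  shows "tensor_map K M N P Q \<phi> \<psi> \<in> module_hom K (tensor_module K M N) (tensor_module K P Q)"
proof (rule module_homI[OF tensor_map_amap[OF assms]])
  interpret S: tensor_pair K M N using MN by (rule tensor_pair.intro)
  interpret T: tensor_pair K P Q using PQ by (rule tensor_pair.intro)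
  note t = tensor_map_amap[OF assms] and tp = tensor_map_pt[OF assms]
  fix a z assume a: "a \<in> carrier K" and z: "z \<in> carrier S.Z"
  show "tensor_map K M N P Q \<phi> \<psi> (a \<odot>\<^bsub>S.Z\<^esub> z) = a \<odot>\<^bsub>T.Z\<^esub> tensor_map K M N P Q \<phi> \<psi> z"
  proof (rule S.amap_tensor_eqI[where P = T.Z and z = z])
    show "amap S.Z T.Z (\<lambda>z. tensor_map K M N P Q \<phi> \<psi> (a \<odot>\<^bsub>S.Z\<^esub> z))"
      by (rule amap_comp[OF S.smult_amap[OF a] t])
    show "amap S.Z T.Z (\<lambda>z. a \<odot>\<^bsub>T.Z\<^esub> tensor_map K M N P Q \<phi> \<psi> z)"
      by (rule amap_comp[OF t T.smult_amap[OF a]])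
  qed (use a z \<phi> \<psi> in \<open>simp_all add: S.smult_pt tp T.smult_pt module_hom_in module_hom_smult\<close>)
qed

lemma module_hom_comp:
  "f \<in> module_hom K M N \<Longrightarrow> g \<in> module_hom K N P \<Longrightarrow> (\<lambda>x. g (f x)) \<in> module_hom K M P"
  by (auto simp: module_hom_def Pi_iff)

lemma module_hom_inv_into:
  assumes M: "module K M" and f: "f \<in> module_hom K M N"
    and bij: "bij_betw f (carrier M) (carrier N)"
  shows "inv_into (carrier M) f \<in> module_hom K N M"
proof -
  interpret module K M by fact
  have *: "inv_into (carrier M) f (f x) = x" if "x \<in> carrier M" for x
    using bij that by (simp add: bij_betw_def)
  have ex: "\<exists>x\<in>carrier M. y = f x" if "y \<in> carrier N" for y
    using bij that by (auto simp: bij_betw_def)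
  show ?thesis
  proof (intro module_homI amapI)
    fix x y assume "x \<in> carrier N" "y \<in> carrier N"
    then obtain a b where "a \<in> carrier M" "b \<in> carrier M" "x = f a" "y = f b" using ex by meson
    then show "inv_into (carrier M) f (x \<oplus>\<^bsub>N\<^esub> y)
        = inv_into (carrier M) f x \<oplus>\<^bsub>M\<^esub> inv_into (carrier M) f y"
      using *[of "a \<oplus>\<^bsub>M\<^esub> b"] by (simp add: * module_hom_add[OF f])
  next
    fix a x assume "a \<in> carrier K" "x \<in> carrier N"
    moreover then obtain b where "b \<in> carrier M" "x = f b" using ex by meson
    ultimately show "inv_into (carrier M) f (a \<odot>\<^bsub>N\<^esub> x) = a \<odot>\<^bsub>M\<^esub> inv_into (carrier M) f x"
      using *[of "a \<odot>\<^bsub>M\<^esub> b"] by (simp add: * module_hom_smult[OF f])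
  next
    show "inv_into (carrier M) f x \<in> carrier M" if "x \<in> carrier N" for x
      using ex[OF that] * by auto
  qed
qed

text \<open>Together with \<open>fin_dim_iff\<close> this reduces the inclusion of an image in a
  submodule to finitely many generators.\<close>

lemma preimage_submodule:
  assumes M: "module K M" and f: "f \<in> module_hom K M N" and N: "module K N" and U: "submodule K U N"
  shows "submodule K {x \<in> carrier M. f x \<in> U} M"
proof -
  interpret M: module K M by fact
  interpret U: submodule K U N by fact
  show ?thesis
    using amap_zero[OF module_trans(2)[OF M] module_trans(2)[OF N] module_hom_amap[OF f]]
    by (intro submodule.intro[OF M])
      (auto simp: module_hom_add[OF f] module_hom_smult[OF f])
qed

locale ext_map =
  fixes k :: "('u, 'x) ring_scheme" and V :: "('u, 'v, 'y) module_scheme"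
    and W :: "('u, 'w, 'z) module_scheme" and R :: "('u, 'u) module" and \<phi> :: "'v \<Rightarrow> 'w"
  assumes V: "module k V" and W: "module k W" and R: "algebra k R" and \<phi>: "\<phi> \<in> module_hom k V W"
begin

sublocale EV: ext_scal k V R using V R by (rule ext_scal.intro)
sublocale EW: ext_scal k W R using W R by (rule ext_scal.intro)

abbreviation "V\<phi> \<equiv> tensor_map k V R W R \<phi> (\<lambda>r. r)"

lemma V\<phi>_amap: "amap EV.Z EW.Z V\<phi>"
  and V\<phi>_pt: "v \<in> carrier V \<Longrightarrow> r \<in> carrier R \<Longrightarrow> V\<phi> (EV.pt v r) = EW.pt (\<phi> v) r"
  using tensor_map_amap[OF V EV.N W EW.N \<phi> id_module_hom]
    tensor_map_pt[OF V EV.N W EW.N \<phi> id_module_hom] by simp_all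

lemma V\<phi>_closed: "z \<in> carrier (tensor_group k V R) \<Longrightarrow> V\<phi> z \<in> carrier (tensor_group k W R)"
  using amap_closed[OF V\<phi>_amap] by simp

lemma V\<phi>_module_hom: "V\<phi> \<in> module_hom R EV.E EW.E"
proof (rule module_homI)
  show "amap EV.E EW.E V\<phi>" using V\<phi>_amap by (simp add: amap_def)
  show "V\<phi> (r \<odot>\<^bsub>EV.E\<^esub> z) = r \<odot>\<^bsub>EW.E\<^esub> V\<phi> z" if r: "r \<in> carrier R" and z: "z \<in> carrier EV.E" for r z
  proof (rule EV.amap_tensor_eqI[where P = EW.Z and z = z])
    show "amap EV.Z EW.Z (\<lambda>z. V\<phi> (r \<odot>\<^bsub>EV.E\<^esub> z))"
      by (rule amap_comp[OF EV.esmult_amap[OF r] V\<phi>_amap])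
    show "amap EV.Z EW.Z (\<lambda>z. r \<odot>\<^bsub>EW.E\<^esub> V\<phi> z)" by (rule amap_comp[OF V\<phi>_amap EW.esmult_amap[OF r]])
  qed (use r z \<phi> in \<open>simp_all add: EV.esmult_pt V\<phi>_pt EW.esmult_pt module_hom_in\<close>)
qed

end

text \<open>The composite enters as a third map \<chi> that need agree with it only on the carrier,
  since maps are functions on a whole type. With \<chi> the identity this yields inverses.\<close>

lemma ext_map_comp:
  fixes k :: "('u, 'x) ring_scheme" and R :: "('u, 'u) module"
  assumes V: "module k V" and W: "module k W" and P: "module k P" and R: "algebra k R"
    and \<phi>: "\<phi> \<in> module_hom k V W" and \<psi>: "\<psi> \<in> module_hom k W P" and \<chi>: "\<chi> \<in> module_hom k V P"
    and eq: "\<And>v. v \<in> carrier V \<Longrightarrow> \<chi> v = \<psi> (\<phi> v)" and z: "z \<in> carrier (tensor_group k V R)"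
  shows "tensor_map k W R P R \<psi> (\<lambda>r. r) (tensor_map k V R W R \<phi> (\<lambda>r. r) z)
    = tensor_map k V R P R \<chi> (\<lambda>r. r) z"
proof -
  interpret A: ext_map k V W R \<phi> using V W R \<phi> by (rule ext_map.intro)
  interpret B: ext_map k W P R \<psi> using W P R \<psi> by (rule ext_map.intro)
  interpret C: ext_map k V P R \<chi> using V P R \<chi> by (rule ext_map.intro)
  show ?thesis
    by (rule A.EV.amap_tensor_eqI[where P = B.EW.Z and z = z])
      (use z \<phi> eq in \<open>simp_all add: amap_comp[OF A.V\<phi>_amap B.V\<phi>_amap] C.V\<phi>_amap A.V\<phi>_pt B.V\<phi>_pt
          C.V\<phi>_pt module_hom_in\<close>)
qed

lemma ext_map_id:
  fixes k :: "('u, 'x) ring_scheme" and R :: "('u, 'u) module"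
  assumes V: "module k V" and R: "algebra k R" and z: "z \<in> carrier (tensor_group k V R)"
    and \<phi>: "\<phi> \<in> module_hom k V V" "\<And>v. v \<in> carrier V \<Longrightarrow> \<phi> v = v"
  shows "tensor_map k V R V R \<phi> (\<lambda>r. r) z = z"
proof -
  interpret A: ext_map k V V R \<phi> using V R \<phi> by (intro ext_map.intro)
  show ?thesis
    by (rule A.EV.amap_tensor_eqI[where P = A.EV.Z and z = z])
      (use z in \<open>simp_all add: A.V\<phi>_amap amap_id A.V\<phi>_pt \<phi>\<close>)
qed

lemma ext_map_bij:
  fixes k :: "('u, 'x) ring_scheme" and R :: "('u, 'u) module"
  assumes V: "module k V" and W: "module k W" and R: "algebra k R"
    and \<phi>: "\<phi> \<in> module_hom k V W" and bij: "bij_betw \<phi> (carrier V) (carrier W)"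
  shows "bij_betw (tensor_map k V R W R \<phi> (\<lambda>r. r)) (carrier (tensor_group k V R))
      (carrier (tensor_group k W R))"
proof -
  let ?\<psi> = "inv_into (carrier V) \<phi>"
  have \<psi>: "?\<psi> \<in> module_hom k W V" by (rule module_hom_inv_into[OF V \<phi> bij])
  interpret A: ext_map k V W R \<phi> using V W R \<phi> by (rule ext_map.intro)
  interpret B: ext_map k W V R ?\<psi> using W V R \<psi> by (rule ext_map.intro)
  have 1: "?\<psi> (\<phi> v) = v" if "v \<in> carrier V" for v
    using bij that by (simp add: bij_betw_def)
  have 2: "\<phi> (?\<psi> w) = w" if "w \<in> carrier W" for w
    using bij that by (simp add: bij_betw_inv_into_right)
  show ?thesis
  proof (rule bij_betw_byWitness[where f' = B.V\<phi>])
    show "\<forall>z\<in>carrier (tensor_group k V R). B.V\<phi> (A.V\<phi> z) = z"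
      using ext_map_comp[OF V W V R \<phi> \<psi> id_module_hom] ext_map_id[OF V R _ id_module_hom] 1 by simp
    show "\<forall>z\<in>carrier (tensor_group k W R). A.V\<phi> (B.V\<phi> z) = z"
      using ext_map_comp[OF W V W R \<psi> \<phi> id_module_hom] ext_map_id[OF W R _ id_module_hom] 2 by simp
  qed (use A.V\<phi>_closed B.V\<phi>_closed in auto)
qed

lemma ext_map_base_change:
  fixes k :: "'u ring" and V :: "('u, 'v) module" and W :: "('u, 'w) module"
    and R S :: "('u, 'u) module"
  assumes V: "module k V" and W: "module k W" and R: "algebra k R" and S: "algebra k S"
    and \<phi>: "\<phi> \<in> module_hom k V W" and f: "f \<in> alg_hom k R S"
      and z: "z \<in> carrier (tensor_group k V R)"
  shows "tensor_map k W R W S (\<lambda>v. v) f (tensor_map k V R W R \<phi> (\<lambda>r. r) z)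
    = tensor_map k V S W S \<phi> (\<lambda>r. r) (tensor_map k V R V S (\<lambda>v. v) f z)"
proof -
  interpret A: ext_map k V W R \<phi> using V W R \<phi> by (rule ext_map.intro)
  interpret B: ext_map k V W S \<phi> using V W S \<phi> by (rule ext_map.intro)
  interpret BV: base_chg k V R S f using V R S f by (rule base_chg.intro)
  interpret BW: base_chg k W R S f using W R S f by (rule base_chg.intro)
  show ?thesis
    by (rule A.EV.amap_tensor_eqI[where P = B.EW.Z and z = z])
      (use z \<phi> in \<open>simp_all add: amap_comp[OF A.V\<phi>_amap BW.Vf_amap]
          amap_comp[OF BV.Vf_amap B.V\<phi>_amap]
        A.V\<phi>_pt B.V\<phi>_pt BV.Vf_pt BW.Vf_pt module_hom_in alg_homD[OF f]\<close>)
qed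

section \<open>Representations of a group functor\<close>

locale gfun =
  fixes k :: "'u::infinite ring" and G :: "('u, 'g) gfunctor"
  assumes k: "field k" and G: "group_functor k G"
begin

lemma G_group: "algebra k R \<Longrightarrow> group (fob G R)"
  and G_mor: "algebra k R \<Longrightarrow> algebra k S \<Longrightarrow> f \<in> alg_hom k R S \<Longrightarrow>
      fmor G R S f \<in> hom (fob G R) (fob G S)"
  and G_id: "algebra k R \<Longrightarrow> x \<in> carrier (fob G R) \<Longrightarrow> fmor G R R (\<lambda>r\<in>carrier R. r) x = x"
  and G_comp: "algebra k R \<Longrightarrow> algebra k S \<Longrightarrow> algebra k T \<Longrightarrow> f \<in> alg_hom k R S \<Longrightarrow> g \<in> alg_hom k S T \<Longrightarrow>
    x \<in> carrier (fob G R) \<Longrightarrow> fmor G R T (compose (carrier R) g f) x = fmor G S T g (fmor G R S f x)"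
  using G by (simp_all add: group_functor_def)

lemma G_closed: "algebra k R \<Longrightarrow> algebra k S \<Longrightarrow> f \<in> alg_hom k R S \<Longrightarrow> g \<in> carrier (fob G R) \<Longrightarrow>
    fmor G R S f g \<in> carrier (fob G S)"
  by (rule hom_in_carrier[OF G_mor])

lemma k_cring: "cring k"
  using k by (simp add: field_def domain_def)

lemma rep_vectorspace: "representation k G X \<Longrightarrow> vectorspace k (space X)"
  by (simp add: representation_def)

lemma rep_module: "representation k G X \<Longrightarrow> module k (space X)"
  using rep_vectorspace vectorspace_def by blast

context
  fixes X :: "('u, 'v, 'g) rep" and R :: "('u, 'u) module"
  assumes X: "representation k G X" and R: "algebra k R"
begin

interpretation E: ext_scal k "space X" R
  using rep_module[OF X] R by (rule ext_scal.intro)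

lemma act_aut: "g \<in> carrier (fob G R) \<Longrightarrow> act X R g \<in> carrier (linear_aut_group R E.E)"
  using X R by (auto simp: representation_def gfunctor_hom_def GL_functor_def hom_def Pi_iff)

lemma act_hom: "g \<in> carrier (fob G R) \<Longrightarrow> act X R g \<in> module_hom R E.E E.E"
  using act_aut by (simp add: linear_aut_group_def)

lemma act_ext: "g \<in> carrier (fob G R) \<Longrightarrow> act X R g \<in> extensional (carrier E.E)"
  using act_aut by (simp add: linear_aut_group_def)

lemma act_amap: "g \<in> carrier (fob G R) \<Longrightarrow> amap E.Z E.Z (act X R g)"
  using module_hom_amap[OF act_hom] by (simp add: E.amap_E)

lemma act_closed: "g \<in> carrier (fob G R) \<Longrightarrow> z \<in> carrier (tensor_group k (space X) R) \<Longrightarrow>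
    act X R g z \<in> carrier (tensor_group k (space X) R)"
  using amap_closed[OF act_amap] by simp

lemma act_mult: "g \<in> carrier (fob G R) \<Longrightarrow> h \<in> carrier (fob G R) \<Longrightarrow>
    act X R (g \<otimes>\<^bsub>fob G R\<^esub> h) = compose (carrier E.E) (act X R g) (act X R h)"
  using X R by (simp add: representation_def gfunctor_hom_def GL_functor_def hom_def
      linear_aut_group_def)

text \<open>The action of the unit is idempotent and injective, hence the identity. This spares a
  proof that \<open>linear_aut_group\<close> is a group.\<close>

lemma act_one: 
  assumes z: "z \<in> carrier (tensor_group k (space X) R)"
  shows "act X R \<one>\<^bsub>fob G R\<^esub> z = z"
proof -
  interpret group "fob G R" by (rule G_group[OF R])
  let ?e = "act X R \<one>\<^bsub>fob G R\<^esub>"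
  have "?e = compose (carrier E.E) ?e ?e" using act_mult[OF one_closed one_closed] by simp
  from fun_cong[OF this, of z] have "?e (?e z) = ?e z" using z by (simp add: compose_eq)
  moreover have "inj_on (act X R \<one>\<^bsub>fob G R\<^esub>) (carrier E.E)"
    using act_aut[of "\<one>\<^bsub>fob G R\<^esub>"] by (simp add: linear_aut_group_def bij_betw_def)
  ultimately show ?thesis using z act_closed[OF one_closed z] by (auto dest: inj_onD)
qed

lemma act_nat:
  assumes S: "algebra k S" and f: "f \<in> alg_hom k R S" and g: "g \<in> carrier (fob G R)"
    and z: "z \<in> carrier (tensor_group k (space X) R)"
  shows "act X S (fmor G R S f g) (tensor_map k (space X) R (space X) S (\<lambda>v. v) f z)
    = tensor_map k (space X) R (space X) S (\<lambda>v. v) f (act X R g z)"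
proof -
  interpret B: base_chg k "space X" R S f using rep_module[OF X] R S f by (rule base_chg.intro)
  have "act X S (fmor G R S f g) = base_change k (space X) R S f (act X R g)"
    using X R S f g by (simp add: representation_def gfunctor_hom_def GL_functor_def)
  then show ?thesis using B.base_change_Vf[OF act_hom[OF g]] z by simp
qed

end

text \<open>Two requirements become lighter: bijectivity of an action follows from the inverse group
  element, and naturality is asked only on tensors with right factor 1, by
  \<open>base_change_eq\<close>.\<close>

lemma representationI:
  fixes X :: "('u, 'v, 'g) rep"
  assumes V: "vectorspace k (space X)"
    and hom: "\<And>R g. algebra k R \<Longrightarrow> g \<in> carrier (fob G R) \<Longrightarrow>
      act X R g \<in> module_hom R (ext_scalars k (space X) R) (ext_scalars k (space X) R)"
    and ext: "\<And>R g. algebra k R \<Longrightarrow> g \<in> carrier (fob G R) \<Longrightarrow>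
      act X R g \<in> extensional (carrier (tensor_group k (space X) R))"
    and mult: "\<And>R g h z. algebra k R \<Longrightarrow> g \<in> carrier (fob G R) \<Longrightarrow> h \<in> carrier (fob G R) \<Longrightarrow>
      z \<in> carrier (tensor_group k (space X) R) \<Longrightarrow>
      act X R (g \<otimes>\<^bsub>fob G R\<^esub> h) z = act X R g (act X R h z)"
    and one: "\<And>R z. algebra k R \<Longrightarrow> z \<in> carrier (tensor_group k (space X) R) \<Longrightarrow>
      act X R \<one>\<^bsub>fob G R\<^esub> z = z"
    and nat: "\<And>R S f g v. algebra k R \<Longrightarrow> algebra k S \<Longrightarrow> f \<in> alg_hom k R S \<Longrightarrow> g \<in> carrier (fob G R) \<Longrightarrow>
      v \<in> carrier (space X) \<Longrightarrow>
      act X S (fmor G R S f g) (pure_tensor k (space X) S v \<one>\<^bsub>S\<^esub>)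
      = tensor_map k (space X) R (space X) S (\<lambda>v. v) f
          (act X R g (pure_tensor k (space X) R v \<one>\<^bsub>R\<^esub>))"
  shows "representation k G X"
proof -
  interpret vectorspace k "space X" by fact
  have cl: "act X R g z \<in> carrier (tensor_group k (space X) R)"
    if "algebra k R" "g \<in> carrier (fob G R)" "z \<in> carrier (tensor_group k (space X) R)" for R g z
    using module_hom_in[OF hom[OF that(1,2)], of z] that by simp
  have aut: "act X R g \<in> carrier (linear_aut_group R (ext_scalars k (space X) R))"
    if R: "algebra k R" and g: "g \<in> carrier (fob G R)" for R g
  proof -
    interpret group "fob G R" by (rule G_group[OF R])
    have "act X R h (act X R h' z) = z"
      if "h \<in> carrier (fob G R)" "h' \<in> carrier (fob G R)" "h \<otimes>\<^bsub>fob G R\<^esub> h' = \<one>\<^bsub>fob G R\<^esub>"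
        "z \<in> carrier (tensor_group k (space X) R)" for h h' z
      using mult[OF R that(1,2,4)] one[OF R that(4)] that(3) by simp
    note this[OF g inv_closed[OF g] r_inv[OF g]] this[OF inv_closed[OF g] g l_inv[OF g]]
    then have "bij_betw (act X R g) (carrier (tensor_group k (space X) R))
        (carrier (tensor_group k (space X) R))"
      using cl[OF R g] cl[OF R inv_closed[OF g]]
      by (intro bij_betw_byWitness[where f' = "act X R (inv\<^bsub>fob G R\<^esub> g)"]) auto
    then show ?thesis using hom[OF R g] ext[OF R g] by (simp add: linear_aut_group_def)
  qed
  have "gfunctor_hom k G (GL_functor k (space X)) (act X)"
    unfolding gfunctor_hom_def GL_functor_def gfunctor.simps
  proof (intro conjI allI impI ballI)
    show "act X R \<in> hom (fob G R) (linear_aut_group R (ext_scalars k (space X) R))"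
      if R: "algebra k R" for R
    proof (rule homI)
      show "act X R (g \<otimes>\<^bsub>fob G R\<^esub> h)
          = act X R g \<otimes>\<^bsub>linear_aut_group R (ext_scalars k (space X) R)\<^esub> act X R h"
        if g: "g \<in> carrier (fob G R)" and h: "h \<in> carrier (fob G R)" for g h
      proof -
        interpret group "fob G R" by (rule G_group[OF R])
        show ?thesis
          by (rule extensionalityI[OF ext[OF R m_closed[OF g h]]])
            (simp_all add: linear_aut_group_def mult[OF R g h] compose_def)
      qed
    qed (rule aut[OF R])
    show "act X S (fmor G R S f g) = base_change k (space X) R S f (act X R g)"
      if R: "algebra k R" and S: "algebra k S" and f: "f \<in> alg_hom k R S"
        and g: "g \<in> carrier (fob G R)" for R S f g
    proof -
      interpret B: base_chg k "space X" R S f using module_axioms R S f by (rule base_chg.intro)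
      have fg: "fmor G R S f g \<in> carrier (fob G S)" by (rule G_closed[OF R S f g])
      show ?thesis
        by (rule B.base_change_eq[OF hom[OF S fg] _ nat[OF R S f g] hom[OF R g], symmetric])
          (use ext[OF S fg] in simp)
    qed
  qed
  then show ?thesis using V by (simp add: representation_def)
qed

section \<open>The unit representation\<close>

lemma base_space_vectorspace: "vectorspace k (base_space k)"
proof -
  interpret field k by (rule k)
  have "module k (base_space k)"
  proof (rule moduleI)
    show "abelian_group (base_space k)"
    proof (rule abelian_groupI, goal_cases)
      case (6 x)
      then show ?case using l_neg[of x] by auto
    qed (simp_all add: a_ac)
  qed (simp_all add: k_cring m_assoc l_distr r_distr)
  then show ?thesis by (simp add: vectorspace_def k)
qed

lemma unit_rep_Rep: "unit_rep k \<in> Rep k G"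
proof -
  interpret vectorspace k "base_space k" by (rule base_space_vectorspace)
  have "representation k G (unit_rep k)"
  proof (rule representationI)
    fix R :: "('u, 'u) module" and g assume R: "algebra k R"
    interpret E: ext_scal k "base_space k" R using module_axioms R by (rule ext_scal.intro)
    show "act (unit_rep k) R g \<in> module_hom R (ext_scalars k (space (unit_rep k)) R)
        (ext_scalars k (space (unit_rep k)) R)"
      using E.E.smult_closed by (simp add: unit_rep_def module_hom_def)
  next
    fix R S :: "('u, 'u) module" and f g v
    assume R: "algebra k R" and S: "algebra k S" and f: "f \<in> alg_hom k R S"
      and v: "v \<in> carrier (space (unit_rep k))"
    interpret B: base_chg k "base_space k" R S f using module_axioms R S f by (rule base_chg.intro)
    show "act (unit_rep k) S (fmor G R S f g) (pure_tensor k (space (unit_rep k)) S v \<one>\<^bsub>S\<^esub>)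
      = tensor_map k (space (unit_rep k)) R (space (unit_rep k)) S (\<lambda>v. v) f
          (act (unit_rep k) R g (pure_tensor k (space (unit_rep k)) R v \<one>\<^bsub>R\<^esub>))"
      using v by (simp add: unit_rep_def B.Vf_pt alg_homD[OF f])
  qed (simp_all add: unit_rep_def base_space_vectorspace)
  moreover have "fin_dim"
    unfolding fin_dim_iff[OF base_space_vectorspace]
  proof (intro exI[of _ "{\<one>\<^bsub>k\<^esub>}"] conjI allI impI subsetI)
    fix U x assume U: "submodule k U (base_space k)" "{\<one>\<^bsub>k\<^esub>} \<subseteq> U"
      and x: "x \<in> carrier (base_space k)"
    show "x \<in> U" using submodule.smult_closed[OF U(1), of x "\<one>\<^bsub>k\<^esub>"] U x by simp
  qed simp_all
  ultimately show ?thesis by (simp add: Rep_def unit_rep_def)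
qed

end

section \<open>Tensor products of representations\<close>

text \<open>Products of two finite generating sets generate. A submodule containing them is spread
  to all pure tensors one factor at a time, by pulling it back along v \<mapsto> v \<otimes> w and
  along w \<mapsto> v \<otimes> w.\<close>

lemma fin_dim_tensor:
  fixes V W :: "('u, 'v) module" and P :: "('u, 'w) module"
  assumes V: "vectorspace k V" "vectorspace.fin_dim k V"
    and W: "vectorspace k W" "vectorspace.fin_dim k W"
    and P: "vectorspace k P" and \<phi>: "\<phi> \<in> module_hom k (tensor_module k V W) P"
    and surj: "\<phi> ` carrier (tensor_group k V W) = carrier P"
  shows "vectorspace.fin_dim k P"
proof -
  interpret V: vectorspace k V by fact
  interpret W: vectorspace k W by fact
  interpret P: vectorspace k P by fact
  interpret VW: tensor_pair k V W using V.module_axioms W.module_axioms by (rule tensor_pair.intro)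
  obtain B where B: "finite B" "B \<subseteq> carrier V" "\<And>U. submodule k U V \<Longrightarrow> B \<subseteq> U \<Longrightarrow> carrier V \<subseteq> U"
    using V unfolding fin_dim_iff[OF V(1)] by blast
  obtain C where C: "finite C" "C \<subseteq> carrier W" "\<And>U. submodule k U W \<Longrightarrow> C \<subseteq> U \<Longrightarrow> carrier W \<subseteq> U"
    using W unfolding fin_dim_iff[OF W(1)] by blast
  let ?D = "(\<lambda>(v, w). \<phi> (VW.pt v w)) ` (B \<times> C)"
  have fhom: "(\<lambda>v. VW.pt v w) \<in> module_hom k V VW.Z" if "w \<in> carrier W" for w
    using that by (intro module_homI balanced_amap1[OF VW.pt_balanced]) (simp_all add: VW.smult_pt)
  have shom: "VW.pt v \<in> module_hom k W VW.Z" if "v \<in> carrier V" for v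
    using that by (intro module_homI balanced_amap2[OF VW.pt_balanced])
        (simp_all add: VW.smult_pt VW.pt_smult)
  show ?thesis unfolding fin_dim_iff[OF P]
  proof (intro exI[of _ ?D] conjI allI impI)
    show "finite ?D" using B C by simp
    show "?D \<subseteq> carrier P" using B(2) C(2) by (auto intro!: module_hom_in[OF \<phi>] VW.pt_closed)
    fix U assume U: "submodule k U P" and D: "?D \<subseteq> U"
    interpret U: submodule k U P by (rule U)
    have 1: "\<phi> (VW.pt v w) \<in> U" if v: "v \<in> carrier V" and w: "w \<in> C" for v w
    proof -
      have "carrier V \<subseteq> {v \<in> carrier V. \<phi> (VW.pt v w) \<in> U}"
        using w C(2) B(2) D
        by (intro B(3) preimage_submodule[OF V.module_axioms module_hom_comp[OF fhom \<phi>]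
            P.module_axioms U]) auto
      then show ?thesis using v by blast
    qed
    have 2: "\<phi> (VW.pt v w) \<in> U" if v: "v \<in> carrier V" and w: "w \<in> carrier W" for v w
    proof -
      have "carrier W \<subseteq> {w \<in> carrier W. \<phi> (VW.pt v w) \<in> U}"
        using v 1 C(2)
        by (intro C(3) preimage_submodule[OF W.module_axioms module_hom_comp[OF shom \<phi>]
            P.module_axioms U]) auto
      then show ?thesis using w by blast
    qed
    have "\<phi> z \<in> U" if "z \<in> carrier (tensor_group k V W)" for z
      using that
      by (induction z rule: VW.tensor_induct) (simp_all add: 2 module_hom_add[OF \<phi>])
    then show "carrier P \<subseteq> U" unfolding surj[symmetric] by auto
  qed
qed

locale rep_pair = gfun k G for k :: "'u::infinite ring" and G :: "('u, 'g) gfunctor" +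
  fixes X Y :: "('u, 'u, 'g) rep"
  assumes X: "X \<in> Rep k G" and Y: "Y \<in> Rep k G"
begin

lemma Xr: "representation k G X" and Yr: "representation k G Y"
  using X Y by (simp_all add: Rep_def)

text \<open>The diagonal action before it is carried along \<open>ext_tensor_iso\<close>.\<close>

abbreviation "MM R g \<equiv> tensor_map R (fibre k R X) (fibre k R Y) (fibre k R X) (fibre k R Y)
    (act X R g) (act Y R g)"

context
  fixes R :: "('u, 'u) module"
  assumes R: "algebra k R"
begin

interpretation T: tens_iso k "space X" "space Y" R
  using rep_module[OF Xr] rep_module[OF Yr] R by (rule tens_iso.intro)

lemma act_homX: "g \<in> carrier (fob G R) \<Longrightarrow> act X R g \<in> module_hom R T.VR.E T.VR.E"
  and act_homY: "g \<in> carrier (fob G R) \<Longrightarrow> act Y R g \<in> module_hom R T.WR.E T.WR.E"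
  using act_hom[OF Xr R] act_hom[OF Yr R] by simp_all

lemma MM_hom: "g \<in> carrier (fob G R) \<Longrightarrow> MM R g \<in> module_hom R T.TR.Z T.TR.Z"
  unfolding fibre_def
  by (rule tensor_map_module_hom[OF T.VR.ext_module T.WR.ext_module T.VR.ext_module
      T.WR.ext_module act_homX act_homY])

lemma MM_amap: "g \<in> carrier (fob G R) \<Longrightarrow> amap T.TR.Z T.TR.Z (MM R g)"
  using module_hom_amap[OF MM_hom] .

lemma MM_closed: "g \<in> carrier (fob G R) \<Longrightarrow> z \<in> carrier (tensor_group R T.VR.E T.WR.E) \<Longrightarrow>
    MM R g z \<in> carrier (tensor_group R T.VR.E T.WR.E)"
  using amap_closed[OF MM_amap] by simp

lemma MM_pt: "g \<in> carrier (fob G R) \<Longrightarrow> x \<in> carrier (tensor_group k (space X) R) \<Longrightarrow>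
    y \<in> carrier (tensor_group k (space Y) R) \<Longrightarrow> MM R g (T.TR.pt x y) = T.TR.pt (act X R g x)
        (act Y R g y)"
  unfolding fibre_def
  using tensor_map_pt[OF T.VR.ext_module T.WR.ext_module T.VR.ext_module T.WR.ext_module act_homX
      act_homY]
  by simp

lemma MM_mult:
  assumes g: "g \<in> carrier (fob G R)" and h: "h \<in> carrier (fob G R)"
    and z: "z \<in> carrier (tensor_group R T.VR.E T.WR.E)"
  shows "MM R (g \<otimes>\<^bsub>fob G R\<^esub> h) z = MM R g (MM R h z)"
proof (rule T.TR.amap_tensor_eqI[where P = T.TR.Z and z = z])
  interpret group "fob G R" by (rule G_group[OF R])
  show "amap T.TR.Z T.TR.Z (MM R (g \<otimes>\<^bsub>fob G R\<^esub> h))" using g h by (intro MM_amap) simp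
  show "amap T.TR.Z T.TR.Z (\<lambda>z. MM R g (MM R h z))"
    by (rule amap_comp[OF MM_amap[OF h] MM_amap[OF g]])
  show "MM R (g \<otimes>\<^bsub>fob G R\<^esub> h) (T.TR.pt x y) = MM R g (MM R h (T.TR.pt x y))"
    if "x \<in> carrier T.VR.E" "y \<in> carrier T.WR.E" for x y
  proof -
    have "act X R (g \<otimes>\<^bsub>fob G R\<^esub> h) x = act X R g (act X R h x)"
        "act Y R (g \<otimes>\<^bsub>fob G R\<^esub> h) y = act Y R g (act Y R h y)"
      using that by (simp_all add: act_mult[OF Xr R g h] act_mult[OF Yr R g h] compose_eq)
    then show ?thesis
      using that g h act_closed[OF Xr R h] act_closed[OF Yr R h] by (simp add: MM_pt)
  qed
qed (use z in simp)

lemma MM_one: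
  assumes z: "z \<in> carrier (tensor_group R T.VR.E T.WR.E)"
  shows "MM R \<one>\<^bsub>fob G R\<^esub> z = z"
proof -
  interpret group "fob G R" by (rule G_group[OF R])
  show ?thesis
    by (rule T.TR.amap_tensor_eqI[where P = T.TR.Z and z = z])
      (use z in \<open>simp_all add: MM_amap amap_id MM_pt act_one[OF Xr R] act_one[OF Yr R]\<close>)
qed

lemma tensor_rep_act:
  assumes z: "z \<in> carrier (tensor_group R T.VR.E T.WR.E)"
  shows "act (tensor_rep k X Y) R g (T.J z) = T.J (MM R g z)"
proof -
  have "inv_into (carrier (tensor_group R T.VR.E T.WR.E)) T.J (T.J z) = z"
    using T.J_bij z by (simp add: bij_betw_def)
  then show ?thesis using z T.J_closed[OF z] by (simp add: tensor_rep_def Let_def fibre_def)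
qed

end

text \<open>The tensor condition in \<open>monoidal\<close> speaks of members of
  \<open>Rep k G\<close> isomorphic to \<open>tensor_rep k X Y\<close>; it has content for
  \<open>X\<close> and \<open>Y\<close> only because such a member exists. \<open>lam_mult\<close>
  depends on this.\<close>

lemma tensor_rep_in_universe: "\<exists>T\<in>Rep k G. \<exists>\<phi>. \<phi> \<in> rep_iso k G (tensor_rep k X Y) T"
proof -
  interpret sX: vectorspace k "space X" by (rule rep_vectorspace[OF Xr])
  interpret sY: vectorspace k "space Y" by (rule rep_vectorspace[OF Yr])
  interpret VW: tensor_pair k "space X" "space Y" using sX.module_axioms sY.module_axioms
    by (rule tensor_pair.intro)
  obtain \<phi> :: "_ \<Rightarrow> 'u" where inj: "inj_on \<phi> (carrier (tensor_group k (space X) (space Y)))"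
    by (rule tensor_inj_universe[OF sX.module_axioms sY.module_axioms])
  interpret tr: transported VW.Z \<phi> by unfold_locales (simp add: inj)
  define P where "P = transport \<phi> VW.Z"
  have Pm: "module k P" unfolding P_def by (rule tr.transport_module[OF VW.tensor_module_module])
  have Pv: "vectorspace k P" using Pm k by (simp add: vectorspace_def)
  have \<phi>: "\<phi> \<in> module_hom k VW.Z P"
    unfolding P_def by (intro module_homI amapI) (simp_all add: tr.transport_simps)
  have \<phi>bij: "bij_betw \<phi> (carrier VW.Z) (carrier P)" unfolding P_def by (rule tr.transport_bij)
  have Pfin: "vectorspace.fin_dim k P"
    using X Y by (intro fin_dim_tensor[OF sX.vectorspace_axioms _ sY.vectorspace_axioms _ Pv \<phi>])
      (simp_all add: Rep_def P_def)
  \<comment> \<open>\<open>L\<close> is the canonical isomorphism followed by the copying map. The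
    action on the copy is the diagonal action conjugated by \<open>L\<close>, and since
    \<open>L\<close> is bijective and \<open>R\<close>-linear, the axioms for it reduce to those of
    \<open>MM\<close>.\<close>
  define L where "L R z
      = tensor_map k VW.Z R P R \<phi> (\<lambda>r. r)
      (ext_tensor_iso k (space X) (space Y) R z)" for R :: "('u, 'u) module" and z
  let ?TR = "\<lambda>R. tensor_group R (fibre k R X) (fibre k R Y)"
  define T where "T = \<lparr>space = P, act = (\<lambda>R g. \<lambda>z\<in>carrier (tensor_group k P R).
      L R (MM R g (inv_into (carrier (?TR R)) (L R) z)))\<rparr>"
  have Lbij: "bij_betw (L R) (carrier (?TR R)) (carrier (tensor_group k P R))" if R: "algebra k R"
    for R
  proof -
    interpret T: tens_iso k "space X" "space Y" R
      using rep_module[OF Xr] rep_module[OF Yr] R by (rule tens_iso.intro)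
    show ?thesis
      using bij_betw_trans[OF T.J_bij ext_map_bij[OF VW.tensor_module_module Pm R \<phi> \<phi>bij]]
      by (simp add: L_def[abs_def] fibre_def comp_def)
  qed
  have Lhom: "L R \<in> module_hom R (tensor_module R (fibre k R X) (fibre k R Y)) (ext_scalars k P R)"
    if R: "algebra k R" for R
  proof -
    interpret T: tens_iso k "space X" "space Y" R
      using rep_module[OF Xr] rep_module[OF Yr] R by (rule tens_iso.intro)
    interpret e: ext_map k VW.Z P R \<phi> using VW.tensor_module_module Pm R \<phi> by (rule ext_map.intro)
    have "T.J \<in> module_hom R T.TR.Z T.VWR.E"
      by (rule module_homI) (simp_all add: T.VWR.amap_E T.J_amap T.J_smult)
    from module_hom_comp[OF this e.V\<phi>_module_hom]
    show ?thesis by (simp add: L_def[abs_def] fibre_def)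
  qed
  have act_T: "act T R g (L R z) = L R (MM R g z)"
    if R: "algebra k R" and z: "z \<in> carrier (?TR R)" for R g z
    using Lbij[OF R] z by (auto simp: T_def bij_betw_def)
  have ex: "\<exists>w\<in>carrier (?TR R). z = L R w"
    if R: "algebra k R" and z: "z \<in> carrier (tensor_group k P R)" for R z
    using Lbij[OF R] z by (auto simp: bij_betw_def)
  have MMc: "MM R g z \<in> carrier (?TR R)"
    if "algebra k R" "g \<in> carrier (fob G R)" "z \<in> carrier (?TR R)" for R g z
    using MM_closed[of R g z] that by (simp add: fibre_def)
  have TmodR: "module R (tensor_module R (fibre k R X) (fibre k R Y))" if R: "algebra k R" for R
  proof -
    interpret T: tens_iso k "space X" "space Y" R
      using rep_module[OF Xr] rep_module[OF Yr] R by (rule tens_iso.intro)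
    show ?thesis using T.TR.tensor_module_module by (simp add: fibre_def)
  qed
  have Thom: "act T R g \<in> module_hom R (ext_scalars k P R) (ext_scalars k P R)"
    if R: "algebra k R" and g: "g \<in> carrier (fob G R)" for R g
  proof -
    interpret EP: ext_scal k P R using Pm R by (rule ext_scal.intro)
    have i: "inv_into (carrier (?TR R)) (L R) \<in> module_hom R (ext_scalars k P R)
        (tensor_module R (fibre k R X) (fibre k R Y))"
      using module_hom_inv_into[OF TmodR[OF R] Lhom[OF R]] Lbij[OF R] by simp
    have m: "MM R g \<in> module_hom R (tensor_module R (fibre k R X) (fibre k R Y))
        (tensor_module R (fibre k R X) (fibre k R Y))"
      using MM_hom[OF R g] by (simp add: fibre_def)
    have "(\<lambda>z. L R (MM R g (inv_into (carrier (?TR R)) (L R) z))) \<in> module_hom R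
        (ext_scalars k P R) (ext_scalars k P R)"
      by (rule module_hom_comp[OF module_hom_comp[OF i m] Lhom[OF R]])
    then show ?thesis using EP.E.smult_closed by (auto simp: T_def module_hom_def)
  qed
  have Trep: "representation k G T"
  proof (rule representationI)
    fix R :: "('u, 'u) module" and g h z assume R: "algebra k R"
      and gh: "g \<in> carrier (fob G R)" "h \<in> carrier (fob G R)"
      and z: "z \<in> carrier (tensor_group k (space T) R)"
    obtain w where w: "w \<in> carrier (?TR R)" "z = L R w" using ex[OF R, of z] z by (auto simp: T_def)
    show "act T R (g \<otimes>\<^bsub>fob G R\<^esub> h) z = act T R g (act T R h z)"
    proof -
      have "MM R (g \<otimes>\<^bsub>fob G R\<^esub> h) w = MM R g (MM R h w)"
        using MM_mult[OF R gh, of w] w by (simp add: fibre_def)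
      then show ?thesis using w gh by (simp add: act_T R MMc)
    qed
  next
    fix R :: "('u, 'u) module" and z assume R: "algebra k R"
      and z: "z \<in> carrier (tensor_group k (space T) R)"
    obtain w where w: "w \<in> carrier (?TR R)" "z = L R w" using ex[OF R, of z] z by (auto simp: T_def)
    show "act T R \<one>\<^bsub>fob G R\<^esub> z = z" using w MM_one[OF R, of w] by (simp add: act_T R fibre_def)
  next
    fix R S :: "('u, 'u) module" and f g v assume R: "algebra k R" and S: "algebra k S"
      and f: "f \<in> alg_hom k R S"
      and g: "g \<in> carrier (fob G R)" and v: "v \<in> carrier (space T)"
    let ?fg = "fmor G R S f g"
    have fg: "?fg \<in> carrier (fob G S)" by (rule G_closed[OF R S f g])
    interpret TR: tens_iso k "space X" "space Y" R
      using rep_module[OF Xr] rep_module[OF Yr] R by (rule tens_iso.intro)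
    interpret TS: tens_iso k "space X" "space Y" S
      using rep_module[OF Xr] rep_module[OF Yr] S by (rule tens_iso.intro)
    interpret eR: ext_map k VW.Z P R \<phi> using VW.tensor_module_module Pm R \<phi> by (rule ext_map.intro)
    interpret eS: ext_map k VW.Z P S \<phi> using VW.tensor_module_module Pm S \<phi> by (rule ext_map.intro)
    interpret BP: base_chg k P R S f using Pm R S f by (rule base_chg.intro)
    interpret BX: base_chg k "space X" R S f using rep_module[OF Xr] R S f by (rule base_chg.intro)
    interpret BY: base_chg k "space Y" R S f using rep_module[OF Yr] R S f by (rule base_chg.intro)
    obtain u where u: "u \<in> carrier VW.Z" "v = \<phi> u" using v \<phi>bij by (auto simp: T_def bij_betw_def)
    have Ra: "amap eR.EW.Z eR.EW.Z (act T R g)" and Sa: "amap eS.EW.Z eS.EW.Z (act T S ?fg)"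
      using module_hom_amap[OF Thom[OF R g]] module_hom_amap[OF Thom[OF S fg]]
      by (simp_all add: eR.EW.amap_E eS.EW.amap_E)
    have eqR: "eR.EW.pt (\<phi> (VW.pt x y)) \<one>\<^bsub>R\<^esub> = L R (TR.TR.pt (TR.VR.pt x \<one>\<^bsub>R\<^esub>) (TR.WR.pt y \<one>\<^bsub>R\<^esub>))"
      if "x \<in> carrier (space X)" "y \<in> carrier (space Y)" for x y
      using that by (simp add: L_def TR.J_pt eR.V\<phi>_pt)
    have eqS: "eS.EW.pt (\<phi> (VW.pt x y)) \<one>\<^bsub>S\<^esub> = L S (TS.TR.pt (TS.VR.pt x \<one>\<^bsub>S\<^esub>) (TS.WR.pt y \<one>\<^bsub>S\<^esub>))"
      if "x \<in> carrier (space X)" "y \<in> carrier (space Y)" for x y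
      using that by (simp add: L_def TS.J_pt eS.V\<phi>_pt)
    \<comment> \<open>Both sides are additive in \<open>u\<close>, so \<open>u\<close> may be taken
      to be a pure tensor x \<otimes> y, on which the diagonal action is explicit and
      \<open>J_base_change\<close> applies.\<close>
    have "act T S ?fg (eS.EW.pt (\<phi> u) \<one>\<^bsub>S\<^esub>) = BP.Vf (act T R g (eR.EW.pt (\<phi> u) \<one>\<^bsub>R\<^esub>))"
    proof (rule VW.amap_tensor_eqI[where P = eS.EW.Z and z = u])
      show "amap VW.Z eS.EW.Z (\<lambda>u. act T S ?fg (eS.EW.pt (\<phi> u) \<one>\<^bsub>S\<^esub>))"
        by (rule amap_comp[OF amap_comp[OF module_hom_amap[OF \<phi>]
            balanced_amap1[OF eS.EW.pt_balanced]] Sa]) simp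
      show "amap VW.Z eS.EW.Z (\<lambda>u. BP.Vf (act T R g (eR.EW.pt (\<phi> u) \<one>\<^bsub>R\<^esub>)))"
        by (rule amap_comp[OF amap_comp[OF amap_comp[OF module_hom_amap[OF \<phi>]
                balanced_amap1[OF eR.EW.pt_balanced]] Ra] BP.Vf_amap]) simp
      show "act T S ?fg (eS.EW.pt (\<phi> (VW.pt x y)) \<one>\<^bsub>S\<^esub>)
          = BP.Vf (act T R g (eR.EW.pt (\<phi> (VW.pt x y)) \<one>\<^bsub>R\<^esub>))"
        if x: "x \<in> carrier (space X)" and y: "y \<in> carrier (space Y)" for x y
      proof -
        let ?a = "act X R g (TR.VR.pt x \<one>\<^bsub>R\<^esub>)" and ?b = "act Y R g (TR.WR.pt y \<one>\<^bsub>R\<^esub>)"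
        have a: "?a \<in> carrier (tensor_group k (space X) R)"
          and b: "?b \<in> carrier (tensor_group k (space Y) R)"
          using x y act_closed[OF Xr R g] act_closed[OF Yr R g] by simp_all
        have "act T S ?fg (eS.EW.pt (\<phi> (VW.pt x y)) \<one>\<^bsub>S\<^esub>)
            = L S (MM S ?fg (TS.TR.pt (TS.VR.pt x \<one>\<^bsub>S\<^esub>) (TS.WR.pt y \<one>\<^bsub>S\<^esub>)))"
          using x y by (simp add: eqS act_T S fibre_def)
        also have "\<dots> = L S (TS.TR.pt (act X S ?fg (TS.VR.pt x \<one>\<^bsub>S\<^esub>))
            (act Y S ?fg (TS.WR.pt y \<one>\<^bsub>S\<^esub>)))"
          using x y fg by (simp add: MM_pt S)
        also have "act X S ?fg (TS.VR.pt x \<one>\<^bsub>S\<^esub>) = BX.Vf ?a"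
          using act_nat[OF Xr R S f g, of "TR.VR.pt x \<one>\<^bsub>R\<^esub>"] x
            by (simp add: BX.Vf_pt alg_homD[OF f])
        also have "act Y S ?fg (TS.WR.pt y \<one>\<^bsub>S\<^esub>) = BY.Vf ?b"
          using act_nat[OF Yr R S f g, of "TR.WR.pt y \<one>\<^bsub>R\<^esub>"] y
            by (simp add: BY.Vf_pt alg_homD[OF f])
        also have "L S (TS.TR.pt (BX.Vf ?a) (BY.Vf ?b)) = BP.Vf (L R (TR.TR.pt ?a ?b))"
        proof -
          have "TR.J (TR.TR.pt ?a ?b) \<in> carrier (tensor_group k VW.Z R)"
            using a b by (intro TR.J_closed TR.TR.pt_closed) simp_all
          then show ?thesis
            unfolding L_def
            by (simp add: J_base_change[OF rep_module[OF Xr] rep_module[OF Yr] R S f a b, symmetric]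
                ext_map_base_change[OF VW.tensor_module_module Pm R S \<phi> f])
        qed
        also have "L R (TR.TR.pt ?a ?b) = act T R g (eR.EW.pt (\<phi> (VW.pt x y)) \<one>\<^bsub>R\<^esub>)"
          using x y g by (simp add: eqR act_T R fibre_def MM_pt[OF R g, unfolded fibre_def])
        finally show ?thesis .
      qed
    qed (use u in simp)
    then show "act T S ?fg (pure_tensor k (space T) S v \<one>\<^bsub>S\<^esub>)
      = tensor_map k (space T) R (space T) S (\<lambda>v. v) f
          (act T R g (pure_tensor k (space T) R v \<one>\<^bsub>R\<^esub>))"
      using u by (simp add: T_def)
  qed (use Pv Thom in \<open>simp_all add: T_def\<close>)
  have "T \<in> Rep k G" using Trep Pfin by (simp add: Rep_def T_def)
  moreover have "\<phi> \<in> rep_iso k G (tensor_rep k X Y) T"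
  proof -
    have "fibre_map k R (tensor_rep k X Y) T \<phi> (act (tensor_rep k X Y) R g z)
        = act T R g (fibre_map k R (tensor_rep k X Y) T \<phi> z)"
      if R: "algebra k R" and g: "g \<in> carrier (fob G R)"
        and z: "z \<in> carrier (fibre k R (tensor_rep k X Y))" for R g z
    proof -
      interpret T: tens_iso k "space X" "space Y" R
        using rep_module[OF Xr] rep_module[OF Yr] R by (rule tens_iso.intro)
      obtain w where w: "w \<in> carrier (?TR R)" "z = T.J w"
        using z T.J_bij by (auto simp: bij_betw_def fibre_def tensor_rep_def)
      have "fibre_map k R (tensor_rep k X Y) T \<phi> z' = tensor_map k VW.Z R P R \<phi> (\<lambda>r. r) z'" for z'
        by (simp add: fibre_map_def tensor_rep_def T_def)
      then show ?thesis
        using w act_T[OF R w(1), of g] tensor_rep_act[OF R, of w g] by (simp add: L_def fibre_def)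
    qed
    then show ?thesis using \<phi> \<phi>bij by (simp add: rep_iso_def rep_hom_def tensor_rep_def T_def)
  qed
  ultimately show ?thesis by blast
qed

end

section \<open>The canonical map into the monoidal automorphisms\<close>

context gfun
begin

lemma RepD: "X \<in> Rep k G \<Longrightarrow> representation k G X" "X \<in> Rep k G \<Longrightarrow> vectorspace.fin_dim k (space X)"
  by (simp_all add: Rep_def)

text \<open>Naturality is the defining property of morphisms of representations. The tensor
  condition holds because \<phi> is equivariant and \<open>tensor_rep\<close> acts diagonally
  through \<open>ext_tensor_iso\<close>.\<close>

lemma canonical_in_Aut:
  assumes R: "algebra k R" and g: "g \<in> carrier (fob G R)"
  shows "canonical_map k G R g \<in> carrier (fob (Aut_tensor k G) R)"
proof -
  let ?\<theta> = "canonical_map k G R g"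
  have \<theta>: "?\<theta> X = act X R g" if "X \<in> Rep k G" for X using that by (simp add: canonical_map_def)
  have "natural_aut k G R ?\<theta>"
    using act_aut[OF RepD(1) R g] R g by (simp add: natural_aut_def \<theta> fibre_def rep_hom_def)
  moreover have "monoidal k G R ?\<theta>"
  proof -
    have "act T R g (fibre_map k R (tensor_rep k X Y) T \<phi> (ext_tensor_iso k (space X) (space Y) R
        z))
        = fibre_map k R (tensor_rep k X Y) T \<phi> (ext_tensor_iso k (space X) (space Y) R
            (tensor_map R (fibre k R X) (fibre k R Y) (fibre k R X) (fibre k R Y) (act X R g)
                (act Y R g) z))"
      if X: "X \<in> Rep k G" and Y: "Y \<in> Rep k G" and T: "T \<in> Rep k G"
        and \<phi>: "\<phi> \<in> rep_iso k G (tensor_rep k X Y) T"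
        and z: "z \<in> carrier (tensor_group R (fibre k R X) (fibre k R Y))" for X Y T \<phi> z
    proof -
      interpret rep_pair k G X Y using X Y by unfold_locales
      interpret T: tens_iso k "space X" "space Y" R
        using rep_module[OF Xr] rep_module[OF Yr] R by (rule tens_iso.intro)
      have "T.J z \<in> carrier (fibre k R (tensor_rep k X Y))"
        using T.J_closed z by (simp add: fibre_def tensor_rep_def)
      then have "act T R g (fibre_map k R (tensor_rep k X Y) T \<phi> (T.J z))
          = fibre_map k R (tensor_rep k X Y) T \<phi> (act (tensor_rep k X Y) R g (T.J z))"
        using \<phi> R g by (simp add: rep_iso_def rep_hom_def)
      then show ?thesis using tensor_rep_act[OF R, of z g] z by (simp add: fibre_def)
    qed
    moreover have "act (unit_rep k) R g (pure_tensor k (base_space k) R \<one>\<^bsub>k\<^esub> r)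
        = pure_tensor k (base_space k) R \<one>\<^bsub>k\<^esub> r"
      if "r \<in> carrier R" for r
    proof -
      interpret vectorspace k "base_space k" by (rule base_space_vectorspace)
      interpret E: ext_scal k "base_space k" R using module_axioms R by (rule ext_scal.intro)
      show ?thesis using that by (simp add: unit_rep_def)
    qed
    ultimately show ?thesis by (simp add: monoidal_def Let_def \<theta> unit_rep_Rep)
  qed
  ultimately show ?thesis by (simp add: Aut_tensor_def canonical_map_def)
qed

lemma canonical_mult:
  assumes R: "algebra k R" and g: "g \<in> carrier (fob G R)" and h: "h \<in> carrier (fob G R)"
  shows "canonical_map k G R (g \<otimes>\<^bsub>fob G R\<^esub> h)
    = canonical_map k G R g \<otimes>\<^bsub>fob (Aut_tensor k G) R\<^esub> canonical_map k G R h"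
  using act_mult[OF RepD(1) R g h]
    by (simp add: canonical_map_def Aut_tensor_def fibre_def fun_eq_iff)

lemma canonical_nat:
  assumes R: "algebra k R" and S: "algebra k S" and f: "f \<in> alg_hom k R S"
    and g: "g \<in> carrier (fob G R)"
  shows "canonical_map k G S (fmor G R S f g) = fmor (Aut_tensor k G) R S f (canonical_map k G R g)"
proof -
  have "act X S (fmor G R S f g) = base_change k (space X) R S f (act X R g)" if "X \<in> Rep k G" for X
    using RepD(1)[OF that] R S f g by (simp add: representation_def gfunctor_hom_def GL_functor_def)
  then show ?thesis by (simp add: canonical_map_def Aut_tensor_def fun_eq_iff)
qed

end

section \<open>Functions on an affine group scheme\<close>

lemma compose_apply: "x \<in> carrier A \<Longrightarrow> compose (carrier A) f p x = f (p x)"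
  by (simp add: compose_def)

locale affine = gfun k G for k :: "'u::infinite ring" and G :: "('u, 'g) gfunctor" +
  fixes A :: "('u, 'u) module" and \<eta> :: "('u, 'u) module \<Rightarrow> ('u \<Rightarrow> 'u) \<Rightarrow> 'g"
  assumes A: "algebra k A"
    and \<eta>_bij: "algebra k R \<Longrightarrow> bij_betw (\<eta> R) (alg_hom k A R) (carrier (fob G R))"
    and \<eta>_nat: "algebra k R \<Longrightarrow> algebra k S \<Longrightarrow> f \<in> alg_hom k R S \<Longrightarrow> u \<in> alg_hom k A R \<Longrightarrow>
      \<eta> S (compose (carrier A) f u) = fmor G R S f (\<eta> R u)"
begin

sublocale A: algebra k A by (rule A)

lemma A_vectorspace: "vectorspace k A"
  using A.module k by (simp add: vectorspace_def)

abbreviation "H R \<equiv> alg_hom k A R"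
abbreviation "cmp f p \<equiv> compose (carrier A) f p"

text \<open>\<open>gi\<close> reads a group element as an algebra homomorphism out of
  \<open>A\<close>. The group law carried over in this way, \<open>pm\<close> and \<open>pe\<close>,
  takes the place of comultiplication and counit.\<close>

definition gi where "gi R g = inv_into (H R) (\<eta> R) g"
definition pm where "pm R p q = gi R (\<eta> R p \<otimes>\<^bsub>fob G R\<^esub> \<eta> R q)"
definition pe where "pe R = gi R \<one>\<^bsub>fob G R\<^esub>"

lemma cmp_closed: "f \<in> alg_hom k R S \<Longrightarrow> p \<in> H R \<Longrightarrow> cmp f p \<in> H S"
  using alg_hom_compose[OF _ _ A] .

context
  fixes R :: "('u, 'u) module"
  assumes R: "algebra k R"
begin

interpretation GR: group "fob G R" by (rule G_group[OF R])

lemma \<eta>_closed: "p \<in> H R \<Longrightarrow> \<eta> R p \<in> carrier (fob G R)"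
  using \<eta>_bij[OF R] by (auto simp: bij_betw_def)

lemma gi_closed: "g \<in> carrier (fob G R) \<Longrightarrow> gi R g \<in> H R"
  using \<eta>_bij[OF R] unfolding gi_def by (metis bij_betw_def inv_into_into)

lemma \<eta>_gi: "g \<in> carrier (fob G R) \<Longrightarrow> \<eta> R (gi R g) = g"
  using \<eta>_bij[OF R] unfolding gi_def by (rule bij_betw_inv_into_right)

lemma gi_\<eta>: "p \<in> H R \<Longrightarrow> gi R (\<eta> R p) = p"
  using \<eta>_bij[OF R] unfolding gi_def by (rule bij_betw_inv_into_left)

lemma \<eta>_inj: "p \<in> H R \<Longrightarrow> q \<in> H R \<Longrightarrow> \<eta> R p = \<eta> R q \<Longrightarrow> p = q"
  using gi_\<eta> by metis

lemma pm_closed: "p \<in> H R \<Longrightarrow> q \<in> H R \<Longrightarrow> pm R p q \<in> H R"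
  unfolding pm_def by (intro gi_closed GR.m_closed \<eta>_closed)

lemma pe_closed: "pe R \<in> H R"
  unfolding pe_def by (intro gi_closed GR.one_closed)

lemma \<eta>_pm: "p \<in> H R \<Longrightarrow> q \<in> H R \<Longrightarrow> \<eta> R (pm R p q) = \<eta> R p \<otimes>\<^bsub>fob G R\<^esub> \<eta> R q"
  unfolding pm_def by (intro \<eta>_gi GR.m_closed \<eta>_closed)

lemma \<eta>_pe: "\<eta> R (pe R) = \<one>\<^bsub>fob G R\<^esub>"
  unfolding pe_def by (intro \<eta>_gi GR.one_closed)

lemma pm_assoc: "p \<in> H R \<Longrightarrow> q \<in> H R \<Longrightarrow> r \<in> H R \<Longrightarrow> pm R (pm R p q) r = pm R p (pm R q r)"
  by (rule \<eta>_inj) (simp_all add: pm_closed \<eta>_pm \<eta>_closed GR.m_assoc)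

lemma pm_pe: "p \<in> H R \<Longrightarrow> pm R p (pe R) = p" "p \<in> H R \<Longrightarrow> pm R (pe R) p = p"
  by (rule \<eta>_inj; simp add: pm_closed pe_closed \<eta>_pm \<eta>_pe \<eta>_closed)+

lemma gi_mult: "g \<in> carrier (fob G R) \<Longrightarrow> h \<in> carrier (fob G R) \<Longrightarrow>
    gi R (g \<otimes>\<^bsub>fob G R\<^esub> h) = pm R (gi R g) (gi R h)"
  by (simp add: pm_def \<eta>_gi)

lemma cmp_pm:
  assumes S: "algebra k S" and f: "f \<in> alg_hom k R S" and p: "p \<in> H R" and q: "q \<in> H R"
  shows "cmp f (pm R p q) = pm S (cmp f p) (cmp f q)"
proof -
  have "fmor G R S f (\<eta> R p \<otimes>\<^bsub>fob G R\<^esub> \<eta> R q)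
      = fmor G R S f (\<eta> R p) \<otimes>\<^bsub>fob G S\<^esub> fmor G R S f (\<eta> R q)"
    using G_mor[OF R S f] \<eta>_closed p q by (intro hom_mult)
  then have "\<eta> S (cmp f (pm R p q)) = \<eta> S (cmp f p) \<otimes>\<^bsub>fob G S\<^esub> \<eta> S (cmp f q)"
    by (simp add: \<eta>_nat[OF R S f] p q pm_closed \<eta>_pm)
  then show ?thesis
    using gi_def pm_def \<eta>_bij[OF S] cmp_closed[OF f pm_closed[OF p q]]
    by (metis bij_betw_inv_into_left)
qed

lemma cmp_pe:
  assumes S: "algebra k S" and f: "f \<in> alg_hom k R S"
  shows "cmp f (pe R) = pe S"
proof -
  have "fmor G R S f \<one>\<^bsub>fob G R\<^esub> = \<one>\<^bsub>fob G S\<^esub>"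
    using hom_one[OF G_mor[OF R S f] GR.is_group G_group[OF S]] .
  then have "\<eta> S (cmp f (pe R)) = \<one>\<^bsub>fob G S\<^esub>"
    by (simp add: \<eta>_nat[OF R S f] pe_closed \<eta>_pe)
  then show ?thesis
    using gi_def pe_def \<eta>_bij[OF S] cmp_closed[OF f pe_closed]
    by (metis bij_betw_inv_into_left)
qed

lemma gi_mor:
  assumes S: "algebra k S" and f: "f \<in> alg_hom k R S" and g: "g \<in> carrier (fob G R)"
  shows "gi S (fmor G R S f g) = cmp f (gi R g)"
proof -
  have "\<eta> S (cmp f (gi R g)) = fmor G R S f g"
    by (simp add: \<eta>_nat[OF R S f] gi_closed g \<eta>_gi)
  then show ?thesis
    using gi_def \<eta>_bij[OF S] cmp_closed[OF f gi_closed[OF g]] by (metis bij_betw_inv_into_left)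
qed

end

section \<open>Values of tensors at points\<close>

abbreviation "sub V \<equiv> A\<lparr>carrier := V\<rparr>"

text \<open>An element \<open>z = \<Sum> v\<^sub>i \<otimes> r\<^sub>i\<close> of \<open>V \<otimes> R\<close>, with \<open>V\<close> a space of functions on \<open>G\<close>, is a function
  on \<open>G\<close> with coefficients in \<open>R\<close>; \<open>hat V R S h f z\<close> is the value \<open>\<Sum> v\<^sub>i(h) f(r\<^sub>i)\<close> at the
  \<open>S\<close>-point \<open>h\<close>.\<close>

definition hat where "hat V R S h f = tlift k (sub V) R S (\<lambda>v r. h v \<otimes>\<^bsub>S\<^esub> f r)"

lemma sub_module: "submodule k V A \<Longrightarrow> module k (sub V)"
  by (rule A.submodule_is_module)

lemma whole_submodule: "submodule k (carrier A) A"
  using A.module by (simp add: submodule_def)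

lemma hat_balanced:
  assumes V: "submodule k V A" and R: "algebra k R" and S: "algebra k S" and h: "h \<in> H S"
    and f: "f \<in> alg_hom k R S"
  shows "balanced k (sub V) R S (\<lambda>v r. h v \<otimes>\<^bsub>S\<^esub> f r)"
proof -
  interpret R: algebra k R by fact
  interpret S: algebra k S by fact
  have "v \<in> V \<Longrightarrow> v \<in> carrier A" for v using V by (auto simp: submodule_def)
  then show ?thesis
    using alg_homD[OF h] alg_homD[OF f]
    by (intro balancedI) (simp_all add: S.l_distr S.r_distr S.smult_assoc2 S.smult_assoc2_right)
qed

context
  fixes V :: "'u set" and R S :: "('u, 'u) module" and h f :: "'u \<Rightarrow> 'u"
  assumes V: "submodule k V A" and R: "algebra k R" and S: "algebra k S" and h: "h \<in> H S"
    and f: "f \<in> alg_hom k R S"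
begin

interpretation R: algebra k R by (rule R)
interpretation S: algebra k S by (rule S)
interpretation E: ext_scal k "sub V" R using sub_module[OF V] R by (rule ext_scal.intro)

lemma hat_amap: "amap E.Z S (hat V R S h f)"
  unfolding hat_def by (rule E.tlift_amap[OF S.M.abelian_group_axioms hat_balanced[OF V R S h f]])

lemma hat_pt: "v \<in> V \<Longrightarrow> r \<in> carrier R \<Longrightarrow> hat V R S h f (E.pt v r) = h v \<otimes>\<^bsub>S\<^esub> f r"
  unfolding hat_def using E.tlift_pt[OF S.M.abelian_group_axioms hat_balanced[OF V R S h f]] by simp

lemma hat_closed: "z \<in> carrier (tensor_group k (sub V) R) \<Longrightarrow> hat V R S h f z \<in> carrier S"
  using amap_closed[OF hat_amap] by simp

lemma hat_smult:
  assumes r: "r \<in> carrier R" and z: "z \<in> carrier (tensor_group k (sub V) R)"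
  shows "hat V R S h f (r \<odot>\<^bsub>E.E\<^esub> z) = f r \<otimes>\<^bsub>S\<^esub> hat V R S h f z"
proof (rule E.amap_tensor_eqI[where P = S and z = z])
  have Vc: "v \<in> V \<Longrightarrow> v \<in> carrier A" for v using V by (auto simp: submodule_def)
  show "amap E.Z S (\<lambda>z. hat V R S h f (r \<odot>\<^bsub>E.E\<^esub> z))"
    by (rule amap_comp[OF E.esmult_amap[OF r] hat_amap])
  have "amap S S (\<lambda>x. f r \<otimes>\<^bsub>S\<^esub> x)" using alg_homD(4)[OF f r] by (simp add: amap_def S.r_distr)
  then show "amap E.Z S (\<lambda>z. f r \<otimes>\<^bsub>S\<^esub> hat V R S h f z)" by (rule amap_comp[OF hat_amap])
  show "hat V R S h f (r \<odot>\<^bsub>E.E\<^esub> E.pt v s) = f r \<otimes>\<^bsub>S\<^esub> hat V R S h f (E.pt v s)"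
    if "v \<in> carrier (sub V)" "s \<in> carrier R" for v s
    using that r alg_homD[OF f] alg_homD(4)[OF h Vc, of v]
      by (simp add: E.esmult_pt hat_pt S.m_lcomm)
qed (use z in simp)

end

lemma hat_base_change:
  assumes V: "submodule k V A" and R: "algebra k R" and R': "algebra k R'" and S: "algebra k S"
    and h: "h \<in> H S" and g: "g \<in> alg_hom k R R'" and f: "f \<in> alg_hom k R' S"
    and z: "z \<in> carrier (tensor_group k (sub V) R)"
  shows "hat V R' S h f (tensor_map k (sub V) R (sub V) R' (\<lambda>v. v) g z)
      = hat V R S h (compose (carrier R) f g) z"
proof -
  interpret B: base_chg k "sub V" R R' g using sub_module[OF V] R R' g by (rule base_chg.intro)
  have fg: "compose (carrier R) f g \<in> alg_hom k R S" by (rule alg_hom_compose[OF g f R])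
  show ?thesis
    by (rule B.ER.amap_tensor_eqI[where P = S and z = z])
      (use z in \<open>simp_all add: amap_comp[OF B.Vf_amap hat_amap[OF V R' S h f]]
          hat_amap[OF V R S h fg]
        hat_pt[OF V R S h fg] hat_pt[OF V R' S h f] B.Vf_pt alg_homD(4)[OF g] compose_apply\<close>)
qed

lemma hat_incl:
  assumes V: "submodule k V A" and W: "submodule k W A" and VW: "V \<subseteq> W" and R: "algebra k R"
    and S: "algebra k S"
    and h: "h \<in> H S" and f: "f \<in> alg_hom k R S" and z: "z \<in> carrier (tensor_group k (sub V) R)"
  shows "hat W R S h f (tensor_map k (sub V) R (sub W) R (\<lambda>v. v) (\<lambda>r. r) z) = hat V R S h f z"
    and "tensor_map k (sub V) R (sub W) R (\<lambda>v. v) (\<lambda>r. r) z \<in> carrier (tensor_group k (sub W) R)"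
proof -
  have i: "(\<lambda>v. v) \<in> module_hom k (sub V) (sub W)" using VW by (auto simp: module_hom_def)
  interpret e: ext_map k "sub V" "sub W" R "\<lambda>v. v" using sub_module[OF V] sub_module[OF W] R i
    by (rule ext_map.intro)
  show "hat W R S h f (e.V\<phi> z) = hat V R S h f z"
    by (rule e.EV.amap_tensor_eqI[where P = S and z = z])
      (use z VW in \<open>auto simp: amap_comp[OF e.V\<phi>_amap hat_amap[OF W R S h f]] hat_amap[OF V R S h f]
        e.V\<phi>_pt hat_pt[OF V R S h f] hat_pt[OF W R S h f]\<close>)
  show "e.V\<phi> z \<in> carrier (tensor_group k (sub W) R)" using e.V\<phi>_closed[OF z] .
qed

text \<open>A universal choice of \<open>S\<close>, \<open>h\<close> and \<open>f\<close> suffices: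
  the coproduct of \<open>A\<close> and \<open>R\<close> with its two coprojections.\<close>

lemma hat_eqI:
  assumes V: "submodule k V A" and R: "algebra k R"
    and z: "z \<in> carrier (tensor_group k (sub V) R)" and w: "w \<in> carrier (tensor_group k (sub V) R)"
    and eq: "\<And>S h f. algebra k S \<Longrightarrow> h \<in> H S \<Longrightarrow> f \<in> alg_hom k R S \<Longrightarrow> hat V R S h f z = hat V R S h f w"
  shows "z = w"
proof -
  interpret Co: coproduct k A R using A R by (intro coproduct.intro alg_pair.intro)
  have i: "(\<lambda>v. v) \<in> module_hom k (sub V) A" using V by (auto simp: module_hom_def submodule_def)
  interpret e: ext_map k "sub V" A R "\<lambda>v. v" using sub_module[OF V] A.module R i
    by (rule ext_map.intro)
  interpret vV: vec_tensor k A V R using A_vectorspace V algebra.module[OF R]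
    by (rule vec_tensor.intro)
  \<comment> \<open>Over the coproduct the value of a tensor is its own image in A \<otimes> R, up
    to the copying map.\<close>
  have hb: "hat V R Co.Co Co.inl Co.inr x = Co.\<beta> (e.V\<phi> x)"
    if x: "x \<in> carrier (tensor_group k (sub V) R)" for x
    by (rule e.EV.amap_tensor_eqI[where P = Co.Co and z = x])
      (use x in \<open>simp_all add: hat_amap[OF V R Co.Co_algebra Co.inl_hom Co.inr_hom]
          amap_comp[OF e.V\<phi>_amap Co.\<beta>_amap]
        hat_pt[OF V R Co.Co_algebra Co.inl_hom Co.inr_hom] e.V\<phi>_pt vV.V_in Co.\<beta>_pt\<close>)
  have "Co.\<beta> (e.V\<phi> z) = Co.\<beta> (e.V\<phi> w)"
    using eq[OF Co.Co_algebra Co.inl_hom Co.inr_hom] hb z w by simp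
  then have ev: "e.V\<phi> z = e.V\<phi> w"
    using Co.\<beta>_inj e.V\<phi>_closed z w by (auto dest: inj_onD)
  interpret vA: vec_tensor k A "carrier A" R
    using A_vectorspace whole_submodule algebra.module[OF R] by (rule vec_tensor.intro)
  \<comment> \<open>It remains to see that V \<otimes> R embeds in A \<otimes> R. Slices by
    functionals on \<open>A\<close> are the same on both sides and separate the elements of V
    \<otimes> R.\<close>
  have sl: "vA.slice f (e.V\<phi> x) = vV.slice f x"
    if f: "f \<in> functionals k A" and x: "x \<in> carrier (tensor_group k (sub V) R)" for f x
  proof (rule e.EV.amap_tensor_eqI[where P = R and z = x])
    have "amap Co.Z R (vA.slice f)" using vA.slice_amap[OF f] by simp
    then show "amap e.EV.Z R (\<lambda>x. vA.slice f (e.V\<phi> x))" by (rule amap_comp[OF e.V\<phi>_amap])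
    show "amap e.EV.Z R (vV.slice f)" by (rule vV.slice_amap[OF f])
    show "vA.slice f (e.V\<phi> (e.EV.pt v r)) = vV.slice f (e.EV.pt v r)"
      if "v \<in> carrier (sub V)" "r \<in> carrier R" for v r
      using that vA.slice_pt[OF f, of v r] by (simp add: e.V\<phi>_pt vV.slice_pt[OF f] vV.V_in)
  qed (use x in simp)
  show ?thesis by (rule vV.slices_eqI[OF z w]) (metis sl z w ev)
qed

section \<open>Local finiteness of the regular representation\<close>

lemma base_space_algebra: "algebra k (base_space k)"
proof -
  interpret vectorspace k "base_space k" by (rule base_space_vectorspace)
  have "cring (base_space k)"
  proof (rule cringI)
    show "abelian_group (base_space k)" by (rule abelian_group_axioms)
    show "comm_monoid (base_space k)" by (rule comm_monoidI) (simp_all add: A.R.m_ac)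
  qed (simp add: A.R.l_distr)
  then show ?thesis
    by (intro algebraI) (simp_all add: k_cring A.R.l_distr A.R.r_distr A.R.m_assoc)
qed

lemma structure_map: "(\<lambda>c\<in>carrier k. c \<odot>\<^bsub>A\<^esub> \<one>\<^bsub>A\<^esub>) \<in> alg_hom k (base_space k) A"
  by (rule alg_homI) (simp_all add: A.smult_l_distr A.smult_assoc1 A.smult_assoc2)

text \<open>The unit point over \<open>A\<close> comes from the unit point over \<open>k\<close> by
  the structure map, so its values are scalars.\<close>

lemma pe_scalar: 
  assumes c: "c \<in> carrier A"
  obtains d where "d \<in> carrier k" "pe A c = d \<odot>\<^bsub>A\<^esub> \<one>\<^bsub>A\<^esub>"
proof (rule that)
  show "pe (base_space k) c \<in> carrier k"
    using alg_homD(4)[OF pe_closed[OF base_space_algebra] c] by simp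
  then show "pe A c = pe (base_space k) c \<odot>\<^bsub>A\<^esub> \<one>\<^bsub>A\<^esub>"
    using fun_cong[OF cmp_pe[OF base_space_algebra A structure_map], of c] c
      by (simp add: compose_apply)
qed

text \<open>Yoneda's argument: the product of the two coprojections into the copy of A \<otimes> A
  is a universal product of points, and its value at \<open>a\<close> is a tensor \<open>z\<close>.
  Any other pair of points factors through the coproduct, and naturality of the group law carries
  the identity along.\<close>

lemma comult_exists:
  assumes a: "a \<in> carrier A"
  shows "\<exists>z. z \<in> carrier (tensor_group k (sub (carrier A)) A) \<and>
    (\<forall>S p q. algebra k S \<longrightarrow> p \<in> H S \<longrightarrow> q \<in> H S \<longrightarrow> pm S p q a = hat (carrier A) A S q p z)"
proof -
  interpret Co: coproduct k A A using A by (intro coproduct.intro alg_pair.intro)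
  let ?d = "pm Co.Co Co.inr Co.inl"
  have d: "?d \<in> H Co.Co" by (rule pm_closed[OF Co.Co_algebra Co.inr_hom Co.inl_hom])
  have "?d a \<in> carrier Co.Co" by (rule alg_homD(4)[OF d a])
  then obtain z where z: "z \<in> carrier (tensor_group k A A)" "?d a = Co.\<beta> z" by auto
  have "pm S p q a = hat (carrier A) A S q p z" if S: "algebra k S" and p: "p \<in> H S"
    and q: "q \<in> H S" for S p q
  proof -
    obtain t where t: "t \<in> alg_hom k Co.Co S" "cmp t Co.inl = q" "cmp t Co.inr = p"
      "t (Co.\<beta> z) = tlift k A A S (\<lambda>r s. q r \<otimes>\<^bsub>S\<^esub> p s) z"
      using Co.copair[OF S q p] z(1) by metis
    have "cmp t ?d = pm S p q"
      using cmp_pm[OF Co.Co_algebra S t(1) Co.inr_hom Co.inl_hom] t by simp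
    then have "pm S p q a = t (?d a)" using a by (metis compose_apply)
    then show ?thesis using z t(4) by (simp add: hat_def)
  qed
  then show ?thesis using z(1) by auto
qed

text \<open>\<open>comult a\<close> is the comultiplication with the two factors swapped, so that slicing in the left
  factor fixes the right argument of the function \<open>(p, q) \<mapsto> a (p q)\<close>.\<close>

definition comult where "comult a = (SOME z. z \<in> carrier (tensor_group k (sub (carrier A)) A) \<and>
    (\<forall>S p q. algebra k S \<longrightarrow> p \<in> H S \<longrightarrow> q \<in> H S \<longrightarrow> pm S p q a = hat (carrier A) A S q p z))"

lemma comult_closed: "a \<in> carrier A \<Longrightarrow> comult a \<in> carrier (tensor_group k (sub (carrier A)) A)"
  and pm_comult: "a \<in> carrier A \<Longrightarrow> algebra k S \<Longrightarrow> p \<in> H S \<Longrightarrow> q \<in> H S \<Longrightarrow>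
    pm S p q a = hat (carrier A) A S q p (comult a)"
  unfolding comult_def using someI_ex[OF comult_exists] by blast+

sublocale vA: vec_tensor k A "carrier A" A
  using A_vectorspace whole_submodule A.module by (rule vec_tensor.intro)

context
  fixes S :: "('u, 'u) module"
  assumes S: "algebra k S"
begin

interpretation S: algebra k S by (rule S)
interpretation Co: coproduct k A S using A S by (intro coproduct.intro alg_pair.intro)
interpretation vS: vec_tensor k A "carrier A" S using A_vectorspace whole_submodule S.module
  by (rule vec_tensor.intro)

text \<open>The contraction A \<otimes> S \<rightarrow> S, read on the copy of A \<otimes> S in the
  universe, over which points can be multiplied.\<close>

definition cslice where
  "cslice f t = vS.slice f (inv_into (carrier (tensor_group k A S)) Co.\<beta> t)"

lemma cslice_\<beta>: "z \<in> carrier (tensor_group k A S) \<Longrightarrow> cslice f (Co.\<beta> z) = vS.slice f z"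
  unfolding cslice_def using Co.\<beta>_inj by simp

lemma slice_amap': "f \<in> functionals k A \<Longrightarrow> amap Co.Z S (vS.slice f)"
  using vS.slice_amap[of f] by simp

lemma slice_pt': "f \<in> functionals k A \<Longrightarrow> c \<in> carrier A \<Longrightarrow> s \<in> carrier S \<Longrightarrow>
    vS.slice f (Co.pt c s) = f c \<odot>\<^bsub>S\<^esub> s"
  using vS.slice_pt[of f c s] by simp

lemma cslice_amap:
  assumes f: "f \<in> functionals k A" shows "amap Co.Co S (cslice f)"
proof (rule amapI)
  show "cslice f x \<in> carrier S" if "x \<in> carrier Co.Co" for x
    using that amap_closed[OF slice_amap'[OF f]] by (auto simp: cslice_\<beta>)
  show "cslice f (x \<oplus>\<^bsub>Co.Co\<^esub> y) = cslice f x \<oplus>\<^bsub>S\<^esub> cslice f y"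
    if xy: "x \<in> carrier Co.Co" "y \<in> carrier Co.Co" for x y
  proof -
    obtain u v where uv: "u \<in> carrier (tensor_group k A S)" "v \<in> carrier (tensor_group k A S)"
        "x = Co.\<beta> u" "y = Co.\<beta> v"
      using xy by auto
    then have "x \<oplus>\<^bsub>Co.Co\<^esub> y = Co.\<beta> (u \<oplus>\<^bsub>Co.Z\<^esub> v)" using amap_add[OF Co.\<beta>_amap, of u v] by simp
    then show ?thesis using uv amap_add[OF slice_amap'[OF f], of u v] by (simp add: cslice_\<beta>)
  qed
qed

lemma cslice_mult:
  assumes f: "f \<in> functionals k A" and s: "s \<in> carrier S" and t: "t \<in> carrier Co.Co"
  shows "cslice f (Co.inr s \<otimes>\<^bsub>Co.Co\<^esub> t) = s \<otimes>\<^bsub>S\<^esub> cslice f t"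
proof -
  obtain z where z: "z \<in> carrier (tensor_group k A S)" "t = Co.\<beta> z" using t by auto
  have ms: "amap S S (\<lambda>x. s \<otimes>\<^bsub>S\<^esub> x)" using s by (simp add: amap_def S.r_distr)
  have mi: "amap Co.Co Co.Co (\<lambda>x. Co.inr s \<otimes>\<^bsub>Co.Co\<^esub> x)"
    using alg_homD(4)[OF Co.inr_hom s]
      by (intro amapI) (simp_all only: Co.Co.r_distr Co.Co.m_closed)
  have "cslice f (Co.inr s \<otimes>\<^bsub>Co.Co\<^esub> Co.\<beta> z) = s \<otimes>\<^bsub>S\<^esub> cslice f (Co.\<beta> z)"
  proof (rule Co.amap_tensor_eqI[where P = S and z = z])
    show "amap Co.Z S (\<lambda>z. cslice f (Co.inr s \<otimes>\<^bsub>Co.Co\<^esub> Co.\<beta> z))"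
      by (rule amap_comp[OF amap_comp[OF Co.\<beta>_amap mi] cslice_amap[OF f]])
    show "amap Co.Z S (\<lambda>z. s \<otimes>\<^bsub>S\<^esub> cslice f (Co.\<beta> z))"
      by (rule amap_comp[OF amap_comp[OF Co.\<beta>_amap cslice_amap[OF f]] ms])
    show "cslice f (Co.inr s \<otimes>\<^bsub>Co.Co\<^esub> Co.\<beta> (Co.pt c s')) = s \<otimes>\<^bsub>S\<^esub> cslice f (Co.\<beta> (Co.pt c s'))"
      if c: "c \<in> carrier A" and s': "s' \<in> carrier S" for c s'
    proof -
      have "Co.inr s \<otimes>\<^bsub>Co.Co\<^esub> Co.\<beta> (Co.pt c s') = Co.\<beta> (Co.pt c (s \<otimes>\<^bsub>S\<^esub> s'))"
        using c s s' by (simp add: Co.inr_def Co.tr.transport_mult Co.tensor_mult_pt)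
      then show ?thesis
        using c s s' vS.functionalD(1)[OF f c]
          by (simp add: cslice_\<beta> slice_pt' f S.smult_assoc2_right)
    qed
  qed (use z in simp)
  then show ?thesis using z by simp
qed

text \<open>With the universal point \<open>inl\<close> in the left factor, contraction by
  \<open>f\<close> commutes with specialising the right factor at \<open>g\<close>.\<close>

lemma cslice_hat:
  assumes f: "f \<in> functionals k A" and g: "g \<in> H S"
    and z: "z \<in> carrier (tensor_group k (sub (carrier A)) A)"
  shows "cslice f (hat (carrier A) A Co.Co Co.inl (cmp Co.inr g) z) = g (vA.slice f z)"
proof -
  note h = hat_amap[OF whole_submodule A Co.Co_algebra Co.inl_hom cmp_closed[OF Co.inr_hom g]]
    and hp = hat_pt[OF whole_submodule A Co.Co_algebra Co.inl_hom cmp_closed[OF Co.inr_hom g]]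
  show ?thesis
  proof (rule vA.amap_tensor_eqI[where P = S and z = z])
    show "amap vA.Z S (\<lambda>z. cslice f (hat (carrier A) A Co.Co Co.inl (cmp Co.inr g) z))"
      by (rule amap_comp[OF h cslice_amap[OF f]])
    show "amap vA.Z S (\<lambda>z. g (vA.slice f z))"
      by (rule amap_comp[OF vA.slice_amap[OF f] module_hom_amap[OF alg_homD(2)[OF g]]])
    show "cslice f (hat (carrier A) A Co.Co Co.inl (cmp Co.inr g) (vA.pt c b))
        = g (vA.slice f (vA.pt c b))"
      if "c \<in> carrier (sub (carrier A))" and b: "b \<in> carrier A" for c b
    proof -
      have c: "c \<in> carrier A" using that by simp
      show ?thesis
        using c b alg_homD[OF g] vS.functionalD(1)[OF f c]
        by (simp only: hp vA.slice_pt[OF f] compose_apply Co.\<beta>_pt[symmetric] cslice_\<beta> Co.pt_closed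
            slice_pt'[OF f])
    qed
  qed (use z in simp)
qed

text \<open>With \<Sum> c\<otimes>b for \<open>comult a\<close> and \<open>u\<close> the universal
  point \<open>inl\<close>, the value of \<open>a\<close> at the triple product p q u is contracted
  in \<open>u\<close> by \<open>f\<close>, in both bracketings. From (p q) u comes the slice of
  \<open>comult a\<close>, evaluated at p q. From p (q u) comes \<Sum> b(p) times the slice of
  \<open>comult c\<close> evaluated at q. Translates of a slice of \<open>comult a\<close> thus stay
  in every subspace that contains the right factors \<open>b\<close>.\<close>

lemma coassociativity:
  assumes f: "f \<in> functionals k A" and p: "p \<in> H S" and q: "q \<in> H S" and a: "a \<in> carrier A"
    and V: "submodule k V A"
    and zs: "set zs \<subseteq> carrier A \<times> V" and az: "comult a = vA.tsum zs"
  shows "pm S p q (vA.slice f (comult a))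
    = hat V A S p q (vec_tensor.tsum k A V A (map (\<lambda>(c, b). (b, vA.slice f (comult c))) zs))"
proof -
  interpret vV: vec_tensor k A V A using A_vectorspace V A.module by (rule vec_tensor.intro)
  \<comment> \<open>The points \<open>p\<close> and \<open>q\<close> are carried from
    \<open>S\<close> to the coproduct of \<open>A\<close> and \<open>S\<close>, where
    \<open>inl\<close> is available as a third point.\<close>
  let ?x = "cmp Co.inr p" and ?y = "cmp Co.inr q"
  have x: "?x \<in> H Co.Co" and y: "?y \<in> H Co.Co" using cmp_closed[OF Co.inr_hom] p q by blast+
  have yr: "pm Co.Co ?y Co.inl \<in> H Co.Co" by (rule pm_closed[OF Co.Co_algebra y Co.inl_hom])
  have xy: "pm Co.Co ?x ?y = cmp Co.inr (pm S p q)"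
    using cmp_pm[OF S Co.Co_algebra Co.inr_hom p q] by simp
  let ?W = "hat (carrier A) A Co.Co (pm Co.Co ?y Co.inl) ?x"
  note W = hat_amap[OF whole_submodule A Co.Co_algebra yr x]
    and Wp = hat_pt[OF whole_submodule A Co.Co_algebra yr x]
  note U = hat_amap[OF V A S p q] and Up = hat_pt[OF V A S p q]
  have slc: "vA.slice f (comult c) \<in> carrier A" if "c \<in> carrier A" for c
    using amap_closed[OF vA.slice_amap[OF f]] comult_closed[OF that] by simp
  have key: "cslice f (?W (vA.tsum zs))
      = hat V A S p q (vV.tsum (map (\<lambda>(c, b). (b, vA.slice f (comult c))) zs))"
    if "set zs \<subseteq> carrier A \<times> V" for zs
    using that
  proof (induction zs)
    case Nil
    have "?W (vA.tsum []) = \<zero>\<^bsub>Co.Co\<^esub>"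
      using amap_zero[OF vA.tensor_abelian_group Co.Co.M.abelian_group_axioms W] by simp
    moreover have "cslice f \<zero>\<^bsub>Co.Co\<^esub> = \<zero>\<^bsub>S\<^esub>"
      using amap_zero[OF Co.Co.M.abelian_group_axioms S.M.abelian_group_axioms cslice_amap[OF f]] .
    moreover have "hat V A S p q (vV.tsum []) = \<zero>\<^bsub>S\<^esub>"
      using amap_zero[OF vV.tensor_abelian_group S.M.abelian_group_axioms U] by simp
    ultimately show ?case by simp
  next
    case (Cons cb zs)
    obtain c b where cb: "cb = (c, b)" by (cases cb)
    have c: "c \<in> carrier A" and b: "b \<in> V" and bA: "b \<in> carrier A" and zs: "set zs \<subseteq> carrier A \<times> V"
      using Cons.prems cb vV.V_in by auto
    have zsA: "set zs \<subseteq> carrier A \<times> carrier A" using zs vV.V_in by auto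
    have t1: "vA.tsum zs \<in> carrier vA.Z" using vA.tsum_closed[OF zsA] by simp
    have t2: "vA.pt c b \<in> carrier vA.Z" using c bA by simp
    have t3: "set (map (\<lambda>(c, b). (b, vA.slice f (comult c))) zs) \<subseteq> V \<times> carrier A" using zs slc
      by auto
    have pb: "p b \<in> carrier S" using alg_homD(4)[OF p bA] .
    have yc: "pm Co.Co ?y Co.inl c \<in> carrier Co.Co" by (rule alg_homD(4)[OF yr c])
    have "?W (vA.pt c b) = Co.inr (p b) \<otimes>\<^bsub>Co.Co\<^esub> pm Co.Co ?y Co.inl c"
      using c bA yc alg_homD(4)[OF Co.inr_hom pb]
      by (simp only: Wp compose_apply Co.Co.m_comm)
    then have "cslice f (?W (vA.pt c b)) = p b \<otimes>\<^bsub>S\<^esub> cslice f (pm Co.Co ?y Co.inl c)"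
      using cslice_mult[OF f pb yc] by simp
    also have "cslice f (pm Co.Co ?y Co.inl c) = q (vA.slice f (comult c))"
      using pm_comult[OF c Co.Co_algebra y Co.inl_hom] cslice_hat[OF f q comult_closed[OF c]]
        by simp
    finally have e: "cslice f (?W (vA.pt c b)) = hat V A S p q (vV.pt b (vA.slice f (comult c)))"
      using Up[OF b slc[OF c]] by simp
    have "cslice f (?W (vA.pt c b \<oplus>\<^bsub>vA.Z\<^esub> vA.tsum zs))
        = cslice f (?W (vA.pt c b)) \<oplus>\<^bsub>S\<^esub> cslice f (?W (vA.tsum zs))"
      by (rule amap_add[OF amap_comp[OF W cslice_amap[OF f]] t2 t1])
    then show ?case
      using cb Cons.IH[OF zs] e amap_add[OF U, of "vV.pt b (vA.slice f (comult c))"]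
          vV.tsum_closed[OF t3] slc[OF c] b
      by simp
  qed
  have "pm S p q (vA.slice f (comult a))
      = cslice f (hat (carrier A) A Co.Co Co.inl (cmp Co.inr (pm S p q)) (comult a))"
    by (rule cslice_hat[OF f pm_closed[OF S p q] comult_closed[OF a], symmetric])
  also have "\<dots> = cslice f (pm Co.Co (pm Co.Co ?x ?y) Co.inl a)"
    using pm_comult[OF a Co.Co_algebra pm_closed[OF Co.Co_algebra x y] Co.inl_hom] xy by simp
  also have "\<dots> = cslice f (?W (vA.tsum zs))"
    using pm_assoc[OF Co.Co_algebra x y Co.inl_hom] pm_comult[OF a Co.Co_algebra x yr] az by simp
  also have "\<dots> = hat V A S p q (vV.tsum (map (\<lambda>(c, b). (b, vA.slice f (comult c))) zs))"
    by (rule key[OF zs])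
  finally show ?thesis .
qed

end

text \<open>The coaction in terms of points: with \<Sum> v'\<otimes>a' for \<open>z\<close>, it says
  v(p q) = \<Sum> v'(p) a'(q), so that all right translates of \<open>v\<close> stay in
  \<open>V\<close>.\<close>

definition orbit where
  "orbit V v z \<longleftrightarrow> z \<in> carrier (tensor_group k (sub V) A) \<and>
    (\<forall>S p q. algebra k S \<longrightarrow> p \<in> H S \<longrightarrow> q \<in> H S \<longrightarrow> pm S p q v = hat V A S p q z)"

text \<open>These are the finite-dimensional subspaces of functions closed under right translation.
  Finite generation is phrased as in \<open>fin_dim_iff\<close>, but against submodules of
  \<open>A\<close>.\<close>

definition stable where
  "stable V \<longleftrightarrow> submodule k V A \<and> (\<exists>B. finite B \<and> B \<subseteq> V \<and> (\<forall>U. submodule k U A \<longrightarrow> B \<subseteq> U \<longrightarrow> V \<subseteq> U)) \<and>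
    (\<forall>v\<in>V. \<exists>z. orbit V v z)"

lemma stable_submodule: "stable V \<Longrightarrow> submodule k V A"
  by (simp add: stable_def)

lemma orbit_submodule:
  assumes V: "submodule k V A"
  shows "submodule k {v \<in> V. \<exists>z. orbit V v z} A"
proof -
  interpret V: submodule k V A by fact
  interpret E: ext_scal k "sub V" A using sub_module[OF V] A by (rule ext_scal.intro)
  have Vc: "v \<in> V \<Longrightarrow> v \<in> carrier A" for v using V.subset by blast
  show ?thesis
  proof (rule submodule.intro[OF A.module])
    show "{v \<in> V. \<exists>z. orbit V v z} \<subseteq> carrier A" using Vc by blast
    have "orbit V \<zero>\<^bsub>A\<^esub> \<zero>\<^bsub>E.Z\<^esub>"
      unfolding orbit_def
    proof (intro conjI allI impI)
      fix S p q assume S: "algebra k S" and p: "p \<in> H S" and q: "q \<in> H S"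
      have Sab: "abelian_group S" using algebra.module[OF S] module_trans by blast
      show "pm S p q \<zero>\<^bsub>A\<^esub> = hat V A S p q \<zero>\<^bsub>E.Z\<^esub>"
        using amap_zero[OF A.M.abelian_group_axioms Sab
            module_hom_amap[OF alg_homD(2)[OF pm_closed[OF S p q]]]]
          amap_zero[OF E.tensor_abelian_group Sab hat_amap[OF V A S p q]] by simp
    qed simp
    then show "\<zero>\<^bsub>A\<^esub> \<in> {v \<in> V. \<exists>z. orbit V v z}" by auto
    show "v \<oplus>\<^bsub>A\<^esub> w \<in> {v \<in> V. \<exists>z. orbit V v z}"
      if vw: "v \<in> {v \<in> V. \<exists>z. orbit V v z}" "w \<in> {v \<in> V. \<exists>z. orbit V v z}" for v w
    proof -
      obtain x y where xy: "orbit V v x" "orbit V w y" and V': "v \<in> V" "w \<in> V" using vw by blast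
      have "orbit V (v \<oplus>\<^bsub>A\<^esub> w) (x \<oplus>\<^bsub>E.Z\<^esub> y)"
        using xy Vc V' alg_homD(5)[OF pm_closed] amap_add[OF hat_amap[OF V A]]
        by (simp add: orbit_def)
      then show ?thesis using V' by auto
    qed
    show "c \<odot>\<^bsub>A\<^esub> v \<in> {v \<in> V. \<exists>z. orbit V v z}"
      if c: "c \<in> carrier k" and v: "v \<in> {v \<in> V. \<exists>z. orbit V v z}" for c v
    proof -
      obtain x where x: "orbit V v x" and V': "v \<in> V" using v by blast
      \<comment> \<open>V \<otimes> A is a module over \<open>A\<close> by its right factor, so the
        scalar enters as its image in \<open>A\<close>; every point sends that image to the image in
        \<open>S\<close>.\<close>
      let ?c = "c \<odot>\<^bsub>A\<^esub> \<one>\<^bsub>A\<^esub>"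
      have "orbit V (c \<odot>\<^bsub>A\<^esub> v) (?c \<odot>\<^bsub>E.E\<^esub> x)"
        unfolding orbit_def
      proof (intro conjI allI impI)
        show "?c \<odot>\<^bsub>E.E\<^esub> x \<in> carrier (tensor_group k (sub V) A)"
          using amap_closed[OF E.esmult_amap, of ?c x] x c by (simp add: orbit_def)
        fix S p q assume S: "algebra k S" and p: "p \<in> H S" and q: "q \<in> H S"
        interpret S: algebra k S by (rule S)
        have xc: "hat V A S p q x \<in> carrier S" using hat_closed[OF V A S p q] x
          by (simp add: orbit_def)
        have "hat V A S p q (?c \<odot>\<^bsub>E.E\<^esub> x) = q ?c \<otimes>\<^bsub>S\<^esub> hat V A S p q x"
          using x c by (intro hat_smult[OF V A S p q]) (simp_all add: orbit_def)
        also have "\<dots> = c \<odot>\<^bsub>S\<^esub> hat V A S p q x"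
          using c xc alg_homD[OF q] by (simp add: S.smult_assoc2)
        finally show "pm S p q (c \<odot>\<^bsub>A\<^esub> v) = hat V A S p q (?c \<odot>\<^bsub>E.E\<^esub> x)"
          using x S p q c alg_homD(8)[OF pm_closed[OF S p q] c Vc[OF V']] by (simp add: orbit_def)
      qed
      then show ?thesis using V' c by auto
    qed
  qed
qed

lemma orbit_mono:
  assumes "submodule k V A" "submodule k W A" "V \<subseteq> W" "orbit V v z"
  shows "\<exists>z. orbit W v z"
proof -
  have z: "z \<in> carrier (tensor_group k (sub V) A)" using assms(4) by (simp add: orbit_def)
  show ?thesis
    using assms(4) hat_incl(1)[OF assms(1,2,3) A _ _ _ z]
      hat_incl(2)[OF assms(1,2,3) A A alg_hom_id[OF A] alg_hom_id[OF A] z]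
    by (intro exI[of _ "tensor_map k (sub V) A (sub W) A (\<lambda>v. v) (\<lambda>r. r) z"]) (simp add: orbit_def)
qed

lemma stable_span:
  assumes B: "finite B" "B \<subseteq> carrier A" and orb: "\<And>b. b \<in> B \<Longrightarrow> \<exists>z. orbit (A.span B) b z"
  shows "stable (A.span B)"
proof -
  have V: "submodule k (A.span B) A" by (rule A.span_is_submodule[OF B(2)])
  have sub: "A.span B \<subseteq> U" if "submodule k U A" "B \<subseteq> U" for U
    by (rule A.span_is_subset[OF that(2,1)])
  have "A.span B \<subseteq> {v \<in> A.span B. \<exists>z. orbit (A.span B) v z}"
    using orb A.in_own_span[OF B(2)] by (intro sub[OF orbit_submodule[OF V]]) auto
  then show ?thesis
    unfolding stable_def using V B(1) A.in_own_span[OF B(2)] sub by blast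
qed

text \<open>\<open>V\<close> is spanned by the right factors of a minimal expression of
  \<open>comult a\<close>. Minimality makes each of them a slice of \<open>comult a\<close>, and
  \<open>coassociativity\<close> then provides its orbit.\<close>

lemma stable_exists:
  assumes a: "a \<in> carrier A"
  obtains V where "stable V" "a \<in> V"
proof -
  obtain zs where zs: "set zs \<subseteq> carrier A \<times> carrier A" "comult a = vA.tsum zs"
    and sl: "\<And>c b. (c, b) \<in> set zs \<Longrightarrow> \<exists>f\<in>functionals k A. vA.slice f (comult a) = b"
    using vA.minimal_expression[OF comult_closed[OF a]] by metis
  define B where "B = snd ` set zs"
  let ?V = "A.span B"
  have B: "finite B" "B \<subseteq> carrier A" using zs by (auto simp: B_def)
  have V: "submodule k ?V A" by (rule A.span_is_submodule[OF B(2)])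
  interpret V: submodule k ?V A by (rule V)
  interpret vV: vec_tensor k A ?V A using A_vectorspace V A.module by (rule vec_tensor.intro)
  have zsV: "set zs \<subseteq> carrier A \<times> ?V" using zs A.in_own_span[OF B(2)] by (force simp: B_def)
  have "stable ?V"
  proof (rule stable_span[OF B])
    fix b assume "b \<in> B"
    then obtain c where "(c, b) \<in> set zs" by (auto simp: B_def)
    then obtain f where f: "f \<in> functionals k A" "vA.slice f (comult a) = b" using sl by blast
    let ?ws = "map (\<lambda>(c, b). (b, vA.slice f (comult c))) zs"
    have "vA.slice f (comult c) \<in> carrier A" if "c \<in> carrier A" for c
      using amap_closed[OF vA.slice_amap[OF f(1)]] comult_closed[OF that] by simp
    then have "set ?ws \<subseteq> ?V \<times> carrier A" using zsV by auto
    then have "vV.tsum ?ws \<in> carrier (tensor_group k (sub ?V) A)" by (rule vV.tsum_closed)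
    then have "orbit ?V b (vV.tsum ?ws)"
      using coassociativity[OF _ f(1) _ _ a V zsV zs(2)] f(2) by (simp add: orbit_def)
    then show "\<exists>z. orbit ?V b z" by blast
  qed
  \<comment> \<open>Evaluating the left factors at the unit point recovers \<open>a\<close> from
    \<open>comult a\<close>. Their values are scalars by \<open>pe_scalar\<close>, so
    \<open>a\<close> is a linear combination of the right factors.\<close>
  moreover have "a \<in> ?V"
  proof -
    define idA where "idA = (\<lambda>r\<in>carrier A. r)"
    have id: "idA \<in> H A" unfolding idA_def by (rule alg_hom_id[OF A])
    have id_eq: "idA r = r" if "r \<in> carrier A" for r using that by (simp add: idA_def)
    have pe: "pe A \<in> H A" by (rule pe_closed[OF A])
    note h = hat_amap[OF whole_submodule A A pe id] and hp = hat_pt[OF whole_submodule A A pe id]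
    have "hat (carrier A) A A (pe A) idA (vA.tsum zs) \<in> ?V" if "set zs \<subseteq> carrier A \<times> ?V" for zs
      using that
    proof (induction zs)
      case Nil
      then show ?case using amap_zero[OF vA.tensor_abelian_group A.M.abelian_group_axioms h] by simp
    next
      case (Cons cb zs)
      obtain c b where cb: "cb = (c, b)" by (cases cb)
      have c: "c \<in> carrier A" and b: "b \<in> ?V" "b \<in> carrier A" and zs: "set zs \<subseteq> carrier A \<times> ?V"
        using Cons.prems cb vV.V_in by auto
      have zsA: "set zs \<subseteq> carrier A \<times> carrier A" using zs vV.V_in by auto
      obtain d where d: "d \<in> carrier k" "pe A c = d \<odot>\<^bsub>A\<^esub> \<one>\<^bsub>A\<^esub>" using pe_scalar[OF c] by blast
      have "hat (carrier A) A A (pe A) idA (vA.pt c b) = d \<odot>\<^bsub>A\<^esub> b"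
        using hp[OF c b(2)] d b by (simp add: id_eq A.smult_assoc2)
      then have "hat (carrier A) A A (pe A) idA (vA.pt c b) \<in> ?V" using d b V.smult_closed by simp
      moreover have "hat (carrier A) A A (pe A) idA (vA.pt c b \<oplus>\<^bsub>vA.Z\<^esub> vA.tsum zs)
          = hat (carrier A) A A (pe A) idA (vA.pt c b) \<oplus>\<^bsub>A\<^esub> hat (carrier A) A A (pe A) idA
              (vA.tsum zs)"
        by (rule amap_add[OF h]) (use c b vA.tsum_closed[OF zsA] vA.pt_closed[of c b] in simp_all)
      ultimately show ?case using Cons.IH[OF zs] cb V.m_closed by simp
    qed
    note this[OF zsV]
    moreover have "hat (carrier A) A A (pe A) idA (comult a) = a"
      using pm_comult[OF a A id pe] pm_pe(1)[OF A id] a by (simp add: id_eq)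
    ultimately show ?thesis using zs(2) by simp
  qed
  ultimately show thesis by (rule that)
qed

text \<open>Stable subspaces are directed; this allows \<open>lambda\<close> to be glued from its
  restrictions to them.\<close>

lemma stable_sum:
  assumes V: "stable V" and W: "stable W"
  obtains U where "stable U" "V \<subseteq> U" "W \<subseteq> U"
proof -
  obtain B where B: "finite B" "B \<subseteq> V" "\<And>U. submodule k U A \<Longrightarrow> B \<subseteq> U \<Longrightarrow> V \<subseteq> U"
    using V unfolding stable_def by blast
  obtain C where C: "finite C" "C \<subseteq> W" "\<And>U. submodule k U A \<Longrightarrow> C \<subseteq> U \<Longrightarrow> W \<subseteq> U"
    using W unfolding stable_def by blast
  have Vc: "V \<subseteq> carrier A" and Wc: "W \<subseteq> carrier A"
    using V W by (auto simp: stable_def submodule_def)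
  have BC: "B \<union> C \<subseteq> carrier A" "finite (B \<union> C)" using B C Vc Wc by auto
  let ?U = "A.span (B \<union> C)"
  have U: "submodule k ?U A" by (rule A.span_is_submodule[OF BC(1)])
  have VU: "V \<subseteq> ?U" and WU: "W \<subseteq> ?U"
    using B(3)[OF U] C(3)[OF U] A.in_own_span[OF BC(1)] by auto
  have "\<exists>z. orbit ?U b z" if "b \<in> B \<union> C" for b
  proof -
    have "(\<exists>z. orbit V b z) \<or> (\<exists>z. orbit W b z)" using that V W B(2) C(2) by (auto simp: stable_def)
    then show ?thesis
      using orbit_mono[OF stable_submodule[OF V] U VU] orbit_mono[OF stable_submodule[OF W] U WU]
        by blast
  qed
  then have "stable ?U" by (rule stable_span[OF BC(2,1)])
  then show thesis using that VU WU by blast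
qed

lemma stable_finite:
  assumes "finite F" "F \<subseteq> carrier A"
  shows "\<exists>V. stable V \<and> F \<subseteq> V"
  using assms
proof (induction F rule: finite_induct)
  case empty
  then show ?case using stable_exists[OF A.one_closed] by blast
next
  case (insert a F)
  then obtain V where V: "stable V" "F \<subseteq> V" by auto
  obtain W where W: "stable W" "a \<in> W" using stable_exists[of a] insert.prems by auto
  obtain U where "stable U" "V \<subseteq> U" "W \<subseteq> U" by (rule stable_sum[OF V(1) W(1)])
  then show ?case using V W by blast
qed

end

section \<open>Regular subrepresentations\<close>

lemma compose_restrict_id: "compose (carrier A) (\<lambda>r\<in>carrier R. r) p = p" if "p \<in> alg_hom k A R"
proof
  show "compose (carrier A) (\<lambda>r\<in>carrier R. r) p x = p x" for x
    using alg_homD(3,4)[OF that] by (cases "x \<in> carrier A") (auto simp: compose_def extensional_def)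
qed

context affine
begin

text \<open>Right translation, (g v)(h) = v(h g), with coefficients in \<open>R\<close>. The values
  at all points single out one tensor \<open>y\<close>: it is unique by \<open>hat_eqI\<close> and
  exists by \<open>reg_act_exists\<close> when \<open>V\<close> is stable.\<close>

definition reg :: "'u set \<Rightarrow> ('u, 'u, 'g) rep" where
  "reg V = \<lparr>space = sub V, act = (\<lambda>R g. \<lambda>z\<in>carrier (tensor_group k (sub V) R).
     SOME y. y \<in> carrier (tensor_group k (sub V) R) \<and>
       (\<forall>S h f. algebra k S \<longrightarrow> h \<in> H S \<longrightarrow> f \<in> alg_hom k R S \<longrightarrow>
          hat V R S h f y = hat V R S (pm S h (cmp f (gi R g))) f z))\<rparr>"

lemma reg_space [simp]: "space (reg V) = sub V"
  by (simp add: reg_def)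

text \<open>For v \<otimes> r, the orbit tensor of \<open>v\<close> has its right factor specialised
  at \<open>g\<close> and is multiplied by \<open>r\<close>. Sums follow by additivity.\<close>

lemma reg_act_exists:
  assumes V: "stable V" and R: "algebra k R" and g: "g \<in> carrier (fob G R)"
    and z: "z \<in> carrier (tensor_group k (sub V) R)"
  shows "\<exists>y. y \<in> carrier (tensor_group k (sub V) R) \<and>
       (\<forall>S h f. algebra k S \<longrightarrow> h \<in> H S \<longrightarrow> f \<in> alg_hom k R S \<longrightarrow>
          hat V R S h f y = hat V R S (pm S h (cmp f (gi R g))) f z)"
proof -
  note V' = stable_submodule[OF V]
  have gg: "gi R g \<in> H R" by (rule gi_closed[OF R g])
  interpret E: ext_scal k "sub V" R using sub_module[OF V'] R by (rule ext_scal.intro)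
  interpret B: base_chg k "sub V" A R "gi R g" using sub_module[OF V'] A R gg
    by (rule base_chg.intro)
  have fg: "cmp f (gi R g) \<in> H S" if "f \<in> alg_hom k R S" for S f by (rule cmp_closed[OF that gg])
  have hg: "pm S h (cmp f (gi R g)) \<in> H S" if "algebra k S" "h \<in> H S" "f \<in> alg_hom k R S" for S h f
    by (rule pm_closed[OF that(1,2) fg[OF that(3)]])
  show ?thesis
    using z
  proof (induction z rule: E.tensor_induct)
    case (pure v r)
    then obtain w where w: "orbit V v w" using V by (auto simp: stable_def)
    then have wc: "w \<in> carrier (tensor_group k (sub V) A)" by (simp add: orbit_def)
    have Bw: "B.Vf w \<in> carrier (tensor_group k (sub V) R)" by (rule B.Vf_closed[OF wc])
    have "hat V R S h f (r \<odot>\<^bsub>E.E\<^esub> B.Vf w) = hat V R S (pm S h (cmp f (gi R g))) f (E.pt v r)"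
      if S: "algebra k S" and h: "h \<in> H S" and f: "f \<in> alg_hom k R S" for S h f
    proof -
      interpret S: algebra k S by fact
      have vA: "v \<in> carrier A" using pure(1) V' by (auto simp: submodule_def)
      have "hat V R S h f (r \<odot>\<^bsub>E.E\<^esub> B.Vf w) = f r \<otimes>\<^bsub>S\<^esub> hat V A S h (cmp f (gi R g)) w"
        using hat_smult[OF V' R S h f pure(2) Bw] hat_base_change[OF V' A R S h gg f wc] by simp
      also have "hat V A S h (cmp f (gi R g)) w = pm S h (cmp f (gi R g)) v"
        using w S h fg[OF f] by (simp add: orbit_def)
      finally show ?thesis
        using hat_pt[OF V' R S hg[OF S h f] f, of v r] pure alg_homD(4)[OF f pure(2)]
            alg_homD(4)[OF hg[OF S h f] vA]
        by (simp add: S.m_comm)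
    qed
    then show ?case
      using amap_closed[OF E.esmult_amap[OF pure(2)], of "B.Vf w"] Bw by auto
  next
    case (add x y)
    then obtain x' y' where x': "x' \<in> carrier (tensor_group k (sub V) R)"
        "\<And>S h f. algebra k S \<Longrightarrow> h \<in> H S \<Longrightarrow> f \<in> alg_hom k R S \<Longrightarrow>
          hat V R S h f x' = hat V R S (pm S h (cmp f (gi R g))) f x"
      and y': "y' \<in> carrier (tensor_group k (sub V) R)"
        "\<And>S h f. algebra k S \<Longrightarrow> h \<in> H S \<Longrightarrow> f \<in> alg_hom k R S \<Longrightarrow>
          hat V R S h f y' = hat V R S (pm S h (cmp f (gi R g))) f y" by blast
    have "hat V R S h f (x' \<oplus>\<^bsub>E.Z\<^esub> y') = hat V R S (pm S h (cmp f (gi R g))) f (x \<oplus>\<^bsub>E.Z\<^esub> y)"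
      if S: "algebra k S" and h: "h \<in> H S" and f: "f \<in> alg_hom k R S" for S h f
      using x'(1) y'(1) add(1,2) x'(2)[OF that] y'(2)[OF that]
        amap_add[OF hat_amap[OF V' R S h f], of x' y']
            amap_add[OF hat_amap[OF V' R S hg[OF that] f], of x y]
      by simp
    then show ?case using x'(1) y'(1) by (intro exI[of _ "x' \<oplus>\<^bsub>E.Z\<^esub> y'"]) simp
  qed
qed

context
  fixes V R g
  assumes V: "stable V" and R: "algebra k R" and g: "g \<in> carrier (fob G R)"
begin

lemma reg_act_props:
  assumes z: "z \<in> carrier (tensor_group k (sub V) R)"
  shows reg_act_closed: "act (reg V) R g z \<in> carrier (tensor_group k (sub V) R)"
    and hat_reg_act: "\<And>S h f. algebra k S \<Longrightarrow> h \<in> H S \<Longrightarrow> f \<in> alg_hom k R S \<Longrightarrow>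
      hat V R S h f (act (reg V) R g z) = hat V R S (pm S h (cmp f (gi R g))) f z"
  using someI_ex[OF reg_act_exists[OF V R g z]] z by (simp_all add: reg_def)

lemma reg_act_eqI:
  assumes z: "z \<in> carrier (tensor_group k (sub V) R)"
    and y: "y \<in> carrier (tensor_group k (sub V) R)"
    and "\<And>S h f. algebra k S \<Longrightarrow> h \<in> H S \<Longrightarrow> f \<in> alg_hom k R S \<Longrightarrow>
      hat V R S h f y = hat V R S (pm S h (cmp f (gi R g))) f z"
  shows "act (reg V) R g z = y"
  by (rule hat_eqI[OF stable_submodule[OF V] R reg_act_closed[OF z] y])
    (simp add: hat_reg_act[OF z] assms(3))

end

text \<open>Compared through values, composition of actions becomes associativity of
  \<open>pm\<close>, the identity law becomes \<open>pm_pe\<close>, and naturality becomes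
  \<open>gi_mor\<close>.\<close>

lemma reg_Rep:
  assumes V: "stable V"
  shows "reg V \<in> Rep k G"
proof -
  note V' = stable_submodule[OF V]
  have vs: "vectorspace k (sub V)" using sub_module[OF V'] k by (simp add: vectorspace_def)
  have "representation k G (reg V)"
  proof (rule representationI)
    show "vectorspace k (space (reg V))" using vs by simp
  next
    fix R :: "('u, 'u) module" and g assume R: "algebra k R" and g: "g \<in> carrier (fob G R)"
    interpret E: ext_scal k "sub V" R using sub_module[OF V'] R by (rule ext_scal.intro)
    note c = reg_act_closed[OF V R g] and ht = hat_reg_act[OF V R g]
    have hg: "pm S h (cmp f (gi R g)) \<in> H S" if "algebra k S" "h \<in> H S" "f \<in> alg_hom k R S"
      for S h f
      by (rule pm_closed[OF that(1,2) cmp_closed[OF that(3) gi_closed[OF R g]]])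
    have "act (reg V) R g (x \<oplus>\<^bsub>E.Z\<^esub> y) = act (reg V) R g x \<oplus>\<^bsub>E.Z\<^esub> act (reg V) R g y"
      if xy: "x \<in> carrier (tensor_group k (sub V) R)" "y \<in> carrier (tensor_group k (sub V) R)"
        for x y
    proof (rule reg_act_eqI[OF V R g])
      fix S h f assume S: "algebra k S" and h: "h \<in> H S" and f: "f \<in> alg_hom k R S"
      show "hat V R S h f (act (reg V) R g x \<oplus>\<^bsub>E.Z\<^esub> act (reg V) R g y)
          = hat V R S (pm S h (cmp f (gi R g))) f (x \<oplus>\<^bsub>E.Z\<^esub> y)"
        using amap_add[OF hat_amap[OF V' R S h f], of "act (reg V) R g x" "act (reg V) R g y"]
          amap_add[OF hat_amap[OF V' R S hg[OF S h f] f], of x y] xy c ht[OF xy(1) S h f]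
              ht[OF xy(2) S h f]
        by simp
    qed (use xy c in auto)
    moreover have "act (reg V) R g (r \<odot>\<^bsub>E.E\<^esub> x) = r \<odot>\<^bsub>E.E\<^esub> act (reg V) R g x"
      if r: "r \<in> carrier R" and x: "x \<in> carrier (tensor_group k (sub V) R)" for r x
    proof (rule reg_act_eqI[OF V R g])
      have cl: "r \<odot>\<^bsub>E.E\<^esub> y \<in> carrier (tensor_group k (sub V) R)"
        if "y \<in> carrier (tensor_group k (sub V) R)" for y
        using amap_closed[OF E.esmult_amap[OF r]] that by simp
      show "r \<odot>\<^bsub>E.E\<^esub> x \<in> carrier (tensor_group k (sub V) R)"
        "r \<odot>\<^bsub>E.E\<^esub> act (reg V) R g x \<in> carrier (tensor_group k (sub V) R)"
        by (rule cl[OF x], rule cl[OF c[OF x]])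
      fix S h f assume S: "algebra k S" and h: "h \<in> H S" and f: "f \<in> alg_hom k R S"
      show "hat V R S h f (r \<odot>\<^bsub>E.E\<^esub> act (reg V) R g x)
          = hat V R S (pm S h (cmp f (gi R g))) f (r \<odot>\<^bsub>E.E\<^esub> x)"
        by (simp add: hat_smult[OF V' R S h f r c[OF x]] hat_smult[OF V' R S hg[OF S h f] f r x]
            ht[OF x S h f])
    qed
    ultimately show "act (reg V) R g \<in> module_hom R (ext_scalars k (space (reg V)) R)
        (ext_scalars k (space (reg V)) R)"
      using c by (simp add: module_hom_def)
    show "act (reg V) R g \<in> extensional (carrier (tensor_group k (space (reg V)) R))"
      by (simp add: reg_def)
  next
    fix R :: "('u, 'u) module" and g g' z
    assume R: "algebra k R" and g: "g \<in> carrier (fob G R)" and g': "g' \<in> carrier (fob G R)"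
      and "z \<in> carrier (tensor_group k (space (reg V)) R)"
    then have z: "z \<in> carrier (tensor_group k (sub V) R)" by simp
    interpret GR: group "fob G R" by (rule G_group[OF R])
    note c' = reg_act_closed[OF V R g' z]
    show "act (reg V) R (g \<otimes>\<^bsub>fob G R\<^esub> g') z = act (reg V) R g (act (reg V) R g' z)"
    proof (rule reg_act_eqI[OF V R GR.m_closed[OF g g'] z reg_act_closed[OF V R g c']])
      fix S h f assume S: "algebra k S" and h: "h \<in> H S" and f: "f \<in> alg_hom k R S"
      note gg = gi_closed[OF R g] gi_closed[OF R g']
      note fg = cmp_closed[OF f gg(1)] cmp_closed[OF f gg(2)]
      show "hat V R S h f (act (reg V) R g (act (reg V) R g' z))
          = hat V R S (pm S h (cmp f (gi R (g \<otimes>\<^bsub>fob G R\<^esub> g')))) f z"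
        by (simp add: hat_reg_act[OF V R g c' S h f]
            hat_reg_act[OF V R g' z S pm_closed[OF S h fg(1)] f]
            gi_mult[OF R g g'] cmp_pm[OF R S f gg] pm_assoc[OF S h fg])
    qed
  next
    fix R :: "('u, 'u) module" and z
    assume R: "algebra k R" and "z \<in> carrier (tensor_group k (space (reg V)) R)"
    then have z: "z \<in> carrier (tensor_group k (sub V) R)" by simp
    interpret GR: group "fob G R" by (rule G_group[OF R])
    show "act (reg V) R \<one>\<^bsub>fob G R\<^esub> z = z"
      by (rule reg_act_eqI[OF V R GR.one_closed z z])
        (simp add: pe_def[symmetric] cmp_pe[OF R] pm_pe)
  next
    fix R S :: "('u, 'u) module" and F g v
    assume R: "algebra k R" and S: "algebra k S" and F: "F \<in> alg_hom k R S"
      and g: "g \<in> carrier (fob G R)"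
      and "v \<in> carrier (space (reg V))"
    then have v: "v \<in> V" by simp
    have vA: "v \<in> carrier A" using v V' by (auto simp: submodule_def)
    interpret B: base_chg k "sub V" R S F using sub_module[OF V'] R S F by (rule base_chg.intro)
    have p: "B.ER.pt v \<one>\<^bsub>R\<^esub> \<in> carrier (tensor_group k (sub V) R)"
        "B.ES.pt v \<one>\<^bsub>S\<^esub> \<in> carrier (tensor_group k (sub V) S)"
      using v by simp_all
    have "act (reg V) S (fmor G R S F g) (B.ES.pt v \<one>\<^bsub>S\<^esub>) = B.Vf (act (reg V) R g (B.ER.pt v \<one>\<^bsub>R\<^esub>))"
    proof (rule reg_act_eqI[OF V S G_closed[OF R S F g] p(2)
        B.Vf_closed[OF reg_act_closed[OF V R g p(1)]]])
      fix S' h f assume S': "algebra k S'" and h: "h \<in> H S'" and f: "f \<in> alg_hom k S S'"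
      interpret S': algebra k S' by fact
      have fF: "compose (carrier R) f F \<in> alg_hom k R S'" by (rule alg_hom_compose[OF F f R])
      note gg = gi_closed[OF R g]
      have e: "cmp (compose (carrier R) f F) (gi R g) = cmp f (cmp F (gi R g))"
        using alg_homD(4)[OF gg] by (auto simp: compose_def fun_eq_iff)
      have hg: "pm S' h (cmp f (cmp F (gi R g))) \<in> H S'"
        by (rule pm_closed[OF S' h cmp_closed[OF f cmp_closed[OF F gg]]])
      have "hat V S S' h f (B.Vf (act (reg V) R g (B.ER.pt v \<one>\<^bsub>R\<^esub>)))
          = hat V R S' (pm S' h (cmp f (cmp F (gi R g)))) (compose (carrier R) f F)
              (B.ER.pt v \<one>\<^bsub>R\<^esub>)"
        by (simp add: hat_base_change[OF V' R S S' h F f reg_act_closed[OF V R g p(1)]]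
            hat_reg_act[OF V R g p(1) S' h fF] e)
      also have "\<dots> = pm S' h (cmp f (cmp F (gi R g))) v"
        using hat_pt[OF V' R S' hg fF v, of "\<one>\<^bsub>R\<^esub>"] alg_homD(7)[OF fF] alg_homD(4)[OF hg vA] by simp
      also have "\<dots> = hat V S S' (pm S' h (cmp f (cmp F (gi R g)))) f (B.ES.pt v \<one>\<^bsub>S\<^esub>)"
        using hat_pt[OF V' S S' hg f v, of "\<one>\<^bsub>S\<^esub>"] alg_homD(7)[OF f] alg_homD(4)[OF hg vA] by simp
      finally show "hat V S S' h f (B.Vf (act (reg V) R g (B.ER.pt v \<one>\<^bsub>R\<^esub>)))
          = hat V S S' (pm S' h (cmp f (gi S (fmor G R S F g)))) f (B.ES.pt v \<one>\<^bsub>S\<^esub>)"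
        by (simp add: gi_mor[OF R S F g])
    qed
    then show "act (reg V) S (fmor G R S F g) (pure_tensor k (space (reg V)) S v \<one>\<^bsub>S\<^esub>)
        = tensor_map k (space (reg V)) R (space (reg V)) S (\<lambda>v. v) F
            (act (reg V) R g (pure_tensor k (space (reg V)) R v \<one>\<^bsub>R\<^esub>))"
      by simp
  qed
  moreover have "vectorspace.fin_dim k (sub V)"
  proof -
    obtain B where B: "finite B" "B \<subseteq> V" "\<And>U. submodule k U A \<Longrightarrow> B \<subseteq> U \<Longrightarrow> V \<subseteq> U"
      using V unfolding stable_def by blast
    have "submodule k U A" if "submodule k U (sub V)" for U
      using that V' A.module by (auto simp: submodule_def)
    then show ?thesis
      unfolding fin_dim_iff[OF vs] using B by (intro exI[of _ B]) simp
  qed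
  ultimately show ?thesis by (simp add: Rep_def)
qed

lemma rep_hom_regI:
  fixes X :: "('u, 'v, 'g) rep"
  assumes W: "stable W" and X: "representation k G X" and \<phi>: "\<phi> \<in> module_hom k (space X) (sub W)"
    and eq: "\<And>R g z S h f. algebra k R \<Longrightarrow> g \<in> carrier (fob G R) \<Longrightarrow>
        z \<in> carrier (tensor_group k (space X) R) \<Longrightarrow>
      algebra k S \<Longrightarrow> h \<in> H S \<Longrightarrow> f \<in> alg_hom k R S \<Longrightarrow>
      hat W R S h f (tensor_map k (space X) R (sub W) R \<phi> (\<lambda>r. r) (act X R g z))
      = hat W R S (pm S h (cmp f (gi R g))) f (tensor_map k (space X) R (sub W) R \<phi> (\<lambda>r. r) z)"
  shows "\<phi> \<in> rep_hom k G X (reg W)"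
proof -
  have "tensor_map k (space X) R (sub W) R \<phi> (\<lambda>r. r) (act X R g z)
      = act (reg W) R g (tensor_map k (space X) R (sub W) R \<phi> (\<lambda>r. r) z)"
    if R: "algebra k R" and g: "g \<in> carrier (fob G R)"
      and z: "z \<in> carrier (tensor_group k (space X) R)" for R g z
  proof -
    interpret e: ext_map k "space X" "sub W" R \<phi>
      using rep_module[OF X] sub_module[OF stable_submodule[OF W]] R \<phi> by (rule ext_map.intro)
    show ?thesis
      by (rule reg_act_eqI[OF W R g, symmetric])
        (use e.V\<phi>_closed[OF z] e.V\<phi>_closed[OF act_closed[OF X R g z]] eq[OF R g z] in simp_all)
  qed
  then show ?thesis using \<phi> by (simp add: rep_hom_def fibre_def fibre_map_def)
qed

text \<open>This provides the regular representation into which a matrix coefficient map of a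
  finite-dimensional representation is a morphism.\<close>

lemma stable_spanning:
  fixes X :: "('u, 'v, 'w) module_scheme"
  assumes X: "vectorspace k X" "vectorspace.fin_dim k X" and m: "m \<in> module_hom k X A"
  obtains U where "stable U" "m ` carrier X \<subseteq> U"
proof -
  interpret X: vectorspace k X by (rule X(1))
  obtain B where B: "finite B" "B \<subseteq> carrier X" "\<And>U. submodule k U X \<Longrightarrow> B \<subseteq> U \<Longrightarrow> carrier X \<subseteq> U"
    using X(2) unfolding fin_dim_iff[OF X(1)] by blast
  have "m ` B \<subseteq> carrier A" using B(2) module_hom_in[OF m] by auto
  then obtain U where U: "stable U" "m ` B \<subseteq> U" using stable_finite[of "m ` B"] B(1) by blast
  have "carrier X \<subseteq> {x \<in> carrier X. m x \<in> U}"
    by (rule B(3)[OF preimage_submodule[OF X.module_axioms m A.module stable_submodule[OF U(1)]]])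
        (use U B in auto)
  then have "m ` carrier X \<subseteq> U" by auto
  then show thesis using that U(1) by blast
qed

end

section \<open>Matrix coefficients\<close>

text \<open>The case of \<open>vec_tensor\<close> where the subspace is the whole space, restated so
  that the tensor product is formed on \<open>V\<close> itself instead of
  \<open>V\<lparr>carrier := carrier V\<rparr>\<close>.\<close>

locale whole_slice =
  fixes k :: "'u ring" and V :: "('u, 'v) module" and R :: "('u, 'u) module"
  assumes vector_space: "vectorspace k V" and alg: "algebra k R"
begin

sublocale ext_scal k V R
  using vector_space alg by (auto intro: ext_scal.intro simp: vectorspace_def)

interpretation v: vec_tensor k V "carrier V" R
proof (rule vec_tensor.intro[OF vector_space _ N])
  show "submodule k (carrier V) V"
    using M by (simp add: submodule_def module_def abelian_group_def abelian_monoid.a_closed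
      abelian_monoid.zero_closed module.smult_closed[OF M])
qed

definition wslice where "wslice \<xi> = tlift k V R R (\<lambda>v r. \<xi> v \<odot>\<^bsub>R\<^esub> r)"

lemma wslice_eq: "wslice = v.slice"
  by (simp add: wslice_def v.slice_def fun_eq_iff)

lemma wslice_amap: "\<xi> \<in> functionals k V \<Longrightarrow> amap Z R (wslice \<xi>)"
  using v.slice_amap by (simp add: wslice_eq)

lemma wslice_pt: "\<xi> \<in> functionals k V \<Longrightarrow> v \<in> carrier V \<Longrightarrow> r \<in> carrier R \<Longrightarrow>
    wslice \<xi> (pt v r) = \<xi> v \<odot>\<^bsub>R\<^esub> r"
  using v.slice_pt by (simp add: wslice_eq)

lemma wslice_eqI:
  assumes "z \<in> carrier (tensor_group k V R)" "w \<in> carrier (tensor_group k V R)"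
    and "\<And>\<xi>. \<xi> \<in> functionals k V \<Longrightarrow> wslice \<xi> z = wslice \<xi> w"
  shows "z = w"
  using v.slices_eqI[of z w] assms by (simp add: wslice_eq)

lemma wslice_smult:
  assumes \<xi>: "\<xi> \<in> functionals k V" and r: "r \<in> carrier R" and z: "z \<in> carrier (tensor_group k V R)"
  shows "wslice \<xi> (r \<odot>\<^bsub>E\<^esub> z) = r \<otimes>\<^bsub>R\<^esub> wslice \<xi> z"
proof (rule amap_tensor_eqI[where P = R and z = z])
  show "amap Z R (\<lambda>z. wslice \<xi> (r \<odot>\<^bsub>E\<^esub> z))"
    by (rule amap_comp[OF esmult_amap[OF r] wslice_amap[OF \<xi>]])
  have "amap R R (\<lambda>x. r \<otimes>\<^bsub>R\<^esub> x)" using r by (simp add: amap_def R.r_distr)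
  then show "amap Z R (\<lambda>z. r \<otimes>\<^bsub>R\<^esub> wslice \<xi> z)" by (rule amap_comp[OF wslice_amap[OF \<xi>]])
qed (use r z v.functionalD(1)[OF \<xi>] in \<open>simp_all add: esmult_pt wslice_pt[OF \<xi>]
    R.smult_assoc2_right\<close>)

end

lemma wslice_base_change:
  fixes k :: "'u ring" and V :: "('u, 'v) module" and R S :: "('u, 'u) module"
  assumes V: "vectorspace k V" and R: "algebra k R" and S: "algebra k S" and f: "f \<in> alg_hom k R S"
    and \<xi>: "\<xi> \<in> functionals k V" and z: "z \<in> carrier (tensor_group k V R)"
  shows "whole_slice.wslice k V S \<xi> (tensor_map k V R V S (\<lambda>v. v) f z)
      = f (whole_slice.wslice k V R \<xi> z)"
proof -
  have Vm: "module k V" using V by (simp add: vectorspace_def)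
  interpret B: base_chg k V R S f using Vm R S f by (rule base_chg.intro)
  interpret vR: whole_slice k V R using V R by (rule whole_slice.intro)
  interpret vS: whole_slice k V S using V S by (rule whole_slice.intro)
  have \<xi>c: "v \<in> carrier V \<Longrightarrow> \<xi> v \<in> carrier k" for v using module_hom_in[OF \<xi>, of v] by simp
  show ?thesis
    by (rule B.ER.amap_tensor_eqI[where P = S and z = z])
      (use z \<xi>c in \<open>simp_all add: amap_comp[OF B.Vf_amap vS.wslice_amap[OF \<xi>]]
        amap_comp[OF vR.wslice_amap[OF \<xi>] module_hom_amap[OF alg_homD(2)[OF f]]]
        B.Vf_pt vS.wslice_pt[OF \<xi>] vR.wslice_pt[OF \<xi>] alg_homD[OF f]\<close>)
qed

context affine
begin

abbreviation "idA \<equiv> (\<lambda>a\<in>carrier A. a)"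

lemma idA_hom: "idA \<in> H A" by (rule alg_hom_id[OF A])

lemma cmp_idA: "h \<in> H S \<Longrightarrow> cmp h idA = h"
  using alg_homD(3)[of h k A S] by (auto simp: compose_def fun_eq_iff extensional_def)

text \<open>The function g \<mapsto> \<xi>(g x) as an element of \<open>A\<close>: the universal
  element \<open>\<eta> A idA\<close> of G(A) acts on x \<otimes> 1, and \<xi> contracts the
  result.\<close>

definition coeff :: "('u, 'v, 'g) rep \<Rightarrow> ('v \<Rightarrow> 'u) \<Rightarrow> 'v \<Rightarrow> 'u" where
  "coeff X \<xi> x = whole_slice.wslice k (space X) A \<xi>
      (act X A (\<eta> A idA) (pure_tensor k (space X) A x \<one>\<^bsub>A\<^esub>))"

context
  fixes X :: "('u, 'v, 'g) rep" and \<xi>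
  assumes X: "representation k G X" and \<xi>: "\<xi> \<in> functionals k (space X)"
begin

interpretation X: vectorspace k "space X" by (rule rep_vectorspace[OF X])
interpretation WA: whole_slice k "space X" A using X.vectorspace_axioms A
  by (rule whole_slice.intro)

lemma coeff_hom: "coeff X \<xi> \<in> module_hom k (space X) A"
proof (rule module_homI)
  note u = \<eta>_closed[OF A idA_hom]
  have c: "coeff X \<xi> = (\<lambda>x. WA.wslice \<xi> (act X A (\<eta> A idA) (WA.pt x \<one>\<^bsub>A\<^esub>)))"
    by (simp add: coeff_def fun_eq_iff)
  show "amap (space X) A (coeff X \<xi>)"
    unfolding c
    by (rule amap_comp[OF amap_comp[OF balanced_amap1[OF WA.pt_balanced] act_amap[OF X A u]]
        WA.wslice_amap[OF \<xi>]]) simp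
  show "coeff X \<xi> (a \<odot>\<^bsub>space X\<^esub> x) = a \<odot>\<^bsub>A\<^esub> coeff X \<xi> x"
    if a: "a \<in> carrier k" and x: "x \<in> carrier (space X)" for a x
  proof -
    have "WA.pt (a \<odot>\<^bsub>space X\<^esub> x) \<one>\<^bsub>A\<^esub> = (a \<odot>\<^bsub>A\<^esub> \<one>\<^bsub>A\<^esub>) \<odot>\<^bsub>WA.E\<^esub> WA.pt x \<one>\<^bsub>A\<^esub>"
      using a x by (simp add: WA.esmult_pt WA.pt_smult)
    moreover have "WA.pt x \<one>\<^bsub>A\<^esub> \<in> carrier WA.E" using x by simp
    moreover have "act X A (\<eta> A idA) (WA.pt x \<one>\<^bsub>A\<^esub>) \<in> carrier (tensor_group k (space X) A)"
      using x by (intro act_closed[OF X A u]) simp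
    ultimately show ?thesis
      using a amap_closed[OF WA.wslice_amap[OF \<xi>], of "act X A (\<eta> A idA) (WA.pt x \<one>\<^bsub>A\<^esub>)"]
      by (simp add: c module_hom_smult[OF act_hom[OF X A u]] WA.wslice_smult[OF \<xi>] A.smult_assoc2)
  qed
qed

text \<open>The element of G(S) that belongs to \<open>h\<close> is the image of the universal
  element under \<open>h\<close>, and the action is natural.\<close>

lemma coeff_point:
  assumes S: "algebra k S" and h: "h \<in> H S" and x: "x \<in> carrier (space X)"
  shows "h (coeff X \<xi> x)
      = whole_slice.wslice k (space X) S \<xi> (act X S (\<eta> S h) (pure_tensor k (space X) S x \<one>\<^bsub>S\<^esub>))"
proof -
  note u = \<eta>_closed[OF A idA_hom]
  interpret B: base_chg k "space X" A S h using X.module_axioms A S h by (rule base_chg.intro)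
  have "fmor G A S h (\<eta> A idA) = \<eta> S h"
    using \<eta>_nat[OF A S h idA_hom] cmp_idA[OF h] by simp
  then have "act X S (\<eta> S h) (B.Vf (WA.pt x \<one>\<^bsub>A\<^esub>)) = B.Vf (act X A (\<eta> A idA) (WA.pt x \<one>\<^bsub>A\<^esub>))"
    using act_nat[OF X A S h u, of "WA.pt x \<one>\<^bsub>A\<^esub>"] x by simp
  then show ?thesis
    using wslice_base_change[OF X.vectorspace_axioms A S h \<xi> act_closed[OF X A u],
        of "WA.pt x \<one>\<^bsub>A\<^esub>"] x
    by (simp add: coeff_def B.Vf_pt alg_homD(7)[OF h])
qed

lemma hat_coeff:
  assumes U: "stable U" and mU: "coeff X \<xi> ` carrier (space X) \<subseteq> U" and R: "algebra k R"
    and S: "algebra k S"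
    and h: "h \<in> H S" and f: "f \<in> alg_hom k R S" and z: "z \<in> carrier (tensor_group k (space X) R)"
  shows "hat U R S h f (tensor_map k (space X) R (sub U) R (coeff X \<xi>) (\<lambda>r. r) z)
    = whole_slice.wslice k (space X) S \<xi>
        (act X S (\<eta> S h) (tensor_map k (space X) R (space X) S (\<lambda>v. v) f z))"
proof -
  have m: "coeff X \<xi> \<in> module_hom k (space X) (sub U)" using coeff_hom mU
    by (auto simp: module_hom_def)
  interpret S: algebra k S by fact
  interpret e: ext_map k "space X" "sub U" R "coeff X \<xi>"
    using X.module_axioms sub_module[OF stable_submodule[OF U]] R m by (rule ext_map.intro)
  interpret WS: whole_slice k "space X" S using X.vectorspace_axioms S by (rule whole_slice.intro)
  interpret B: base_chg k "space X" R S f using X.module_axioms R S f by (rule base_chg.intro)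
  note g = \<eta>_closed[OF S h]
  show ?thesis
  proof (rule e.EV.amap_tensor_eqI[where P = S and z = z])
    show "amap e.EV.Z S (\<lambda>z. hat U R S h f (e.V\<phi> z))"
      by (rule amap_comp[OF e.V\<phi>_amap hat_amap[OF stable_submodule[OF U] R S h f]])
    show "amap e.EV.Z S (\<lambda>z. WS.wslice \<xi> (act X S (\<eta> S h) (B.Vf z)))"
      by (rule amap_comp[OF amap_comp[OF B.Vf_amap act_amap[OF X S g]] WS.wslice_amap[OF \<xi>]])
    show "hat U R S h f (e.V\<phi> (e.EV.pt x r)) = WS.wslice \<xi> (act X S (\<eta> S h) (B.Vf (e.EV.pt x r)))"
      if x: "x \<in> carrier (space X)" and r: "r \<in> carrier R" for x r
    proof -
      have fr: "f r \<in> carrier S" by (rule alg_homD(4)[OF f r])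
      have px: "WS.pt x \<one>\<^bsub>S\<^esub> \<in> carrier WS.E" "WS.pt x \<one>\<^bsub>S\<^esub> \<in> carrier (tensor_group k (space X) S)"
        using x by simp_all
      note ac = act_closed[OF X S g px(2)]
      have "B.Vf (e.EV.pt x r) = f r \<odot>\<^bsub>WS.E\<^esub> WS.pt x \<one>\<^bsub>S\<^esub>"
        using x r fr by (simp add: B.Vf_pt WS.esmult_pt)
      then have "WS.wslice \<xi> (act X S (\<eta> S h) (B.Vf (e.EV.pt x r))) = f r \<otimes>\<^bsub>S\<^esub> h (coeff X \<xi> x)"
        using fr px ac coeff_point[OF S h x]
        by (simp add: module_hom_smult[OF act_hom[OF X S g]] WS.wslice_smult[OF \<xi>])
      moreover have "coeff X \<xi> x \<in> U" using mU x by auto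
      moreover have "coeff X \<xi> x \<in> carrier A" using coeff_hom x by (rule module_hom_in)
      ultimately show ?thesis
        using x r fr alg_homD(4)[OF h]
          by (simp add: e.V\<phi>_pt hat_pt[OF stable_submodule[OF U] R S h f] S.m_comm)
    qed
  qed (use z in simp)
qed

text \<open>Associativity of the action gives \<xi>((h g) x) = \<xi>(h (g x)): translating a
  coefficient function on the right by \<open>g\<close> amounts to replacing \<open>x\<close> by
  \<open>g x\<close>.\<close>

lemma coeff_rep_hom:
  assumes U: "stable U" and mU: "coeff X \<xi> ` carrier (space X) \<subseteq> U"
  shows "coeff X \<xi> \<in> rep_hom k G X (reg U)"
proof (rule rep_hom_regI[OF U X])
  show "coeff X \<xi> \<in> module_hom k (space X) (sub U)" using coeff_hom mU
    by (auto simp: module_hom_def)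
next
  fix R S :: "('u, 'u) module" and g z h f
  assume R: "algebra k R" and g: "g \<in> carrier (fob G R)"
    and z: "z \<in> carrier (tensor_group k (space X) R)"
    and S: "algebra k S" and h: "h \<in> H S" and f: "f \<in> alg_hom k R S"
  interpret B: base_chg k "space X" R S f using X.module_axioms R S f by (rule base_chg.intro)
  note gg = gi_closed[OF R g]
  note fg = cmp_closed[OF f gg]
  note hc = \<eta>_closed[OF S h] and Fc = G_closed[OF R S f g]
  have e: "\<eta> S (pm S h (cmp f (gi R g))) = \<eta> S h \<otimes>\<^bsub>fob G S\<^esub> fmor G R S f g"
    by (simp add: \<eta>_pm[OF S h fg] \<eta>_nat[OF R S f gg] \<eta>_gi[OF R g])
  show "hat U R S h f (tensor_map k (space X) R (sub U) R (coeff X \<xi>) (\<lambda>r. r) (act X R g z))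
      = hat U R S (pm S h (cmp f (gi R g))) f
          (tensor_map k (space X) R (sub U) R (coeff X \<xi>) (\<lambda>r. r) z)"
    using B.Vf_closed[OF z]
    by (simp add: hat_coeff[OF U mU R S h f act_closed[OF X R g z]]
        hat_coeff[OF U mU R S pm_closed[OF S h fg] f z]
        e act_mult[OF X S hc Fc] act_nat[OF X R S f g z, symmetric] compose_eq)
qed

end

section \<open>The algebra homomorphism of a monoidal automorphism\<close>

lemma incl_rep_hom:
  assumes V: "stable V" and W: "stable W" and VW: "V \<subseteq> W"
  shows "(\<lambda>v. v) \<in> rep_hom k G (reg V) (reg W)"
proof (rule rep_hom_regI[OF W])
  show "representation k G (reg V)" using reg_Rep[OF V] by (rule RepD)
  show "(\<lambda>v. v) \<in> module_hom k (space (reg V)) (sub W)" using VW by (auto simp: module_hom_def)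
next
  fix R S :: "('u, 'u) module" and g z h f
  assume R: "algebra k R" and g: "g \<in> carrier (fob G R)"
    and "z \<in> carrier (tensor_group k (space (reg V)) R)"
    and S: "algebra k S" and h: "h \<in> H S" and f: "f \<in> alg_hom k R S"
  then have z: "z \<in> carrier (tensor_group k (sub V) R)" by simp
  note i = hat_incl(1)[OF stable_submodule[OF V] stable_submodule[OF W] VW R S]
  have "pm S h (cmp f (gi R g)) \<in> H S"
    by (rule pm_closed[OF S h cmp_closed[OF f gi_closed[OF R g]]])
  then show "hat W R S h f (tensor_map k (space (reg V)) R (sub W) R (\<lambda>v. v) (\<lambda>r. r)
      (act (reg V) R g z))
      = hat W R S (pm S h (cmp f (gi R g))) f
          (tensor_map k (space (reg V)) R (sub W) R (\<lambda>v. v) (\<lambda>r. r) z)"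
    by (simp add: i[OF h f reg_act_closed[OF V R g z]] i[OF _ f z] hat_reg_act[OF V R g z S h f])
qed

text \<open>Every point takes the value 1 at the constant function 1, so constants are unchanged by
  translation.\<close>

lemma unit_rep_hom:
  assumes U: "stable U" and 1: "\<one>\<^bsub>A\<^esub> \<in> U"
  shows "(\<lambda>c. c \<odot>\<^bsub>A\<^esub> \<one>\<^bsub>A\<^esub>) \<in> rep_hom k G (unit_rep k) (reg U)"
proof (rule rep_hom_regI[OF U])
  note U' = stable_submodule[OF U]
  interpret U: submodule k U A by (rule U')
  interpret k: vectorspace k "base_space k" by (rule base_space_vectorspace)
  show "representation k G (unit_rep k)" using unit_rep_Rep by (rule RepD)
  have \<phi>: "(\<lambda>c. c \<odot>\<^bsub>A\<^esub> \<one>\<^bsub>A\<^esub>) \<in> module_hom k (base_space k) (sub U)"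
    using 1 U.smult_closed by (auto simp: module_hom_def A.smult_l_distr A.smult_assoc1)
  then show "(\<lambda>c. c \<odot>\<^bsub>A\<^esub> \<one>\<^bsub>A\<^esub>) \<in> module_hom k (space (unit_rep k)) (sub U)"
    by (simp add: unit_rep_def)
  fix R S :: "('u, 'u) module" and g z h f
  assume R: "algebra k R" and g: "g \<in> carrier (fob G R)"
    and "z \<in> carrier (tensor_group k (space (unit_rep k)) R)"
    and S: "algebra k S" and h: "h \<in> H S" and f: "f \<in> alg_hom k R S"
  then have z: "z \<in> carrier (tensor_group k (base_space k) R)" by (simp add: unit_rep_def)
  interpret e: ext_map k "base_space k" "sub U" R "\<lambda>c. c \<odot>\<^bsub>A\<^esub> \<one>\<^bsub>A\<^esub>"
    using k.module_axioms sub_module[OF U'] R \<phi> by (rule ext_map.intro)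
  have hg: "pm S h (cmp f (gi R g)) \<in> H S"
    by (rule pm_closed[OF S h cmp_closed[OF f gi_closed[OF R g]]])
  have "hat U R S h f (e.V\<phi> z) = hat U R S (pm S h (cmp f (gi R g))) f (e.V\<phi> z)"
    by (rule e.EV.amap_tensor_eqI[where P = S and z = z])
      (use z 1 in \<open>simp_all add: amap_comp[OF e.V\<phi>_amap hat_amap[OF U' R S h f]]
          amap_comp[OF e.V\<phi>_amap hat_amap[OF U' R S hg f]]
        e.V\<phi>_pt hat_pt[OF U' R S h f] hat_pt[OF U' R S hg f] alg_homD[OF h] alg_homD[OF hg]\<close>)
  then show "hat U R S h f (tensor_map k (space (unit_rep k)) R (sub U) R (\<lambda>c. c \<odot>\<^bsub>A\<^esub> \<one>\<^bsub>A\<^esub>)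
      (\<lambda>r. r) (act (unit_rep k) R g z))
      = hat U R S (pm S h (cmp f (gi R g))) f
          (tensor_map k (space (unit_rep k)) R (sub U) R (\<lambda>c. c \<odot>\<^bsub>A\<^esub> \<one>\<^bsub>A\<^esub>) (\<lambda>r. r) z)"
    using z by (simp add: unit_rep_def)
qed

text \<open>A stable subspace containing the finitely many products of generators contains all
  products. This is spread one factor at a time, commutativity exchanging the two factors.\<close>

lemma stable_product:
  assumes V: "stable V"
  obtains U where "stable U" "\<And>v w. v \<in> V \<Longrightarrow> w \<in> V \<Longrightarrow> v \<otimes>\<^bsub>A\<^esub> w \<in> U"
proof -
  obtain B where B: "finite B" "B \<subseteq> V" "\<And>U. submodule k U A \<Longrightarrow> B \<subseteq> U \<Longrightarrow> V \<subseteq> U"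
    using V unfolding stable_def by blast
  have Vc: "V \<subseteq> carrier A" using stable_submodule[OF V] by (simp add: submodule_def)
  let ?F = "(\<lambda>(b, c). b \<otimes>\<^bsub>A\<^esub> c) ` (B \<times> B)"
  have "?F \<subseteq> carrier A" using B(2) Vc by auto
  then obtain U where U: "stable U" "?F \<subseteq> U" using stable_finite[of ?F] B(1) by blast
  have mh: "(\<lambda>v. w \<otimes>\<^bsub>A\<^esub> v) \<in> module_hom k A A" if "w \<in> carrier A" for w
    using that by (auto simp: module_hom_def A.r_distr A.smult_assoc2_right)
  note pre = preimage_submodule[OF A.module mh A.module stable_submodule[OF U(1)]]
  have 1: "b \<otimes>\<^bsub>A\<^esub> v \<in> U" if b: "b \<in> B" and v: "v \<in> V" for b v
  proof -
    have "V \<subseteq> {x \<in> carrier A. b \<otimes>\<^bsub>A\<^esub> x \<in> U}"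
      by (rule B(3)[OF pre]) (use b B(2) Vc U(2) in auto)
    then show ?thesis using v by auto
  qed
  have 2: "v \<otimes>\<^bsub>A\<^esub> w \<in> U" if v: "v \<in> V" and w: "w \<in> V" for v w
  proof -
    have "V \<subseteq> {x \<in> carrier A. w \<otimes>\<^bsub>A\<^esub> x \<in> U}"
    proof (rule B(3)[OF pre])
      show "B \<subseteq> {x \<in> carrier A. w \<otimes>\<^bsub>A\<^esub> x \<in> U}"
      proof
        fix x assume x: "x \<in> B"
        then have "w \<otimes>\<^bsub>A\<^esub> x = x \<otimes>\<^bsub>A\<^esub> w" using B(2) Vc w by (intro A.m_comm) auto
        then show "x \<in> {x \<in> carrier A. w \<otimes>\<^bsub>A\<^esub> x \<in> U}" using 1[OF x w] x B(2) Vc by auto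
      qed
    qed (use w Vc in auto)
    moreover have "v \<otimes>\<^bsub>A\<^esub> w = w \<otimes>\<^bsub>A\<^esub> v" using v w Vc by (intro A.m_comm) auto
    ultimately show ?thesis using v by auto
  qed
  show thesis using that[OF U(1)] 2 by blast
qed

section \<open>From a monoidal automorphism to a point\<close>

context
  fixes R :: "('u, 'u) module" and \<theta>
  assumes R: "algebra k R" and nat: "natural_aut k G R \<theta>" and mono: "monoidal k G R \<theta>"
begin

interpretation R: algebra k R by (rule R)

abbreviation (input) "idR \<equiv> (\<lambda>r\<in>carrier R. r)"

lemma idR_hom: "idR \<in> alg_hom k R R" by (rule alg_hom_id[OF R])

lemma \<theta>_hom: "X \<in> Rep k G \<Longrightarrow>
    \<theta> X \<in> module_hom R (ext_scalars k (space X) R) (ext_scalars k (space X) R)"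
  and \<theta>_ext: "X \<in> Rep k G \<Longrightarrow> \<theta> X \<in> extensional (carrier (tensor_group k (space X) R))"
  using nat by (simp_all add: natural_aut_def linear_aut_group_def fibre_def)

lemma \<theta>_closed: "X \<in> Rep k G \<Longrightarrow> z \<in> carrier (tensor_group k (space X) R) \<Longrightarrow>
    \<theta> X z \<in> carrier (tensor_group k (space X) R)"
  using module_hom_in[OF \<theta>_hom, of X z] by simp

lemma \<theta>_nat: "X \<in> Rep k G \<Longrightarrow> Y \<in> Rep k G \<Longrightarrow> \<phi> \<in> rep_hom k G X Y \<Longrightarrow>
    z \<in> carrier (tensor_group k (space X) R) \<Longrightarrow>
    \<theta> Y (tensor_map k (space X) R (space Y) R \<phi> (\<lambda>r. r) z) = tensor_map k (space X) R (space Y) R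
        \<phi> (\<lambda>r. r) (\<theta> X z)"
  using nat by (simp add: natural_aut_def fibre_def fibre_map_def)

lemma tensor_rep_space: "space (tensor_rep k X Y) = tensor_module k (space X) (space Y)"
  by (simp add: tensor_rep_def)

lemma \<theta>_tensor:
  assumes "X \<in> Rep k G" "Y \<in> Rep k G" "T \<in> Rep k G" "\<phi> \<in> rep_iso k G (tensor_rep k X Y) T"
    and "z \<in> carrier (tensor_group R (ext_scalars k (space X) R) (ext_scalars k (space Y) R))"
  shows "\<theta> T (tensor_map k (tensor_module k (space X) (space Y)) R (space T) R \<phi> (\<lambda>r. r)
      (ext_tensor_iso k (space X) (space Y) R z))
    = tensor_map k (tensor_module k (space X) (space Y)) R (space T) R \<phi> (\<lambda>r. r)
      (ext_tensor_iso k (space X) (space Y) R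
        (tensor_map R (ext_scalars k (space X) R) (ext_scalars k (space Y) R)
          (ext_scalars k (space X) R) (ext_scalars k (space Y) R) (\<theta> X) (\<theta> Y) z))"
  using mono assms unfolding monoidal_def Let_def
    by (simp add: fibre_def fibre_map_def tensor_rep_space)

abbreviation "ev V \<equiv> hat V R R (pe R) idR"

definition lam where "lam V v = ev V (\<theta> (reg V) (pure_tensor k (sub V) R v \<one>\<^bsub>R\<^esub>))"

lemma pe_id: "pe R \<in> H R" "idR \<in> alg_hom k R R" by (rule pe_closed[OF R], rule idR_hom)

lemma sub_pt_closed: "stable V \<Longrightarrow> v \<in> V \<Longrightarrow>
    pure_tensor k (sub V) R v \<one>\<^bsub>R\<^esub> \<in> carrier (tensor_group k (sub V) R)"
  using tensor_pair.pt_closed[OF tensor_pair.intro[OF sub_module[OF stable_submodule] R.module],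
      of V v "\<one>\<^bsub>R\<^esub>"] by simp

lemma \<theta>_reg_closed: "stable V \<Longrightarrow> z \<in> carrier (tensor_group k (sub V) R) \<Longrightarrow>
    \<theta> (reg V) z \<in> carrier (tensor_group k (sub V) R)"
  using \<theta>_closed[OF reg_Rep] by simp

lemma lam_closed: "stable V \<Longrightarrow> v \<in> V \<Longrightarrow> lam V v \<in> carrier R"
  unfolding lam_def by (intro hat_closed[OF stable_submodule R R pe_id] \<theta>_reg_closed sub_pt_closed)

text \<open>By naturality \<open>lam\<close> can be computed in any representation that maps to a
  regular one. It is used for inclusions, the unit, multiplication and matrix coefficients.\<close>

lemma lam_push:
  fixes X :: "('u, 'u, 'g) rep"
  assumes U: "stable U" and X: "X \<in> Rep k G" and \<phi>: "\<phi> \<in> rep_hom k G X (reg U)"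
    and x: "x \<in> carrier (space X)"
  shows "lam U (\<phi> x) = ev U (tensor_map k (space X) R (sub U) R \<phi> (\<lambda>r. r)
      (\<theta> X (pure_tensor k (space X) R x \<one>\<^bsub>R\<^esub>)))"
proof -
  have \<phi>': "\<phi> \<in> module_hom k (space X) (sub U)" using \<phi> by (simp add: rep_hom_def)
  interpret e: ext_map k "space X" "sub U" R \<phi>
    using rep_module[OF RepD(1)[OF X]] sub_module[OF stable_submodule[OF U]] R \<phi>'
      by (rule ext_map.intro)
  show ?thesis
    using \<theta>_nat[OF X reg_Rep[OF U] \<phi>, of "e.EV.pt x \<one>\<^bsub>R\<^esub>"] x by (simp add: lam_def e.V\<phi>_pt)
qed

lemma lam_mono:
  assumes V: "stable V" and W: "stable W" and VW: "V \<subseteq> W" and v: "v \<in> V"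
  shows "lam W v = lam V v"
  using lam_push[OF W reg_Rep[OF V] incl_rep_hom[OF V W VW], of v] v
    hat_incl(1)[OF stable_submodule[OF V] stable_submodule[OF W] VW R R pe_id
        \<theta>_reg_closed[OF V sub_pt_closed[OF V v]]]
  by (simp add: lam_def)

definition lambda where "lambda = (\<lambda>a\<in>carrier A. lam (SOME V. stable V \<and> a \<in> V) a)"

text \<open>The choice made in \<open>lambda\<close> is harmless: two stable subspaces lie in a
  third, where \<open>lam_mono\<close> compares them.\<close>

lemma lambda_eq:
  assumes V: "stable V" and a: "a \<in> V"
  shows "lambda a = lam V a"
proof -
  have aA: "a \<in> carrier A" using a stable_submodule[OF V] by (auto simp: submodule_def)
  let ?W = "SOME V. stable V \<and> a \<in> V"
  have W: "stable ?W \<and> a \<in> ?W" by (rule someI[of _ V]) (use V a in simp)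
  obtain U where "stable U" "V \<subseteq> U" "?W \<subseteq> U" using stable_sum[OF V conjunct1[OF W]] by blast
  then have "lam V a = lam ?W a" using lam_mono[of V U a] lam_mono[of ?W U a] V W a by simp
  then show ?thesis using aA by (simp add: lambda_def)
qed

lemma lam_linear:
  assumes V: "stable V"
  shows "v \<in> V \<Longrightarrow> w \<in> V \<Longrightarrow> lam V (v \<oplus>\<^bsub>A\<^esub> w) = lam V v \<oplus>\<^bsub>R\<^esub> lam V w"
    and "c \<in> carrier k \<Longrightarrow> v \<in> V \<Longrightarrow> lam V (c \<odot>\<^bsub>A\<^esub> v) = c \<odot>\<^bsub>R\<^esub> lam V v"
proof -
  note V' = stable_submodule[OF V]
  interpret E: ext_scal k "sub V" R using sub_module[OF V'] R by (rule ext_scal.intro)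
  have \<theta>: "\<theta> (reg V) \<in> module_hom R E.E E.E" using \<theta>_hom[OF reg_Rep[OF V]] by simp
  have \<theta>a: "amap E.Z E.Z (\<theta> (reg V))" using module_hom_amap[OF \<theta>] by (simp add: E.amap_E)
  note ha = amap_comp[OF \<theta>a hat_amap[OF V' R R pe_id]]
  show "lam V (v \<oplus>\<^bsub>A\<^esub> w) = lam V v \<oplus>\<^bsub>R\<^esub> lam V w" if v: "v \<in> V" and w: "w \<in> V"
    using v w E.pt_add1[of v w "\<one>\<^bsub>R\<^esub>"] amap_add[OF ha, of "E.pt v \<one>\<^bsub>R\<^esub>" "E.pt w \<one>\<^bsub>R\<^esub>"]
      by (simp add: lam_def)
  show "lam V (c \<odot>\<^bsub>A\<^esub> v) = c \<odot>\<^bsub>R\<^esub> lam V v" if c: "c \<in> carrier k" and v: "v \<in> V"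
  proof -
    have c1: "c \<odot>\<^bsub>R\<^esub> \<one>\<^bsub>R\<^esub> \<in> carrier R" using c by simp
    have p: "E.pt v \<one>\<^bsub>R\<^esub> \<in> carrier E.E" using v by simp
    have "E.pt (c \<odot>\<^bsub>A\<^esub> v) \<one>\<^bsub>R\<^esub> = (c \<odot>\<^bsub>R\<^esub> \<one>\<^bsub>R\<^esub>) \<odot>\<^bsub>E.E\<^esub> E.pt v \<one>\<^bsub>R\<^esub>"
      using c v E.pt_smult[of c v "\<one>\<^bsub>R\<^esub>"] by (simp add: E.esmult_pt)
    then have "lam V (c \<odot>\<^bsub>A\<^esub> v) = ev V ((c \<odot>\<^bsub>R\<^esub> \<one>\<^bsub>R\<^esub>) \<odot>\<^bsub>E.E\<^esub> \<theta> (reg V) (E.pt v \<one>\<^bsub>R\<^esub>))"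
      using module_hom_smult[OF \<theta> c1 p] by (simp add: lam_def)
    also have "\<dots> = (c \<odot>\<^bsub>R\<^esub> \<one>\<^bsub>R\<^esub>) \<otimes>\<^bsub>R\<^esub> lam V v"
      using hat_smult[OF V' R R pe_id c1 \<theta>_reg_closed[OF V sub_pt_closed[OF V v]]] c1
        by (simp add: lam_def)
    finally show ?thesis using c lam_closed[OF V v] by (simp add: R.smult_assoc2)
  qed
qed

text \<open>The constants are the image of the unit representation, where the unit condition makes
  \<theta> fix 1 \<otimes> 1.\<close>

lemma lam_one:
  assumes U: "stable U" and 1: "\<one>\<^bsub>A\<^esub> \<in> U"
  shows "lam U \<one>\<^bsub>A\<^esub> = \<one>\<^bsub>R\<^esub>"
proof -
  note U' = stable_submodule[OF U]
  interpret k: vectorspace k "base_space k" by (rule base_space_vectorspace)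
  let ?\<phi> = "\<lambda>c. c \<odot>\<^bsub>A\<^esub> \<one>\<^bsub>A\<^esub>"
  have \<phi>: "?\<phi> \<in> rep_hom k G (unit_rep k) (reg U)" by (rule unit_rep_hom[OF U 1])
  then have \<phi>': "?\<phi> \<in> module_hom k (base_space k) (sub U)" by (simp add: rep_hom_def unit_rep_def)
  interpret e: ext_map k "base_space k" "sub U" R ?\<phi>
    using k.module_axioms sub_module[OF U'] R \<phi>' by (rule ext_map.intro)
  have "\<theta> (unit_rep k) (e.EV.pt \<one>\<^bsub>k\<^esub> \<one>\<^bsub>R\<^esub>) = e.EV.pt \<one>\<^bsub>k\<^esub> \<one>\<^bsub>R\<^esub>"
    using mono by (simp add: monoidal_def)
  then have "lam U (?\<phi> \<one>\<^bsub>k\<^esub>) = ev U (e.V\<phi> (e.EV.pt \<one>\<^bsub>k\<^esub> \<one>\<^bsub>R\<^esub>))"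
    using lam_push[OF U unit_rep_Rep \<phi>, of "\<one>\<^bsub>k\<^esub>"] by (simp add: unit_rep_def)
  then show ?thesis using 1 hat_pt[OF U' R R pe_id 1, of "\<one>\<^bsub>R\<^esub>"] alg_homD(7)[OF pe_id(1)]
    by (simp add: e.V\<phi>_pt)
qed

text \<open>Multiplication of functions is a morphism from the tensor square of \<open>reg V\<close>
  to \<open>reg U\<close>. On the tensor square \<theta> acts as \<theta> \<otimes> \<theta> by the
  tensor condition, and evaluation at the unit point turns products into products.\<close>

lemma lam_mult:
  assumes V: "stable V" and U: "stable U" and VU: "\<And>v w. v \<in> V \<Longrightarrow> w \<in> V \<Longrightarrow> v \<otimes>\<^bsub>A\<^esub> w \<in> U"
    and a: "a \<in> V" and b: "b \<in> V"
  shows "lam U (a \<otimes>\<^bsub>A\<^esub> b) = lam V a \<otimes>\<^bsub>R\<^esub> lam V b"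
proof -
  note V' = stable_submodule[OF V] and U' = stable_submodule[OF U]
  let ?X = "reg V"
  have Vc: "v \<in> V \<Longrightarrow> v \<in> carrier A" for v using V' by (auto simp: submodule_def)
  interpret rp: rep_pair k G ?X ?X by unfold_locales (rule reg_Rep[OF V])+
  obtain T \<phi> where T: "T \<in> Rep k G" and \<phi>: "\<phi> \<in> rep_iso k G (tensor_rep k ?X ?X) T"
    using rp.tensor_rep_in_universe by blast
  interpret VV: tensor_pair k "sub V" "sub V" using sub_module[OF V'] sub_module[OF V']
    by (rule tensor_pair.intro)
  have Um: "module k (sub U)" by (rule sub_module[OF U'])
  have Tm: "module k (space T)" by (rule rep_module[OF RepD(1)[OF T]])
  let ?\<mu> = "tlift k (sub V) (sub V) (sub U) (\<lambda>v w. v \<otimes>\<^bsub>A\<^esub> w)"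
  have mb: "balanced k (sub V) (sub V) (sub U) (\<lambda>v w. v \<otimes>\<^bsub>A\<^esub> w)"
    using VU Vc by (intro balancedI)
        (simp_all add: A.l_distr A.r_distr A.smult_assoc2 A.smult_assoc2_right)
  note \<mu>a = VV.tlift_amap[OF module_trans(2)[OF Um] mb]
    and \<mu>p = VV.tlift_pt[OF module_trans(2)[OF Um] mb]
  have \<mu>: "?\<mu> \<in> module_hom k VV.Z (sub U)"
  proof (rule module_homI[OF \<mu>a])
    fix c z assume c: "c \<in> carrier k" and z: "z \<in> carrier VV.Z"
    have "?\<mu> (c \<odot>\<^bsub>VV.Z\<^esub> z) = c \<odot>\<^bsub>sub U\<^esub> ?\<mu> z"
    proof (rule VV.amap_tensor_eqI[where P = "sub U" and z = z])
      show "amap VV.Z (sub U) (\<lambda>z. ?\<mu> (c \<odot>\<^bsub>VV.Z\<^esub> z))" by (rule amap_comp[OF VV.smult_amap[OF c] \<mu>a])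
      show "amap VV.Z (sub U) (\<lambda>z. c \<odot>\<^bsub>sub U\<^esub> ?\<mu> z)"
        by (rule amap_comp[OF \<mu>a module_hom_amap[OF module.smult_module_hom[OF Um c]]])
      show "?\<mu> (c \<odot>\<^bsub>VV.Z\<^esub> VV.pt v w) = c \<odot>\<^bsub>sub U\<^esub> ?\<mu> (VV.pt v w)"
        if "v \<in> carrier (sub V)" "w \<in> carrier (sub V)" for v w
        using that c Vc VV.M.smult_closed[of c v] by (simp add: VV.smult_pt \<mu>p A.smult_assoc2)
    qed (use z in simp)
    then show "?\<mu> (c \<odot>\<^bsub>VV.Z\<^esub> z) = c \<odot>\<^bsub>sub U\<^esub> ?\<mu> z" .
  qed
  have \<phi>h: "\<phi> \<in> module_hom k VV.Z (space T)" and \<phi>b: "bij_betw \<phi> (carrier VV.Z) (carrier (space T))"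
    using \<phi> by (simp_all add: rep_iso_def rep_hom_def tensor_rep_def)
  \<comment> \<open>The tensor square is present in \<open>Rep k G\<close> only as the copy
    \<open>T\<close>, so the morphism has to start at \<open>T\<close>; \<psi> is multiplication
    with the copying map undone.\<close>
  define \<psi> where "\<psi> = (\<lambda>t. ?\<mu> (inv_into (carrier VV.Z) \<phi> t))"
  have \<psi>: "\<psi> \<in> module_hom k (space T) (sub U)"
    unfolding \<psi>_def by (rule module_hom_comp[OF module_hom_inv_into[OF VV.tensor_module_module \<phi>h
        \<phi>b] \<mu>])
  have \<psi>\<phi>: "?\<mu> z = \<psi> (\<phi> z)" if "z \<in> carrier VV.Z" for z
    using \<phi>b that by (simp add: \<psi>_def bij_betw_def)
  \<comment> \<open>The value of a product of functions at a point is the product of the values,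
    here with coefficients and for arbitrary tensors.\<close>
  have hat_J: "hat U R' S h f (tensor_map k VV.Z R' (sub U) R' ?\<mu> (\<lambda>r. r)
      (ext_tensor_iso k (sub V) (sub V) R'
        (pure_tensor R' (ext_scalars k (sub V) R') (ext_scalars k (sub V) R') x y))) = hat V R' S
            h f x \<otimes>\<^bsub>S\<^esub> hat V R' S h f y"
    if R': "algebra k R'" and S: "algebra k S" and h: "h \<in> H S" and f: "f \<in> alg_hom k R' S"
      and x: "x \<in> carrier (tensor_group k (sub V) R')"
        and y: "y \<in> carrier (tensor_group k (sub V) R')" for R' S h f x y
  proof -
    interpret R': algebra k R' by fact
    interpret S: algebra k S by fact
    interpret TI: tens_iso k "sub V" "sub V" R' using sub_module[OF V'] sub_module[OF V'] R'
      by (rule tens_iso.intro)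
    interpret e: ext_map k VV.Z "sub U" R' ?\<mu> using VV.tensor_module_module Um R' \<mu>
      by (rule ext_map.intro)
    note hV = hat_amap[OF V' R' S h f] and hVp = hat_pt[OF V' R' S h f]
    note L = amap_comp[OF amap_comp[OF TI.J_amap e.V\<phi>_amap] hat_amap[OF U' R' S h f]]
    have mr: "amap S S (\<lambda>u. u \<otimes>\<^bsub>S\<^esub> v)" and ml: "amap S S (\<lambda>u. v \<otimes>\<^bsub>S\<^esub> u)" if "v \<in> carrier S" for v
      using that by (simp_all add: amap_def S.l_distr S.r_distr)
    have pt2: "amap TI.VR.Z TI.TR.Z (TI.TR.pt x)" if "x \<in> carrier (tensor_group k (sub V) R')" for x
      using balanced_amap2[OF TI.TR.pt_balanced, of x] that by (simp add: TI.VR.amap_E)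
    have pt1: "amap TI.VR.Z TI.TR.Z (\<lambda>x. TI.TR.pt x y)"
      if "y \<in> carrier (tensor_group k (sub V) R')" for y
      using balanced_amap1[OF TI.TR.pt_balanced, of y] that by (simp add: TI.VR.amap_E)
    show ?thesis
    proof (rule TI.VR.amap_tensor_eqI[where P = S and z = x])
      show "amap TI.VR.Z S (\<lambda>x. hat U R' S h f (e.V\<phi> (TI.J (TI.TR.pt x y))))"
        by (rule amap_comp[OF pt1[OF y] L])
      show "amap TI.VR.Z S (\<lambda>x. hat V R' S h f x \<otimes>\<^bsub>S\<^esub> hat V R' S h f y)"
        by (rule amap_comp[OF hV mr[OF hat_closed[OF V' R' S h f y]]])
      show "hat U R' S h f (e.V\<phi> (TI.J (TI.TR.pt (TI.VR.pt v r) y)))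
          = hat V R' S h f (TI.VR.pt v r) \<otimes>\<^bsub>S\<^esub> hat V R' S h f y"
        if "v \<in> carrier (sub V)" and r: "r \<in> carrier R'" for v r
      proof (rule TI.VR.amap_tensor_eqI[where P = S and z = y])
        have v: "v \<in> V" using that by simp
        have vr: "TI.VR.pt v r \<in> carrier (tensor_group k (sub V) R')" using v r by simp
        show "amap TI.VR.Z S (\<lambda>y. hat U R' S h f (e.V\<phi> (TI.J (TI.TR.pt (TI.VR.pt v r) y))))"
          by (rule amap_comp[OF pt2[OF vr] L])
        show "amap TI.VR.Z S (\<lambda>y. hat V R' S h f (TI.VR.pt v r) \<otimes>\<^bsub>S\<^esub> hat V R' S h f y)"
          by (rule amap_comp[OF hV ml[OF hat_closed[OF V' R' S h f vr]]])
        show "hat U R' S h f (e.V\<phi> (TI.J (TI.TR.pt (TI.VR.pt v r) (TI.VR.pt w s))))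
            = hat V R' S h f (TI.VR.pt v r) \<otimes>\<^bsub>S\<^esub> hat V R' S h f (TI.VR.pt w s)"
          if "w \<in> carrier (sub V)" and s: "s \<in> carrier R'" for w s
        proof -
          have w: "w \<in> V" using that by simp
          have "h v \<in> carrier S" "h w \<in> carrier S" "f r \<in> carrier S" "f s \<in> carrier S"
            using alg_homD(4)[OF h Vc[OF v]] alg_homD(4)[OF h Vc[OF w]] alg_homD(4)[OF f r]
                alg_homD(4)[OF f s] by simp_all
          then show ?thesis
            using v r w s VU[OF v w] alg_homD(6)[OF h Vc[OF v] Vc[OF w]] alg_homD(6)[OF f r s]
            by (simp add: TI.J_pt e.V\<phi>_pt \<mu>p hat_pt[OF U' R' S h f] hVp S.m_ac)
        qed
      qed (use y in simp)
    qed (use x in simp)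
  qed
  have comp: "tensor_map k (space T) R' (sub U) R' \<psi> (\<lambda>r. r) (tensor_map k VV.Z R' (space T) R' \<phi>
      (\<lambda>r. r) z)
      = tensor_map k VV.Z R' (sub U) R' ?\<mu> (\<lambda>r. r) z"
    if R': "algebra k R'" and z: "z \<in> carrier (tensor_group k VV.Z R')"
      for R' :: "('u, 'u) module" and z
    by (rule ext_map_comp[OF VV.tensor_module_module Tm Um R' \<phi>h \<psi> \<mu> \<psi>\<phi> z])
  \<comment> \<open>The translate of a product is the product of the translates:
    \<open>hat_J\<close> is applied at \<open>h\<close> to the translated factors, and at the
    product of \<open>h\<close> with \<open>g\<close> to the original ones.\<close>
  have \<psi>rep: "\<psi> \<in> rep_hom k G T (reg U)"
  proof (rule rep_hom_regI[OF U RepD(1)[OF T] \<psi>])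
    fix R' S :: "('u, 'u) module" and g t h f
    assume R': "algebra k R'" and g: "g \<in> carrier (fob G R')"
      and t: "t \<in> carrier (tensor_group k (space T) R')"
      and S: "algebra k S" and h: "h \<in> H S" and f: "f \<in> alg_hom k R' S"
    interpret S: algebra k S by fact
    interpret TI: tens_iso k "sub V" "sub V" R' using sub_module[OF V'] sub_module[OF V'] R'
      by (rule tens_iso.intro)
    interpret e: ext_map k VV.Z "sub U" R' ?\<mu> using VV.tensor_module_module Um R' \<mu>
      by (rule ext_map.intro)
    interpret ep: ext_map k VV.Z "space T" R' \<phi> using VV.tensor_module_module Tm R' \<phi>h
      by (rule ext_map.intro)
    let ?MM = "tensor_map R' TI.VR.E TI.VR.E TI.VR.E TI.VR.E (act ?X R' g) (act ?X R' g)"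
    have hg: "pm S h (cmp f (gi R' g)) \<in> H S"
      by (rule pm_closed[OF S h cmp_closed[OF f gi_closed[OF R' g]]])
    obtain z where z: "z \<in> carrier (tensor_group k VV.Z R')" "t = ep.V\<phi> z"
      using ext_map_bij[OF VV.tensor_module_module Tm R' \<phi>h \<phi>b] t by (auto simp: bij_betw_def)
    obtain w where w: "w \<in> carrier (tensor_group R' TI.VR.E TI.VR.E)" "z = TI.J w"
      using TI.J_bij z(1) by (auto simp: bij_betw_def)
    have MMa: "amap TI.TR.Z TI.TR.Z ?MM" using rp.MM_amap[OF R' g] by (simp add: fibre_def)
    have MMw: "?MM w \<in> carrier (tensor_group R' TI.VR.E TI.VR.E)" using amap_closed[OF MMa] w
      by simp
    have "act T R' g (ep.V\<phi> (TI.J w)) = ep.V\<phi> (act (tensor_rep k ?X ?X) R' g (TI.J w))"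
      using \<phi> R' g TI.J_closed[OF w(1)]
        by (simp add: rep_iso_def rep_hom_def fibre_def fibre_map_def tensor_rep_def)
    also have "act (tensor_rep k ?X ?X) R' g (TI.J w) = TI.J (?MM w)"
      using rp.tensor_rep_act[OF R', of w g] w(1) by (simp add: fibre_def)
    finally have act: "act T R' g t = ep.V\<phi> (TI.J (?MM w))" using z w by simp
    have "hat U R' S h f (e.V\<phi> (TI.J (?MM w)))
        = hat U R' S (pm S h (cmp f (gi R' g))) f (e.V\<phi> (TI.J w))"
    proof (rule TI.TR.amap_tensor_eqI[where P = S and z = w])
      show "amap TI.TR.Z S (\<lambda>w. hat U R' S h f (e.V\<phi> (TI.J (?MM w))))"
        by (rule amap_comp[OF MMa
            amap_comp[OF amap_comp[OF TI.J_amap e.V\<phi>_amap] hat_amap[OF U' R' S h f]]])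
      show "amap TI.TR.Z S (\<lambda>w. hat U R' S (pm S h (cmp f (gi R' g))) f (e.V\<phi> (TI.J w)))"
        by (rule amap_comp[OF amap_comp[OF TI.J_amap e.V\<phi>_amap] hat_amap[OF U' R' S hg f]])
      show "hat U R' S h f (e.V\<phi> (TI.J (?MM (TI.TR.pt x y))))
          = hat U R' S (pm S h (cmp f (gi R' g))) f (e.V\<phi> (TI.J (TI.TR.pt x y)))"
        if "x \<in> carrier TI.VR.E" "y \<in> carrier TI.VR.E" for x y
      proof -
        have x: "x \<in> carrier (tensor_group k (sub V) R')"
          and y: "y \<in> carrier (tensor_group k (sub V) R')" using that by simp_all
        have "?MM (TI.TR.pt x y) = TI.TR.pt (act ?X R' g x) (act ?X R' g y)"
          using rp.MM_pt[OF R' g, of x y] x y by (simp add: fibre_def)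
        then show ?thesis
          by (simp add: hat_J[OF R' S h f reg_act_closed[OF V R' g x] reg_act_closed[OF V R' g y]]
              hat_J[OF R' S hg f x y] hat_reg_act[OF V R' g x S h f] hat_reg_act[OF V R' g y S h f])
      qed
    qed (use w in simp)
    moreover have "tensor_map k (space T) R' (sub U) R' \<psi> (\<lambda>r. r) (act T R' g t)
        = e.V\<phi> (TI.J (?MM w))"
      unfolding act by (rule comp[OF R' TI.J_closed[OF MMw]])
    moreover have "tensor_map k (space T) R' (sub U) R' \<psi> (\<lambda>r. r) t = e.V\<phi> (TI.J w)"
      unfolding z(2) w(2)[symmetric] by (rule comp[OF R' z(1)])
    ultimately show "hat U R' S h f (tensor_map k (space T) R' (sub U) R' \<psi> (\<lambda>r. r) (act T R' g t))
        = hat U R' S (pm S h (cmp f (gi R' g))) f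
            (tensor_map k (space T) R' (sub U) R' \<psi> (\<lambda>r. r) t)"
      by simp
  qed
  interpret TI: tens_iso k "sub V" "sub V" R using sub_module[OF V'] sub_module[OF V'] R
    by (rule tens_iso.intro)
  interpret ep: ext_map k VV.Z "space T" R \<phi> using VV.tensor_module_module Tm R \<phi>h
    by (rule ext_map.intro)
  let ?x = "\<theta> ?X (TI.VR.pt a \<one>\<^bsub>R\<^esub>)" and ?y = "\<theta> ?X (TI.VR.pt b \<one>\<^bsub>R\<^esub>)"
  have x: "?x \<in> carrier (tensor_group k (sub V) R)" and y: "?y \<in> carrier (tensor_group k (sub V) R)"
    by (rule \<theta>_reg_closed[OF V sub_pt_closed[OF V a]],
        rule \<theta>_reg_closed[OF V sub_pt_closed[OF V b]])
  let ?w = "TI.TR.pt (TI.VR.pt a \<one>\<^bsub>R\<^esub>) (TI.VR.pt b \<one>\<^bsub>R\<^esub>)"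
  have w: "?w \<in> carrier (tensor_group R TI.VR.E TI.VR.E)" using a b by simp
  have t: "ep.EW.pt (\<phi> (VV.pt a b)) \<one>\<^bsub>R\<^esub> = ep.V\<phi> (TI.J ?w)" using a b
    by (simp add: TI.J_pt ep.V\<phi>_pt)
  have \<theta>X: "\<theta> ?X \<in> module_hom R TI.VR.E TI.VR.E" using \<theta>_hom[OF reg_Rep[OF V]] by simp
  have "\<theta> T (ep.V\<phi> (TI.J ?w))
      = ep.V\<phi> (TI.J (tensor_map R TI.VR.E TI.VR.E TI.VR.E TI.VR.E (\<theta> ?X) (\<theta> ?X) ?w))"
    using \<theta>_tensor[OF reg_Rep[OF V] reg_Rep[OF V] T \<phi>, of ?w] w by simp
  also have "tensor_map R TI.VR.E TI.VR.E TI.VR.E TI.VR.E (\<theta> ?X) (\<theta> ?X) ?w = TI.TR.pt ?x ?y"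
    using tensor_map_pt[OF TI.VR.ext_module TI.VR.ext_module TI.VR.ext_module TI.VR.ext_module \<theta>X
        \<theta>X] a b by simp
  finally have \<theta>T: "\<theta> T (ep.EW.pt (\<phi> (VV.pt a b)) \<one>\<^bsub>R\<^esub>) = ep.V\<phi> (TI.J (TI.TR.pt ?x ?y))"
    by (simp add: t)
  have "\<phi> (VV.pt a b) \<in> carrier (space T)" using module_hom_in[OF \<phi>h, of "VV.pt a b"] a b by simp
  from lam_push[OF U T \<psi>rep this]
  have "lam U (\<psi> (\<phi> (VV.pt a b)))
      = ev U (tensor_map k VV.Z R (sub U) R ?\<mu> (\<lambda>r. r) (TI.J (TI.TR.pt ?x ?y)))"
    using x y by (simp add: \<theta>T comp[OF R] TI.J_closed)
  also have "\<dots> = lam V a \<otimes>\<^bsub>R\<^esub> lam V b"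
    using hat_J[OF R R pe_id x y] by (simp add: lam_def)
  also have "\<psi> (\<phi> (VV.pt a b)) = a \<otimes>\<^bsub>A\<^esub> b"
    using \<psi>\<phi>[of "VV.pt a b"] \<mu>p[of a b] a b by simp
  finally show ?thesis .
qed

lemma lambda_hom: "lambda \<in> H R"
proof (rule alg_homI)
  show "lambda \<in> extensional (carrier A)" by (simp add: lambda_def)
  show "lambda x \<in> carrier R" if x: "x \<in> carrier A" for x
  proof -
    obtain V where "stable V" "x \<in> V" by (rule stable_exists[OF x])
    then show ?thesis by (simp add: lambda_eq lam_closed)
  qed
  fix x y assume x: "x \<in> carrier A" and y: "y \<in> carrier A"
  obtain V where V: "stable V" "x \<in> V" "y \<in> V" using stable_finite[of "{x, y}"] x y by auto
  interpret V: submodule k V A by (rule stable_submodule[OF V(1)])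
  show "lambda (x \<oplus>\<^bsub>A\<^esub> y) = lambda x \<oplus>\<^bsub>R\<^esub> lambda y"
    using V by (simp add: lambda_eq[OF V(1)] lam_linear)
  obtain U where U: "stable U" "\<And>v w. v \<in> V \<Longrightarrow> w \<in> V \<Longrightarrow> v \<otimes>\<^bsub>A\<^esub> w \<in> U" using stable_product[OF V(1)]
    by blast
  show "lambda (x \<otimes>\<^bsub>A\<^esub> y) = lambda x \<otimes>\<^bsub>R\<^esub> lambda y"
    using lam_mult[OF V(1) U V(2,3)] V U by (simp add: lambda_eq[OF V(1)] lambda_eq[OF U(1)])
next
  obtain U where "stable U" "\<one>\<^bsub>A\<^esub> \<in> U" by (rule stable_exists[OF A.one_closed])
  then show "lambda \<one>\<^bsub>A\<^esub> = \<one>\<^bsub>R\<^esub>" by (simp add: lambda_eq lam_one)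
next
  fix c x assume c: "c \<in> carrier k" and x: "x \<in> carrier A"
  obtain V where V: "stable V" "x \<in> V" by (rule stable_exists[OF x])
  interpret V: submodule k V A by (rule stable_submodule[OF V(1)])
  show "lambda (c \<odot>\<^bsub>A\<^esub> x) = c \<odot>\<^bsub>R\<^esub> lambda x"
    using V c by (simp add: lambda_eq[OF V(1)] lam_linear)
qed

text \<open>Every vector is determined by its matrix coefficients, and those are morphisms into regular
  subrepresentations, where \<open>\<theta>\<close> is described by \<open>lambda\<close>.\<close>

lemma \<theta>_eq_act:
  assumes X: "X \<in> Rep k G"
  shows "\<theta> X = act X R (\<eta> R lambda)"
proof -
  note Xr = RepD(1)[OF X]
  interpret X: vectorspace k "space X" by (rule rep_vectorspace[OF Xr])
  interpret W: whole_slice k "space X" R using X.vectorspace_axioms R by (rule whole_slice.intro)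
  interpret B: base_chg k "space X" R R idR using X.module_axioms R R idR_hom
    by (rule base_chg.intro)
  note g = \<eta>_closed[OF R lambda_hom]
  \<comment> \<open>\<open>hat_coeff\<close> introduces a base change along the identity of
    \<open>R\<close>, which has to be recognised as trivial.\<close>
  have bid: "B.Vf z = z" if z: "z \<in> carrier (tensor_group k (space X) R)" for z
  proof (rule W.amap_tensor_eqI[where P = W.Z and z = z])
    show "amap W.Z W.Z B.Vf" by (rule B.Vf_amap)
    show "B.Vf (W.pt v r) = W.pt v r" if "v \<in> carrier (space X)" "r \<in> carrier R" for v r
      using B.Vf_pt[OF that] that by simp
  qed (use z in \<open>simp_all add: amap_id\<close>)
  have pts: "\<theta> X (W.pt x \<one>\<^bsub>R\<^esub>) = act X R (\<eta> R lambda) (W.pt x \<one>\<^bsub>R\<^esub>)" if x: "x \<in> carrier (space X)"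
    for x
  proof (rule W.wslice_eqI)
    have px: "W.pt x \<one>\<^bsub>R\<^esub> \<in> carrier (tensor_group k (space X) R)" using x by simp
    show \<theta>c: "\<theta> X (W.pt x \<one>\<^bsub>R\<^esub>) \<in> carrier (tensor_group k (space X) R)" by (rule \<theta>_closed[OF X px])
    show "act X R (\<eta> R lambda) (W.pt x \<one>\<^bsub>R\<^esub>) \<in> carrier (tensor_group k (space X) R)"
      by (rule act_closed[OF Xr R g px])
    fix \<xi> assume \<xi>: "\<xi> \<in> functionals k (space X)"
    obtain U where U: "stable U" "coeff X \<xi> ` carrier (space X) \<subseteq> U"
      by (rule stable_spanning[OF X.vectorspace_axioms RepD(2)[OF X] coeff_hom[OF Xr \<xi>]])
    \<comment> \<open>At the unit point of the group, the coefficient map followed by evaluation is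
      contraction by \<xi>; \<open>lam\<close> of a coefficient function is therefore the
      contraction of \<theta>(x \<otimes> 1).\<close>
    have "lam U (coeff X \<xi> x) = W.wslice \<xi> (act X R (\<eta> R (pe R)) (B.Vf (\<theta> X (W.pt x \<one>\<^bsub>R\<^esub>))))"
      using lam_push[OF U(1) X coeff_rep_hom[OF Xr \<xi> U] x] hat_coeff[OF Xr \<xi> U R R pe_id \<theta>c] by simp
    also have "\<dots> = W.wslice \<xi> (\<theta> X (W.pt x \<one>\<^bsub>R\<^esub>))"
      by (simp add: bid[OF \<theta>c] \<eta>_pe[OF R] act_one[OF Xr R \<theta>c])
    finally have "W.wslice \<xi> (\<theta> X (W.pt x \<one>\<^bsub>R\<^esub>)) = lambda (coeff X \<xi> x)"
      using lambda_eq[OF U(1), of "coeff X \<xi> x"] U(2) x by auto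
    then show "W.wslice \<xi> (\<theta> X (W.pt x \<one>\<^bsub>R\<^esub>)) = W.wslice \<xi> (act X R (\<eta> R lambda) (W.pt x \<one>\<^bsub>R\<^esub>))"
      by (simp add: coeff_point[OF Xr \<xi> R lambda_hom x])
  qed
  show ?thesis
  proof (rule extensionalityI[OF \<theta>_ext[OF X]])
    show "act X R (\<eta> R lambda) \<in> extensional (carrier (tensor_group k (space X) R))"
      using act_ext[OF Xr R g] by simp
    show "\<theta> X z = act X R (\<eta> R lambda) z" if "z \<in> carrier (tensor_group k (space X) R)" for z
      by (rule W.module_hom_eqI[OF \<theta>_hom[OF X] act_hom[OF Xr R g]]) (use that pts in simp_all)
  qed
qed

end

section \<open>The canonical isomorphism and its consequences\<close>

lemma canonical_surj:
  assumes R: "algebra k R" and \<theta>: "\<theta> \<in> carrier (fob (Aut_tensor k G) R)"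
  shows "\<exists>g\<in>carrier (fob G R). \<theta> = canonical_map k G R g"
proof -
  have \<theta>': "natural_aut k G R \<theta>" "monoidal k G R \<theta>" "\<theta> \<in> extensional (Rep k G)"
    using \<theta> by (simp_all add: Aut_tensor_def)
  have "\<theta> = canonical_map k G R (\<eta> R (lambda R \<theta>))"
    by (rule extensionalityI[OF \<theta>'(3)]) (simp_all add: canonical_map_def \<theta>_eq_act[OF R \<theta>'(1,2)])
  then show ?thesis using \<eta>_closed[OF R lambda_hom[OF R \<theta>'(1,2)]] by blast
qed

text \<open>Regular representations recover the point: evaluating the translate of \<open>a\<close>
  by \<open>g\<close> at the unit gives a(g), and every \<open>a\<close> lies in some stable
  subspace.\<close>

lemma canonical_inj:
  assumes R: "algebra k R" and g: "g \<in> carrier (fob G R)" and g': "g' \<in> carrier (fob G R)"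
    and eq: "canonical_map k G R g = canonical_map k G R g'"
  shows "g = g'"
proof -
  interpret R: algebra k R by fact
  let ?id = "\<lambda>r\<in>carrier R. r"
  note id = alg_hom_id[OF R] and pe = pe_closed[OF R]
  have ev: "gi R g a = hat V R R (pe R) ?id (act (reg V) R g (pure_tensor k (sub V) R a \<one>\<^bsub>R\<^esub>))"
    if V: "stable V" and a: "a \<in> V" and g: "g \<in> carrier (fob G R)" for V a g
  proof -
    note V' = stable_submodule[OF V]
    interpret E: ext_scal k "sub V" R using sub_module[OF V'] R by (rule ext_scal.intro)
    have "E.pt a \<one>\<^bsub>R\<^esub> \<in> carrier (tensor_group k (sub V) R)" using a by simp
    from hat_reg_act[OF V R g this R pe id]
    have "hat V R R (pe R) ?id (act (reg V) R g (E.pt a \<one>\<^bsub>R\<^esub>))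
        = hat V R R (gi R g) ?id (E.pt a \<one>\<^bsub>R\<^esub>)"
      by (simp add: compose_restrict_id[OF gi_closed[OF R g]] pm_pe(2)[OF R gi_closed[OF R g]])
    moreover have "a \<in> carrier A" using a V' by (auto simp: submodule_def)
    ultimately show ?thesis
      using hat_pt[OF V' R R gi_closed[OF R g] id a, of "\<one>\<^bsub>R\<^esub>"]
          alg_homD(4)[OF gi_closed[OF R g], of a] by simp
  qed
  have "gi R g = gi R g'"
  proof (rule extensionalityI[OF alg_homD(3)[OF gi_closed[OF R g]]
      alg_homD(3)[OF gi_closed[OF R g']]])
    fix a assume a: "a \<in> carrier A"
    obtain V where V: "stable V" "a \<in> V" by (rule stable_exists[OF a])
    have "act (reg V) R g = act (reg V) R g'"
      using fun_cong[OF eq, of "reg V"] reg_Rep[OF V(1)] by (simp add: canonical_map_def)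
    then show "gi R g a = gi R g' a" by (simp add: ev[OF V g] ev[OF V g'])
  qed
  from arg_cong[OF this, of "\<eta> R"] show ?thesis unfolding \<eta>_gi[OF R g] \<eta>_gi[OF R g'] .
qed

lemma canonical_iso:
  assumes R: "algebra k R"
  shows "canonical_map k G R \<in> iso (fob G R) (fob (Aut_tensor k G) R)"
proof (rule isoI)
  show "canonical_map k G R \<in> hom (fob G R) (fob (Aut_tensor k G) R)"
    by (rule homI[OF canonical_in_Aut[OF R] canonical_mult[OF R]])
  show "bij_betw (canonical_map k G R) (carrier (fob G R)) (carrier (fob (Aut_tensor k G) R))"
    unfolding bij_betw_def
  proof
    show "inj_on (canonical_map k G R) (carrier (fob G R))"
      by (rule inj_onI) (rule canonical_inj[OF R])
    show "canonical_map k G R ` carrier (fob G R) = carrier (fob (Aut_tensor k G) R)"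
    proof
      show "canonical_map k G R ` carrier (fob G R) \<subseteq> carrier (fob (Aut_tensor k G) R)"
        by (rule image_subsetI) (rule canonical_in_Aut[OF R])
      show "carrier (fob (Aut_tensor k G) R) \<subseteq> canonical_map k G R ` carrier (fob G R)"
      proof
        fix \<theta> assume "\<theta> \<in> carrier (fob (Aut_tensor k G) R)"
        then obtain g where "g \<in> carrier (fob G R)" "\<theta> = canonical_map k G R g"
          using canonical_surj[OF R] by metis
        then show "\<theta> \<in> canonical_map k G R ` carrier (fob G R)" by (intro image_eqI)
      qed
    qed
  qed
qed

text \<open>The group axioms come from \<open>G\<close> along the bijective multiplicative map, so
  there is no separate check that inverses of monoidal automorphisms are natural and
  monoidal.\<close>

lemma Aut_group:
  assumes R: "algebra k R" shows "group (fob (Aut_tensor k G) R)"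
proof -
  let ?c = "canonical_map k G R" and ?Aut = "fob (Aut_tensor k G) R"
  interpret GR: group "fob G R" by (rule G_group[OF R])
  have im: "?c ` carrier (fob G R) = carrier ?Aut"
    using canonical_iso[OF R] by (simp add: iso_def bij_betw_def)
  have "?c \<one>\<^bsub>fob G R\<^esub> = \<one>\<^bsub>?Aut\<^esub>"
  proof
    fix X show "?c \<one>\<^bsub>fob G R\<^esub> X = \<one>\<^bsub>?Aut\<^esub> X"
    proof (cases "X \<in> Rep k G")
      case True
      have "act X R \<one>\<^bsub>fob G R\<^esub> = (\<lambda>x\<in>carrier (fibre k R X). x)"
        by (rule extensionalityI[OF act_ext[OF RepD(1)[OF True] R GR.one_closed]])
          (use act_one[OF RepD(1)[OF True] R] in \<open>simp_all add: fibre_def\<close>)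
      then show ?thesis using True by (simp add: canonical_map_def Aut_tensor_def)
    qed (simp add: canonical_map_def Aut_tensor_def)
  qed
  \<comment> \<open>The image of a group under a homomorphism is a group with the image of the unit
    as its unit; here carrier and unit are those already given.\<close>
  then have "?Aut\<lparr>carrier := ?c ` carrier (fob G R), one := ?c \<one>\<^bsub>fob G R\<^esub>\<rparr> = ?Aut"
    by (simp add: im)
  then show ?thesis
    using GR.hom_imp_img_group[of ?c ?Aut] canonical_iso[OF R] by (simp add: iso_def)
qed

text \<open>Every element is the image of a point, and the canonical map is natural, so the functor
  laws are inherited from \<open>G\<close>.\<close>

lemma Aut_group_functor: "group_functor k (Aut_tensor k G)"
proof -
  let ?c = "canonical_map k G" and ?F = "Aut_tensor k G"
  note mor = canonical_nat[symmetric]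
  have mc: "fmor ?F R S f (?c R g) \<in> carrier (fob ?F S)"
    if "algebra k R" "algebra k S" "f \<in> alg_hom k R S" "g \<in> carrier (fob G R)" for R S f g
    using mor[OF that] canonical_in_Aut[OF that(2) G_closed[OF that]] by simp
  show ?thesis
    unfolding group_functor_def
  proof (intro conjI allI impI ballI)
    show "group (fob ?F R)" if "algebra k R" for R by (rule Aut_group[OF that])
    show "fmor ?F R S f \<in> hom (fob ?F R) (fob ?F S)"
      if R: "algebra k R" and S: "algebra k S" and f: "f \<in> alg_hom k R S" for R S f
    proof (rule homI)
      fix x assume "x \<in> carrier (fob ?F R)"
      then obtain g where g: "g \<in> carrier (fob G R)" "x = ?c R g" using canonical_surj[OF R]
        by blast
      show "fmor ?F R S f x \<in> carrier (fob ?F S)" using mc[OF R S f g(1)] g(2) by simp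
      fix y assume "y \<in> carrier (fob ?F R)"
      then obtain h where h: "h \<in> carrier (fob G R)" "y = ?c R h" using canonical_surj[OF R]
        by blast
      interpret GR: group "fob G R" by (rule G_group[OF R])
      show "fmor ?F R S f (x \<otimes>\<^bsub>fob ?F R\<^esub> y) = fmor ?F R S f x \<otimes>\<^bsub>fob ?F S\<^esub> fmor ?F R S f y"
        using g h GR.m_closed[OF g(1) h(1)] hom_mult[OF G_mor[OF R S f] g(1) h(1)]
        by (simp add: mor[OF R S f] canonical_mult[OF R, symmetric]
            canonical_mult[OF S G_closed[OF R S f g(1)] G_closed[OF R S f h(1)], symmetric])
    qed
    show "fmor ?F R R (\<lambda>r\<in>carrier R. r) x = x" if R: "algebra k R" and x: "x \<in> carrier (fob ?F R)"
      for R x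
    proof -
      obtain g where "g \<in> carrier (fob G R)" "x = ?c R g" using canonical_surj[OF R x] by blast
      then show ?thesis by (simp add: mor[OF R R alg_hom_id[OF R]] G_id[OF R])
    qed
    show "fmor ?F R T (compose (carrier R) g f) x = fmor ?F S T g (fmor ?F R S f x)"
      if R: "algebra k R" and S: "algebra k S" and T: "algebra k T" and f: "f \<in> alg_hom k R S"
        and g: "g \<in> alg_hom k S T" and x: "x \<in> carrier (fob ?F R)" for R S T f g x
    proof -
      obtain a where a: "a \<in> carrier (fob G R)" "x = ?c R a" using canonical_surj[OF R x] by blast
      then show ?thesis
        by (simp add: mor[OF R S f a(1)] mor[OF S T g G_closed[OF R S f a(1)]]
            mor[OF R T alg_hom_compose[OF f g R] a(1)] G_comp[OF R S T f g a(1)])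
    qed
  qed
qed

text \<open>The same algebra \<open>A\<close> serves, through \<eta> followed by the canonical
  map.\<close>

lemma Aut_representable: "representable k (Aut_tensor k G)"
  unfolding representable_def
proof (intro exI conjI allI impI ballI)
  let ?\<eta> = "\<lambda>R p. canonical_map k G R (\<eta> R p)"
  show "algebra k A" by (rule A)
  show "bij_betw (?\<eta> R) (H R) (carrier (fob (Aut_tensor k G) R))" if R: "algebra k R" for R
    using bij_betw_trans[OF \<eta>_bij[OF R], of "canonical_map k G R"] canonical_iso[OF R]
    by (simp add: iso_def comp_def)
  show "?\<eta> S (cmp f u) = fmor (Aut_tensor k G) R S f (?\<eta> R u)"
    if "algebra k R" "algebra k S" "f \<in> alg_hom k R S" "u \<in> H R" for R S f u
    using canonical_nat[OF that(1-3) \<eta>_closed[OF that(1,4)]] \<eta>_nat[OF that] by simp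
qed

end

theorem proposition3p2p13:
  fixes k :: "'u::infinite ring"
    and G :: "('u, 'g) gfunctor"
  assumes "field k"
    and "affine_group_scheme k G"
  shows "gfunctor_iso k G (Aut_tensor k G) (canonical_map k G)
       \<and> affine_group_scheme k (Aut_tensor k G)"
proof -
  have G: "group_functor k G" and rep: "representable k G"
    using assms(2) by (simp_all add: affine_group_scheme_def)
  obtain A \<eta> where "algebra k A"
    and "\<And>R. algebra k R \<Longrightarrow> bij_betw (\<eta> R) (alg_hom k A R) (carrier (fob G R))"
    and "\<And>R S f u. algebra k R \<Longrightarrow> algebra k S \<Longrightarrow> f \<in> alg_hom k R S \<Longrightarrow> u \<in> alg_hom k A R \<Longrightarrow>
      \<eta> S (compose (carrier A) f u) = fmor G R S f (\<eta> R u)"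
    using rep unfolding representable_def by blast
  then interpret affine k G A \<eta>
    using assms(1) G by (intro affine.intro gfun.intro affine_axioms.intro)
  show ?thesis
    using canonical_iso canonical_nat Aut_group_functor Aut_representable
    by (simp add: gfunctor_iso_def gfunctor_hom_def affine_group_scheme_def iso_def)
qed

end
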